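(* Let $\mathbb{H}=\{(x,\dots,x):x\in\mathbb{R}\}$ be the diagonal line in $\mathbb{R}^d$. Let $\xi=(\xi^1,\dots,\xi^d)$ be an $\mathbb{R}^d$-valued Gaussian process on $\mathbb{R}$ such that $\langle v,\xi\rangle$ is not stationary for some $v\notin\mathbb{H}$, and let $\Lambda$ be a nonzero locally finite measure on $\mathbb{H}$. Then $\Lambda$ and $\xi$ generate a stationary particle system if and only if, for some $\lambda\in\mathbb{R}$, $\Lambda$ is proportional to $\mathfrak{e}_\lambda^{\mathbb{H}}$, $$\bar\xi(t)=\begin{cases}W(t)+b(t)+c&\text{if }\lambda=0,\\ W(t)-\frac12\lambda\sigma^2(t)+c&\text{if }\lambda\ne0,\end{cases}$$ where $W(t)$, $t\in\mathbb{R}$, is a centred univariate Gaussian process with stationary increments and variance $\sigma^2(t)$, $b$ is an additive univariate function, $c\in\mathbb{R}$ is a constant, and $\xi^{\mathbb{H}},\xi^\perp$ satisfy the following conditions, where $\boldsymbol\lambda=\lambda d^{-1}(1,\dots,1)\in\mathbb{H}$: (ii) $\xi^\perp-m^\perp$ is stationary; (iii) $C(t_1,t_1)-C(t_2,t_1)=C(t_1+s,t_1+s)-C(t_2+s,t_1+s)$ for all $s,t_1,t_2\in\mathbb{R}$; (iv) $m^\perp(t_2)+C(t_1,t_2)^\top\boldsymbol\lambda=m^\perp(t_2+s)+C(t_1+s,t_2+s)^\top\boldsymbol\lambda$ for all $s,t_1,t_2\in\mathbb{R}$.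
   Context: For $\lambda\in\mathbb{R}$, $\mathfrak{e}_\lambda^{\mathbb{H}}$ denotes the measure on $\mathbb{H}$ with density $e^{-\lambda x}$ at the point $(x,\dots,x)$ (equivalently $e^{-\langle\boldsymbol\lambda,z\rangle}$ at $z\in\mathbb{H}$), with respect to Lebesgue measure on the line. $\bar\xi=d^{-1}\sum_{i=1}^d\xi^i$; $\xi^{\mathbb{H}}$ (the orthogonal projection of $\xi$ onto $\mathbb{H}$) is the vector with all components equal to $\bar\xi$, and $\xi^\perp=\xi-\xi^{\mathbb{H}}$. $m^\perp(t)=\mathbf{E}\xi^\perp(t)$, and $C(t_1,t_2)$ is the covariance matrix of $\xi^{\mathbb{H}}(t_1)$ and $\xi^\perp(t_2)$, i.e. $\mathbf{E}[(\xi^{\mathbb{H}}(t_1)-\mathbf{E}\xi^{\mathbb{H}}(t_1))(\xi^\perp(t_2)-\mathbf{E}\xi^\perp(t_2))^\top]$. A function $b$ is additive if $b(t+s)=b(t)+b(s)$ for all $t,s$. The particle system generated by a measure $\Lambda$ on $\mathbb{R}^d$ and $\xi$ is $N(t)=\{x_i+\xi_i(t):\, i\ge1\}$, $t\in\mathbb{R}$, where $\{x_i\}$ is a Poisson point process on $\mathbb{R}^d$ with intensity measure $\Lambda$, independent of i.i.d. copies $\xi_1,\xi_2,\dots$ of $\xi$. Standing assumption: $\Lambda*P_t$ is locally finite for all $t\in\mathbb{R}$, where $P_t$ is the distribution of $\xi(t)$. The system is stationary if, for all $n\ge1$ and $s,t_1,\dots,t_n\in\mathbb{R}$, the point processes $N(t_1,\dots,t_n)=\{(x_i+\xi_i(t_1),\dots,x_i+\xi_i(t_n)):\,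 i\ge1\}$ and $N(t_1+s,\dots,t_n+s)$ in $\mathbb{R}^{dn}$ have the same distribution. *)

theory Defs
  imports "HOL-Probability.Probability"
begin

section \<open>Stochastic processes indexed by the real line\<close>

text \<open>The law of a process on the path space with the product (Kolmogorov) sigma-algebra. It is
  determined by the finite-dimensional distributions.\<close>

definition process_law ::
  "'a measure \<Rightarrow> (real \<Rightarrow> 'a \<Rightarrow> 'b::topological_space) \<Rightarrow> (real \<Rightarrow> 'b) measure" where
  "process_law M X = distr M (\<Pi>\<^sub>M t\<in>UNIV. borel) (\<lambda>\<omega> t. X t \<omega>)"

definition stationary_process ::
  "'a measure \<Rightarrow> (real \<Rightarrow> 'a \<Rightarrow> 'b::topological_space) \<Rightarrow> bool" where
  "stationary_process M X \<longleftrightarrow> (\<forall>s. process_law M (\<lambda>t. X (t + s)) = process_law M X)"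

definition stationary_increments ::
  "'a measure \<Rightarrow> (real \<Rightarrow> 'a \<Rightarrow> real) \<Rightarrow> bool" where
  "stationary_increments M X \<longleftrightarrow>
     (\<forall>s. process_law M (\<lambda>t \<omega>. X (t + s) \<omega> - X s \<omega>) = process_law M (\<lambda>t \<omega>. X t \<omega> - X 0 \<omega>))"

text \<open>Point masses count as (degenerate) Gaussian laws.\<close>

definition gaussian_rv :: "'a measure \<Rightarrow> ('a \<Rightarrow> real) \<Rightarrow> bool" where
  "gaussian_rv M X \<longleftrightarrow> X \<in> borel_measurable M \<and>
     (\<exists>\<mu>. distr M borel X = return borel \<mu> \<or>
          (\<exists>\<sigma>>0. distr M borel X = density lborel (normal_density \<mu> \<sigma>)))"

definition gaussian_process ::
  "'a measure \<Rightarrow> (real \<Rightarrow> 'a \<Rightarrow> 'b::euclidean_space) \<Rightarrow> bool" where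
  "gaussian_process M X \<longleftrightarrow> (\<forall>t. X t \<in> borel_measurable M) \<and>
     (\<forall>T u. finite T \<longrightarrow> gaussian_rv M (\<lambda>\<omega>. \<Sum>t\<in>T. u t \<bullet> X t \<omega>))"

definition cross_covariance ::
  "'a measure \<Rightarrow> ('a \<Rightarrow> real^'d) \<Rightarrow> ('a \<Rightarrow> real^'d) \<Rightarrow> real^'d^'d" where
  "cross_covariance M X Y =
     (\<chi> i j. \<integral>\<omega>. (X \<omega> - integral\<^sup>L M X) $ i * (Y \<omega> - integral\<^sup>L M Y) $ j \<partial>M)"


section \<open>The diagonal line\<close>

definition diagonal :: "(real^'d) set" where
  "diagonal = range vec"

definition coord_mean :: "real^'d \<Rightarrow> real" where
  "coord_mean x = (\<Sum>i\<in>UNIV. x $ i) / real CARD('d)"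

definition diag_part :: "real^'d \<Rightarrow> real^'d" where
  "diag_part x = vec (coord_mean x)"

definition perp_part :: "real^'d \<Rightarrow> real^'d" where
  "perp_part x = x - diag_part x"

definition diag_vec :: "real \<Rightarrow> real^'d" where
  "diag_vec l = vec (l / real CARD('d))"

text \<open>One-dimensional Lebesgue measure on the diagonal; the parametrisation has unit speed.\<close>

definition lebesgue_diagonal :: "(real^'d) measure" where
  "lebesgue_diagonal = distr lborel borel (\<lambda>u. vec (u / sqrt (real CARD('d))))"

text \<open>Since \<^term>\<open>diag_vec l \<bullet> vec x = l * x\<close>, the density at the point \<^term>\<open>vec x\<close>
  is \<^term>\<open>exp (- (l * x))\<close>.\<close>

definition exp_diagonal :: "real \<Rightarrow> (real^'d) measure" where
  "exp_diagonal l = density lebesgue_diagonal (\<lambda>z. ennreal (exp (- (diag_vec l \<bullet> z))))"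

definition locally_finite_measure :: "'b::topological_space measure \<Rightarrow> bool" where
  "locally_finite_measure \<Lambda> \<longleftrightarrow> sets \<Lambda> = sets borel \<and> (\<forall>K. compact K \<longrightarrow> emeasure \<Lambda> K < \<infinity>)"


section \<open>Point processes and particle systems\<close>

text \<open>A point process is a random counting measure: the family of points \<open>z i\<close>, \<open>i \<in> I\<close>,
  counted with multiplicity, is the image of the counting measure on \<open>I\<close> under \<open>z\<close>. The
  distribution of a point process on \<open>E\<close> is taken on the sigma-algebra generated by the
  evaluations at the measurable sets of \<open>E\<close>.\<close>

definition point_process_law ::
  "'o measure \<Rightarrow> 'e measure \<Rightarrow> ('o \<Rightarrow> 'e measure) \<Rightarrow> ('e set \<Rightarrow> ennreal) measure" where
  "point_process_law M E N =
     distr M (\<Pi>\<^sub>M B\<in>sets E. borel) (\<lambda>\<omega>. \<lambda>B\<in>sets E. emeasure (N \<omega>) B)"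

definition poisson_process :: "'o measure \<Rightarrow> 'e measure \<Rightarrow> ('o \<Rightarrow> 'e measure) \<Rightarrow> bool" where
  "poisson_process M \<Lambda> N \<longleftrightarrow>
     (\<forall>B\<in>sets \<Lambda>. (\<lambda>\<omega>. emeasure (N \<omega>) B) \<in> borel_measurable M) \<and>
     (\<forall>B\<in>sets \<Lambda>. emeasure \<Lambda> B < \<infinity> \<longrightarrow>
        (\<forall>k::nat. measure M {\<omega>\<in>space M. emeasure (N \<omega>) B = of_nat k} =
                  measure \<Lambda> B ^ k / fact k * exp (- measure \<Lambda> B))) \<and>
     (\<forall>B\<in>sets \<Lambda>. emeasure \<Lambda> B = \<infinity> \<longrightarrow> (AE \<omega> in M. emeasure (N \<omega>) B = \<infinity>)) \<and>
     (\<forall>(n::nat) B. (\<forall>i<n. B i \<in> sets \<Lambda>) \<and> disjoint_family_on B {..<n} \<longrightarrow>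
        prob_space.indep_vars M (\<lambda>_. borel) (\<lambda>i \<omega>. emeasure (N \<omega>) (B i)) {..<n})"

text \<open>A realisation on \<open>P\<close> of the data of the particle system generated by \<open>\<Lambda>\<close> and the
  process \<open>\<xi>\<close> on \<open>M\<close>: the starting points are the \<open>x i\<close> with \<open>i < K\<close>, where the random
  number \<open>K\<close> may be infinite (it is a.s. infinite or a.s. finite according to the total mass
  of \<open>\<Lambda>\<close>), and \<open>Y i\<close> is the copy of \<open>\<xi>\<close> attached to the \<open>i\<close>-th point. The enumerated
  points are jointly independent of the copies.\<close>

definition particle_data ::
  "(real^'d) measure \<Rightarrow> 'a measure \<Rightarrow> (real \<Rightarrow> 'a \<Rightarrow> real^'d) \<Rightarrow>
   'o measure \<Rightarrow> ('o \<Rightarrow> enat) \<Rightarrow> (nat \<Rightarrow> 'o \<Rightarrow> real^'d) \<Rightarrow> (nat \<Rightarrow> real \<Rightarrow> 'o \<Rightarrow> real^'d) \<Rightarrow> bool" where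
  "particle_data \<Lambda> M \<xi> P K x Y \<longleftrightarrow>
     prob_space P \<and>
     K \<in> measurable P (count_space UNIV) \<and>
     (\<forall>i. x i \<in> borel_measurable P) \<and>
     (\<forall>i t. Y i t \<in> borel_measurable P) \<and>
     poisson_process P \<Lambda> (\<lambda>\<omega>. distr (count_space {i. enat i < K \<omega>}) borel (\<lambda>i. x i \<omega>)) \<and>
     (\<forall>i. process_law P (Y i) = process_law M \<xi>) \<and>
     prob_space.indep_vars P (\<lambda>_. \<Pi>\<^sub>M t\<in>UNIV. borel) (\<lambda>i \<omega> t. Y i t \<omega>) UNIV \<and>
     prob_space.indep_set P
       (sets (vimage_algebra (space P) (\<lambda>\<omega>. (K \<omega>, \<lambda>i. x i \<omega>))
          (count_space UNIV \<Otimes>\<^sub>M (\<Pi>\<^sub>M i\<in>UNIV. borel))))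
       (sets (vimage_algebra (space P) (\<lambda>\<omega> i t. Y i t \<omega>)
          (\<Pi>\<^sub>M i\<in>UNIV. \<Pi>\<^sub>M t\<in>UNIV. borel)))"

text \<open>The point process \<open>N(t\<^sub>1, \<dots>, t\<^sub>n)\<close>, with the times indexed by \<open>0, \<dots>, n - 1\<close> and
  \<open>\<real>\<^sup>d\<^sup>n\<close> rendered as the \<open>n\<close>-fold product of \<open>\<real>\<^sup>d\<close>.\<close>

definition particle_system ::
  "('o \<Rightarrow> enat) \<Rightarrow> (nat \<Rightarrow> 'o \<Rightarrow> real^'d) \<Rightarrow> (nat \<Rightarrow> real \<Rightarrow> 'o \<Rightarrow> real^'d) \<Rightarrow>
   nat \<Rightarrow> (nat \<Rightarrow> real) \<Rightarrow> 'o \<Rightarrow> (nat \<Rightarrow> real^'d) measure" where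
  "particle_system K x Y n t \<omega> =
     distr (count_space {i. enat i < K \<omega>}) (\<Pi>\<^sub>M j\<in>{..<n}. borel)
       (\<lambda>i. \<lambda>j\<in>{..<n}. x i \<omega> + Y i (t j) \<omega>)"

definition stationary_particle_system ::
  "'o measure \<Rightarrow> ('o \<Rightarrow> enat) \<Rightarrow> (nat \<Rightarrow> 'o \<Rightarrow> real^'d) \<Rightarrow> (nat \<Rightarrow> real \<Rightarrow> 'o \<Rightarrow> real^'d) \<Rightarrow> bool" where
  "stationary_particle_system P K x Y \<longleftrightarrow>
     (\<forall>n\<ge>1. \<forall>s t. point_process_law P (\<Pi>\<^sub>M j\<in>{..<n}. borel) (particle_system K x Y n t) =
                   point_process_law P (\<Pi>\<^sub>M j\<in>{..<n}. borel) (particle_system K x Y n (\<lambda>j. t j + s)))"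

end

theory Submission
  imports Defs "HOL-Complex_Analysis.Conformal_Mappings"
begin

text \<open>
  Write \<open>\<eta>\<close> for the coordinate mean of \<open>\<xi>\<close> and \<open>\<zeta>\<close> for its part orthogonal to the diagonal. The proof
  has four steps.

  \<^emph>\<open>Reduction to intensities.\<close> Let \<open>Q\<^sub>t\<close> be the image of \<open>\<Lambda> \<otimes> M\<close> under
  \<open>(x, \<omega>) \<mapsto> (x + \<xi>(t\<^sub>1), \<dots>, x + \<xi>(t\<^sub>n))\<close>. Since independent displacements of a Poisson process give
  a Poisson process, \<open>E exp (- \<integral> H dN(t)) = exp (- \<integral> (1 - exp (- H)) dQ\<^sub>t)\<close> for all \<open>H \<ge> 0\<close>. Taking
  \<open>H = \<infinity> \<cdot> 1\<^sub>B\<close> recovers \<open>Q\<^sub>t(B)\<close>, and finite sums \<open>H = \<Sum> p\<^sub>B \<cdot> 1\<^sub>B\<close> determine the joint law of the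
  counts. So the system is stationary if and only if every \<open>Q\<^sub>t\<close> is invariant under time shifts
  (\<open>stationary_particle_system_iff\<close>).

  \<^emph>\<open>Quasi-invariance.\<close> A linear functional \<open>\<Theta>(z) = \<Sum> a\<^sub>j \<bullet> z\<^sub>j\<close> that vanishes on the diagonal shifts
  \<open>(x, \<dots>, x)\<close> does not see the starting point. Weighting \<open>Q\<^sub>t\<close> by \<open>exp \<Theta>\<close> therefore only tilts the
  Gaussian factor, and by the Cameron--Martin formula this is a translation of \<open>Q\<^sub>t\<close> by the vector
  \<open>k\<^sub>t\<close> of covariances of \<open>\<xi>(t\<^sub>j)\<close> with \<open>\<Theta>(\<xi>(t))\<close>, up to a constant. If \<open>Q\<^sub>s = Q\<^sub>t\<close>, comparing the two
  translations shows that this measure is reproduced, up to a constant, by the translation along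
  \<open>k\<^sub>s - k\<^sub>t\<close>. Replacing \<open>\<Theta>\<close> by \<open>r \<cdot> \<Theta>\<close> makes the translation linear in \<open>r\<close>, so the logarithm of the
  constant is linear in \<open>r\<close> too; its quadratic part is the difference of the variances of \<open>\<Theta>\<close>,
  which hence agree (\<open>variance_invariant\<close>). By polarisation \<open>k\<^sub>s - k\<^sub>t\<close> is orthogonal to all admissible
  functionals, so it is a diagonal shift by some number \<open>\<tau>\<close> (\<open>cov_vec_shift\<close>). Two times suffice for
  this argument.

  \<^emph>\<open>Identification of \<open>\<Lambda>\<close>.\<close> If \<open>\<tau> \<noteq> 0\<close> for some choice, then the convolution of \<open>\<Lambda>\<close> with the law of \<open>\<xi>(t)\<close>, and by deconvolution \<open>\<Lambda>\<close>
  itself, is multiplied by exponentials under all diagonal shifts, so \<open>\<Lambda>\<close> is exponential. If \<open>\<tau> = 0\<close>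
  throughout, then \<open>Var \<eta>(t) - Var \<eta>(0)\<close> is additive and bounded below, hence zero; all covariances
  of \<open>\<xi>\<close> are stationary, and the mean of \<open>\<xi>\<close> changes only by an additive drift along the diagonal.
  As some \<open>v \<bullet> \<xi>\<close> is not stationary, the drift is nonzero; \<open>\<Lambda>\<close> is invariant under the shifts by its
  values, which contain all fractions \<open>\<beta> / n\<close> of one of them, so \<open>\<Lambda>\<close> is a multiple of Lebesgue measure
  (\<open>exponential_of_stationary_pairs\<close>).

  The deconvolution has to allow \<open>\<Lambda>\<close> to grow so fast that its convolution with the law of \<open>\<eta>(t)\<close> is
  infinite. For this reason \<open>\<eta>(t)\<close> is regressed on \<open>\<zeta>(t)\<close>: the residual is independent of \<open>\<zeta>(t)\<close>, and
  restricting \<open>\<zeta>(t)\<close> to a ball leaves a locally finite convolution with the residual alone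
  (\<open>diagonal_deconvolution\<close>). On the line, the density of a convolution with a normal law is, up to
  an explicit factor, a Laplace transform of the other measure.

  \<^emph>\<open>The conditions.\<close> For \<open>\<Lambda>(du) = exp (- l u) du\<close> the substitution \<open>y = u + \<eta>(t\<^sub>1)\<close> turns \<open>Q\<^sub>t\<close> into
  \<open>exp (- l y) dy\<close> times the law of the differences \<open>\<xi>(t\<^sub>j) - \<eta>(t\<^sub>1)\<close> under the weight
  \<open>exp (l \<eta>(t\<^sub>1))\<close>. This weighted law is Gaussian up to its mass, so its invariance under time shifts
  is that of its mass, means and covariances (\<open>moment_conditions\<close>), and these are the conditions of
  the theorem.
\<close>

section \<open>Exponential moments determine a measure on the line\<close>

lemma AE_lborel_dense:
  fixes a b :: real
  assumes "AE y in lborel. Q y" "a < b"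
  shows "\<exists>y. a < y \<and> y < b \<and> Q y"
proof (rule ccontr)
  assume neg: "\<not> ?thesis"
  have "AE y in lborel. y \<notin> {a<..<b}"
    using assms(1) by eventually_elim (use neg in auto)
  then have "emeasure lborel {a<..<b} = 0"
    by (subst (asm) AE_iff_measurable[where N="{a<..<b}"]) auto
  with \<open>a < b\<close> show False by simp
qed

text \<open>By convexity of the exponential, \<open>exp (y u) \<le> exp (y\<^sub>1 u) + exp (y\<^sub>2 u)\<close> whenever \<open>y\<^sub>1 < y < y\<^sub>2\<close>.\<close>

lemma mgf_finite_everywhere:
  fixes \<nu> :: "real measure"
  assumes [measurable_cong]: "sets \<nu> = sets borel"
    and fin: "AE y in lborel. (\<integral>\<^sup>+u. ennreal (exp (y * u)) \<partial>\<nu>) < \<infinity>"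
  shows "(\<integral>\<^sup>+u. ennreal (exp (y * u)) \<partial>\<nu>) < \<infinity>"
proof -
  obtain y1 where y1: "y - 1 < y1" "y1 < y" "(\<integral>\<^sup>+u. ennreal (exp (y1 * u)) \<partial>\<nu>) < \<infinity>"
    using AE_lborel_dense[OF fin, of "y - 1" y] by auto
  obtain y2 where y2: "y < y2" "y2 < y + 1" "(\<integral>\<^sup>+u. ennreal (exp (y2 * u)) \<partial>\<nu>) < \<infinity>"
    using AE_lborel_dense[OF fin, of y "y + 1"] by auto
  have le: "ennreal (exp (y * u)) \<le> ennreal (exp (y1 * u)) + ennreal (exp (y2 * u))" for u
  proof -
    have "exp (y * u) \<le> exp (y1 * u) + exp (y2 * u)"
    proof (cases "u \<ge> 0")
      case True
      then have "exp (y * u) \<le> exp (y2 * u)" using y2 by (simp add: mult_right_mono)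
      then show ?thesis by (smt (verit) exp_gt_zero)
    next
      case False
      then have "exp (y * u) \<le> exp (y1 * u)" using y1 by (simp add: mult_right_mono_neg)
      then show ?thesis by (smt (verit) exp_gt_zero)
    qed
    then show ?thesis by (simp flip: ennreal_plus)
  qed
  have "(\<integral>\<^sup>+u. ennreal (exp (y * u)) \<partial>\<nu>) \<le> (\<integral>\<^sup>+u. ennreal (exp (y1 * u)) + ennreal (exp (y2 * u)) \<partial>\<nu>)"
    by (rule nn_integral_mono) (rule le)
  also have "\<dots> = (\<integral>\<^sup>+u. ennreal (exp (y1 * u)) \<partial>\<nu>) + (\<integral>\<^sup>+u. ennreal (exp (y2 * u)) \<partial>\<nu>)"
    by (rule nn_integral_add) auto
  also have "\<dots> < \<infinity>" using y1 y2 by (simp add: ennreal_add_less_top)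
  finally show ?thesis .
qed

lemma integrable_exp_complex:
  fixes \<nu> :: "real measure"
  assumes [measurable_cong]: "sets \<nu> = sets borel"
    and fin: "\<And>y. (\<integral>\<^sup>+u. ennreal (exp (y * u)) \<partial>\<nu>) < \<infinity>"
  shows integrable_exp_abs: "integrable \<nu> (\<lambda>u. exp (r * \<bar>u\<bar>))"
    and "integrable \<nu> (\<lambda>u. exp (z * complex_of_real u))"
    and "(\<lambda>n. (\<integral>u. complex_of_real (u ^ n / fact n) \<partial>\<nu>) * z ^ n) sums (\<integral>u. exp (z * complex_of_real u) \<partial>\<nu>)"
proof -
  have int1: "integrable \<nu> (\<lambda>u. exp (y * u))" for y
    using fin[of y] by (intro integrableI_bounded) auto
  have bnd: "exp (r * \<bar>u\<bar>) \<le> exp (r * u) + exp (- r * u)" for r u :: real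
    by (cases "u \<ge> 0") auto
  show int2: "integrable \<nu> (\<lambda>u. exp (r * \<bar>u\<bar>))" for r
    by (rule Bochner_Integration.integrable_bound[OF Bochner_Integration.integrable_add[OF int1[of r] int1[of "-r"]]])
       (use bnd[of r] in \<open>auto intro!: AE_I2 intro: order_trans\<close>)
  show int3: "integrable \<nu> (\<lambda>u. exp (z * complex_of_real u))"
  proof (rule Bochner_Integration.integrable_bound[OF int2[of "cmod z"]])
    show "AE u in \<nu>. norm (exp (z * complex_of_real u)) \<le> norm (exp (cmod z * \<bar>u\<bar>))"
    proof (rule AE_I2)
      fix u
      have "norm (exp (z * complex_of_real u)) \<le> exp (cmod (z * complex_of_real u))"
        by (rule norm_exp)
      then show "norm (exp (z * complex_of_real u)) \<le> norm (exp (cmod z * \<bar>u\<bar>))"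
        by (simp add: norm_mult)
    qed
  qed measurable
  have expbnd: "(\<Sum>k\<in>I. x ^ k /\<^sub>R fact k) \<le> exp x" if "finite I" "x \<ge> 0" for I and x :: real
    unfolding exp_def using that by (intro sum_le_suminf summable_exp_generic) auto
  have S: "(\<lambda>n. (z * complex_of_real u) ^ n /\<^sub>R fact n) sums exp (z * complex_of_real u)" for u
    by (rule exp_converges)
  have pw: "norm (\<Sum>k<n. (z * complex_of_real u) ^ k /\<^sub>R fact k) \<le> exp (cmod z * \<bar>u\<bar>)" for n u
  proof -
    have "norm (\<Sum>k<n. (z * complex_of_real u) ^ k /\<^sub>R fact k) \<le> (\<Sum>k<n. (cmod z * \<bar>u\<bar>) ^ k /\<^sub>R fact k)"
      by (intro order_trans[OF norm_sum] sum_mono) (simp add: norm_power norm_mult)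
    also have "\<dots> \<le> exp (cmod z * \<bar>u\<bar>)"
      by (rule expbnd) auto
    finally show ?thesis .
  qed
  have intk: "integrable \<nu> (\<lambda>u. (z * complex_of_real u) ^ k /\<^sub>R fact k)" for k
  proof (rule Bochner_Integration.integrable_bound[OF int2[of "cmod z"]])
    show "AE u in \<nu>. norm ((z * complex_of_real u) ^ k /\<^sub>R fact k) \<le> norm (exp (cmod z * \<bar>u\<bar>))"
    proof (rule AE_I2)
      fix u
      have "norm ((z * complex_of_real u) ^ k /\<^sub>R fact k) = (\<Sum>k\<in>{k}. (cmod z * \<bar>u\<bar>) ^ k /\<^sub>R fact k)"
        by (simp add: norm_power norm_mult)
      also have "\<dots> \<le> exp (cmod z * \<bar>u\<bar>)"
        by (rule expbnd) auto
      finally show "norm ((z * complex_of_real u) ^ k /\<^sub>R fact k) \<le> norm (exp (cmod z * \<bar>u\<bar>))" by simp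
    qed
  qed measurable
  have "(\<lambda>n. \<integral>u. (\<Sum>k<n. (z * complex_of_real u) ^ k /\<^sub>R fact k) \<partial>\<nu>) \<longlonglongrightarrow> (\<integral>u. exp (z * complex_of_real u) \<partial>\<nu>)"
  proof (rule integral_dominated_convergence[where w="\<lambda>u. exp (cmod z * \<bar>u\<bar>)"])
    show "AE u in \<nu>. (\<lambda>n. \<Sum>k<n. (z * complex_of_real u) ^ k /\<^sub>R fact k) \<longlonglongrightarrow> exp (z * complex_of_real u)"
      using S unfolding sums_def by auto
    show "AE x in \<nu>. norm (\<Sum>k<n. (z * complex_of_real x) ^ k /\<^sub>R fact k) \<le> exp (cmod z * \<bar>x\<bar>)" for n
      using pw by auto
  qed (use int2 in auto)
  moreover have "(\<integral>u. (\<Sum>k<n. (z * complex_of_real u) ^ k /\<^sub>R fact k) \<partial>\<nu>)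
      = (\<Sum>k<n. (\<integral>u. complex_of_real (u ^ k / fact k) \<partial>\<nu>) * z ^ k)" for n
  proof (subst Bochner_Integration.integral_sum)
    have eq: "(z * complex_of_real u) ^ k /\<^sub>R fact k = complex_of_real (u ^ k / fact k) * z ^ k" for k u
      by (simp add: scaleR_conv_of_real power_mult_distrib field_simps)
    show "(\<Sum>k<n. \<integral>u. (z * complex_of_real u) ^ k /\<^sub>R fact k \<partial>\<nu>)
        = (\<Sum>k<n. (\<integral>u. complex_of_real (u ^ k / fact k) \<partial>\<nu>) * z ^ k)"
      by (simp only: eq integral_mult_left_zero)
  qed (rule intk)
  ultimately show "(\<lambda>n. (\<integral>u. complex_of_real (u ^ n / fact n) \<partial>\<nu>) * z ^ n) sums (\<integral>u. exp (z * complex_of_real u) \<partial>\<nu>)"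
    unfolding sums_def by simp
qed

text \<open>The two-sided Laplace transform extends to an entire function. Equality on a dense set of
  positive arguments therefore gives equality on the imaginary axis, that is, of the
  characteristic functions, and Levy's uniqueness theorem applies after normalisation.\<close>

lemma measure_eqI_mgf:
  fixes \<mu> \<nu> :: "real measure"
  assumes sets1[measurable_cong]: "sets \<mu> = sets borel" and sets2[measurable_cong]: "sets \<nu> = sets borel"
    and eq: "AE y in lborel. y > 0 \<longrightarrow> (\<integral>\<^sup>+u. ennreal (exp (y * u)) \<partial>\<mu>) = (\<integral>\<^sup>+u. ennreal (exp (y * u)) \<partial>\<nu>)"
    and fin: "AE y in lborel. (\<integral>\<^sup>+u. ennreal (exp (y * u)) \<partial>\<mu>) < \<infinity>"
    and fin2: "AE y in lborel. (\<integral>\<^sup>+u. ennreal (exp (y * u)) \<partial>\<nu>) < \<infinity>"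
  shows "\<mu> = \<nu>"
proof -
  note F1 = mgf_finite_everywhere[OF sets1 fin] and F2 = mgf_finite_everywhere[OF sets2 fin2]
  note I1 = integrable_exp_complex[OF sets1 F1] and I2 = integrable_exp_complex[OF sets2 F2]
  define G where "G z = (\<integral>u. exp (z * complex_of_real u) \<partial>\<mu>) - (\<integral>u. exp (z * complex_of_real u) \<partial>\<nu>)" for z
  have hol: "G holomorphic_on ball 0 r" for r
    unfolding G_def
    by (intro holomorphic_on_diff
         power_series_holomorphic[where a="\<lambda>n. \<integral>u. complex_of_real (u ^ n / fact n) \<partial>\<mu>"]
         power_series_holomorphic[where a="\<lambda>n. \<integral>u. complex_of_real (u ^ n / fact n) \<partial>\<nu>"])
       (simp_all only: diff_0_right I1(3) I2(3))
  define D where "D = {y::real. (\<integral>\<^sup>+u. ennreal (exp (y * u)) \<partial>\<mu>) = (\<integral>\<^sup>+u. ennreal (exp (y * u)) \<partial>\<nu>)}"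
  have GD: "G (complex_of_real y) = 0" if "y \<in> D" for y
  proof -
    have *: "(\<integral>u. exp (complex_of_real y * complex_of_real u) \<partial>M) = complex_of_real (enn2real (\<integral>\<^sup>+u. ennreal (exp (y * u)) \<partial>M))"
      if "sets M = sets borel" for M
    proof -
      have "(\<integral>u. exp (complex_of_real y * complex_of_real u) \<partial>M) = (\<integral>u. complex_of_real (exp (y * u)) \<partial>M)"
        by (simp flip: of_real_mult exp_of_real)
      also have "\<dots> = complex_of_real (\<integral>u. exp (y * u) \<partial>M)" by (rule integral_complex_of_real)
      also have "(\<integral>u. exp (y * u) \<partial>M) = enn2real (\<integral>\<^sup>+u. ennreal (exp (y * u)) \<partial>M)"
        by (rule integral_eq_nn_integral) (auto simp: measurable_cong_sets[OF that refl])
      finally show ?thesis .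
    qed
    show ?thesis using that unfolding G_def D_def by (simp add: *[OF sets1] *[OF sets2])
  qed
  have lim: "0 islimpt (complex_of_real ` D)"
    unfolding islimpt_approachable
  proof (intro allI impI)
    fix e :: real assume "e > 0"
    from AE_lborel_dense[OF eq this] obtain y where "0 < y" "y < e" "y \<in> D" by (auto simp: D_def)
    then show "\<exists>x'\<in>complex_of_real ` D. x' \<noteq> 0 \<and> dist x' 0 < e"
      by (intro bexI[of _ "complex_of_real y"]) auto
  qed
  have G0: "G w = 0" for w
  proof -
    let ?r = "cmod w + 1"
    have isl: "0 islimpt (complex_of_real ` D \<inter> ball 0 ?r)"
      by (rule islimpt_Int_eventually[OF lim eventually_at_in_open'[OF open_ball]]) (simp add: add_nonneg_pos)
    show ?thesis
      by (rule analytic_continuation[OF hol[of ?r] open_ball connected_ball _ _ isl])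
         (use GD in \<open>auto simp: add_nonneg_pos\<close>)
  qed
  have fm1: "finite_measure \<mu>" using F1[of 0] by (intro finite_measureI) simp
  have fm2: "finite_measure \<nu>" using F2[of 0] by (intro finite_measureI) simp
  interpret m: finite_measure \<mu> by fact
  interpret n: finite_measure \<nu> by fact
  define c where "c = measure \<mu> (space \<mu>)"
  have "complex_of_real (measure \<mu> (space \<mu>)) = complex_of_real (measure \<nu> (space \<nu>))"
    using G0[of 0] unfolding G_def by simp
  then have c: "c = measure \<nu> (space \<nu>)" unfolding c_def by simp
  have em: "emeasure \<mu> (space \<mu>) = ennreal c" "emeasure \<nu> (space \<nu>) = ennreal c"
    using c by (simp_all add: c_def m.emeasure_eq_measure n.emeasure_eq_measure)
  show ?thesis
  proof (cases "c = 0")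
    case True
    show ?thesis
    proof (rule measure_eqI)
      fix A assume "A \<in> sets \<mu>"
      then have "A \<subseteq> space \<mu>" "A \<subseteq> space \<nu>" using sets1 sets2 by (auto dest: sets.sets_into_space simp: sets_eq_imp_space_eq[OF sets1] sets_eq_imp_space_eq[OF sets2])
      then have "emeasure \<mu> A \<le> 0" "emeasure \<nu> A \<le> 0"
        using em True emeasure_mono[of A "space \<mu>" \<mu>] emeasure_mono[of A "space \<nu>" \<nu>] by auto
      then show "emeasure \<mu> A = emeasure \<nu> A" by simp
    qed (simp add: sets1 sets2)
  next
    case False
    then have cpos: "c > 0" unfolding c_def by (simp add: zero_less_measure_iff)
    define N where "N M = density M (\<lambda>_::real. ennreal (1 / c))" for M
    have emN: "emeasure (N M) A = ennreal (1 / c) * emeasure M A" if "A \<in> sets M" for M A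
      using that by (simp add: N_def emeasure_density nn_integral_cmult_indicator)
    have rd: "real_distribution (N M)" if "sets M = sets borel" "emeasure M (space M) = ennreal c" for M
    proof -
      have "emeasure (N M) (space (N M)) = 1"
        using that cpos emN[OF sets.top[of M]] by (simp add: N_def flip: ennreal_mult)
      then interpret prob_space "N M" by (rule prob_spaceI)
      show ?thesis by unfold_locales (simp_all add: N_def that)
    qed
    have ch: "char (N M) \<theta> = (\<integral>u. exp ((\<i> * \<theta>) * complex_of_real u) \<partial>M) /\<^sub>R c"
      if "sets M = sets borel" for M \<theta>
      unfolding char_def N_def using cpos
      by (subst integral_density) (auto simp: measurable_cong_sets[OF that refl] mult.assoc divide_inverse)
    have "N \<mu> = N \<nu>"
    proof (rule Levy_uniqueness[OF rd[OF sets1 em(1)] rd[OF sets2 em(2)]])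
      show "char (N \<mu>) = char (N \<nu>)"
      proof
        fix \<theta> show "char (N \<mu>) \<theta> = char (N \<nu>) \<theta>"
          using G0[of "\<i> * \<theta>"] unfolding G_def ch[OF sets1] ch[OF sets2] by simp
      qed
    qed
    then have eqN: "emeasure (N \<mu>) A = emeasure (N \<nu>) A" for A by simp
    show ?thesis
    proof (rule measure_eqI)
      fix A assume "A \<in> sets \<mu>"
      then have "ennreal (1 / c) * emeasure \<mu> A = ennreal (1 / c) * emeasure \<nu> A"
        using eqN[of A] emN[of A \<mu>] emN[of A \<nu>] by (simp add: sets1 sets2)
      then show "emeasure \<mu> A = emeasure \<nu> A" using cpos
        by (simp add: ennreal_mult_cancel_left)
    qed (simp add: sets1 sets2)
  qed
qed

section \<open>Laplace transforms of random counts\<close>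

text \<open>The function \<open>exp (- a)\<close> on \<open>[0, \<infinity>]\<close>, with value \<open>0\<close> at infinity. It lets counts and
  integrals be infinite in all Laplace functionals below.\<close>

definition neg_exp :: "ennreal \<Rightarrow> ennreal" where
  "neg_exp a = (if a = \<infinity> then 0 else ennreal (exp (- enn2real a)))"

lemma neg_exp_simps [simp]: "neg_exp 0 = 1" "neg_exp \<infinity> = 0" "neg_exp top = 0"
  by (auto simp: neg_exp_def)

lemma neg_exp_ennreal: "r \<ge> 0 \<Longrightarrow> neg_exp (ennreal r) = ennreal (exp (- r))"
  by (simp add: neg_exp_def)

lemma neg_exp_le_1: "neg_exp a \<le> 1"
  by (cases a) (auto simp: neg_exp_def)

lemma neg_exp_neq_top [simp]: "neg_exp a \<noteq> top"
  by (simp add: neg_exp_def)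

lemma neg_exp_add: "neg_exp (a + b) = neg_exp a * neg_exp b"
  by (cases a; cases b) (auto simp: neg_exp_def exp_diff exp_minus field_simps simp flip: ennreal_plus ennreal_mult exp_add)

lemma neg_exp_sum: "neg_exp (\<Sum>i\<in>I. f i) = (\<Prod>i\<in>I. neg_exp (f i))"
  by (induction I rule: infinite_finite_induct) (auto simp: neg_exp_add)

lemma neg_exp_inj: "neg_exp a = neg_exp b \<Longrightarrow> a = b"
  by (cases a; cases b) (auto simp: neg_exp_def)

lemma neg_exp_antimono: "a \<le> b \<Longrightarrow> neg_exp b \<le> neg_exp a"
  by (cases a; cases b) (auto simp: neg_exp_def top_unique)

lemma measurable_neg_exp [measurable]: "neg_exp \<in> borel_measurable borel"
  unfolding neg_exp_def[abs_def] by measurable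

lemma tendsto_neg_exp:
  assumes "f \<longlonglongrightarrow> a"
  shows "(\<lambda>n. neg_exp (f n)) \<longlonglongrightarrow> neg_exp a"
proof (cases "a = \<infinity>")
  case False
  then have ev: "eventually (\<lambda>n. f n < \<infinity>) sequentially"
    using assms by (intro order_tendstoD) (auto simp: less_top)
  have lim: "(\<lambda>n. ennreal (exp (- enn2real (f n)))) \<longlonglongrightarrow> ennreal (exp (- enn2real a))"
    using False assms by (intro tendsto_intros tendsto_enn2real) (auto simp: less_top)
  have "(\<lambda>n. neg_exp (f n)) \<longlonglongrightarrow> ennreal (exp (- enn2real a))"
    by (rule Lim_transform_eventually[OF lim]) (auto simp: neg_exp_def intro: eventually_mono[OF ev])
  then show ?thesis using False by (simp add: neg_exp_def)
next
  case True
  show ?thesis unfolding True neg_exp_simps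
  proof (rule order_tendstoI)
    fix e :: ennreal assume "0 < e"
    then obtain r where r: "0 < r" "ennreal r \<le> e"
      by (cases e) (use that[of 1] in auto)
    have "eventually (\<lambda>n. ennreal \<bar>1 - ln r\<bar> < f n) sequentially"
      using assms True by (intro order_tendstoD(1)) auto
    then show "eventually (\<lambda>n. neg_exp (f n) < e) sequentially"
    proof eventually_elim
      case (elim n)
      then have "neg_exp (f n) \<le> neg_exp (ennreal \<bar>1 - ln r\<bar>)" by (intro neg_exp_antimono) auto
      also have "\<dots> = ennreal (exp (- \<bar>1 - ln r\<bar>))" by (simp add: neg_exp_ennreal)
      also have "exp (- \<bar>1 - ln r\<bar>) < exp (ln r)" by simp
      then have "ennreal (exp (- \<bar>1 - ln r\<bar>)) < ennreal r" using r by (intro ennreal_lessI) auto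
      finally show ?case using r by simp
    qed
  qed auto
qed

lemma neg_exp_of_nat_mult: "neg_exp (of_nat n * a) = neg_exp a ^ n"
  by (induction n) (auto simp: algebra_simps neg_exp_add)

text \<open>A family of test functions whose integrals identify a finite measure. The constant \<open>1\<close> is
  required to be a member because products of test functions have to contain the products over
  fewer coordinates.\<close>

definition determining :: "'b measure \<Rightarrow> ('p \<Rightarrow> 'b \<Rightarrow> ennreal) \<Rightarrow> bool" where
  "determining S \<phi> \<longleftrightarrow> (\<forall>p. \<phi> p \<in> borel_measurable S) \<and> (\<exists>p. \<phi> p = (\<lambda>_. 1)) \<and>
     (\<forall>\<mu> \<nu>. finite_measure \<mu> \<longrightarrow> finite_measure \<nu> \<longrightarrow> sets \<mu> = sets S \<longrightarrow> sets \<nu> = sets S \<longrightarrow>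
        (\<forall>p. (\<integral>\<^sup>+x. \<phi> p x \<partial>\<mu>) < \<infinity>) \<longrightarrow> (\<forall>p. (\<integral>\<^sup>+x. \<phi> p x \<partial>\<mu>) = (\<integral>\<^sup>+x. \<phi> p x \<partial>\<nu>)) \<longrightarrow> \<mu> = \<nu>)"

lemma determining_mgf: "determining borel (\<lambda>y u. ennreal (exp (y * u :: real)))"
  unfolding determining_def
  by (auto intro!: measure_eqI_mgf exI[of _ "0::real"])

text \<open>The Laplace transform at the integers gives the moments of \<open>z = exp (- a) \<in> [0, 1]\<close>. These
  determine the exponential moments of \<open>z\<close>, hence its law, and \<open>a\<close> is a function of \<open>z\<close>.\<close>

lemma determining_laplace: "determining borel (\<lambda>n a. neg_exp (of_nat n * a))"
  unfolding determining_def
proof (intro conjI allI impI)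
  show "\<exists>n::nat. (\<lambda>a. neg_exp (of_nat n * a)) = (\<lambda>_. 1)" by (rule exI[of _ 0]) simp
  fix \<mu> \<nu> :: "ennreal measure"
  assume fm: "finite_measure \<mu>" "finite_measure \<nu>"
    and s[measurable_cong]: "sets \<mu> = sets borel" "sets \<nu> = sets borel"
    and eq: "\<forall>p. (\<integral>\<^sup>+x. neg_exp (of_nat p * x) \<partial>\<mu>) = (\<integral>\<^sup>+x. neg_exp (of_nat p * x) \<partial>\<nu>)"
  define h where "h a = enn2real (neg_exp a)" for a
  have [measurable]: "h \<in> borel_measurable borel" unfolding h_def by measurable
  have h01: "0 \<le> h a" "h a \<le> 1" for a
    using neg_exp_le_1[of a] by (auto simp: h_def enn2real_leI)
  have hp: "ennreal (h a ^ n) = neg_exp (of_nat n * a)" for a n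
    by (simp add: neg_exp_of_nat_mult h_def flip: ennreal_power ) (simp add: less_top[symmetric])
  have mom: "(\<integral>\<^sup>+a. ennreal (h a ^ n) \<partial>\<mu>) = (\<integral>\<^sup>+a. ennreal (h a ^ n) \<partial>\<nu>)" for n
    using eq by (simp add: hp)
  have mgf: "(\<integral>\<^sup>+a. ennreal (exp (y * h a)) \<partial>M) = (\<Sum>n. ennreal (y ^ n / fact n) * (\<integral>\<^sup>+a. ennreal (h a ^ n) \<partial>M))"
    if [measurable_cong]: "sets M = sets borel" and "y \<ge> 0" for M y
  proof -
    have "ennreal (exp (y * h a)) = (\<Sum>n. ennreal (y ^ n / fact n) * ennreal (h a ^ n))" for a
    proof -
      have "(\<lambda>n. (y ^ n / fact n) * h a ^ n) sums exp (y * h a)"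
        using exp_converges[of "y * h a"] by (simp add: power_mult_distrib field_simps)
      then have "(\<lambda>n. ennreal ((y ^ n / fact n) * h a ^ n)) sums ennreal (exp (y * h a))"
        using h01 \<open>y \<ge> 0\<close> by (subst sums_ennreal) auto
      then show ?thesis
        using h01 \<open>y \<ge> 0\<close> by (simp add: sums_iff flip: ennreal_mult)
    qed
    then show ?thesis
      by (simp add: nn_integral_suminf nn_integral_cmult)
  qed
  have fin: "(\<integral>\<^sup>+a. ennreal (exp (y * h a)) \<partial>M) < \<infinity>" if [measurable_cong]: "sets M = sets borel" and "finite_measure M" for y and M :: "ennreal measure"
  proof -
    interpret finite_measure M by fact
    have "(\<integral>\<^sup>+a. ennreal (exp (y * h a)) \<partial>M) \<le> (\<integral>\<^sup>+a. ennreal (exp \<bar>y\<bar>) \<partial>M)"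
    proof (intro nn_integral_mono ennreal_leI)
      fix a
      have "y * h a \<le> \<bar>y\<bar> * 1" using h01[of a] by (intro mult_mono) auto
      then show "exp (y * h a) \<le> exp \<bar>y\<bar>" by simp
    qed
    also have "\<dots> < \<infinity>"
      using emeasure_finite[of "space M"] by (simp add: less_top[symmetric] ennreal_mult_eq_top_iff)
    finally show ?thesis .
  qed
  have D: "distr \<mu> borel h = distr \<nu> borel h"
  proof (rule measure_eqI_mgf)
    show "AE y in lborel. 0 < y \<longrightarrow> (\<integral>\<^sup>+ u. ennreal (exp (y * u)) \<partial>distr \<mu> borel h) = (\<integral>\<^sup>+ u. ennreal (exp (y * u)) \<partial>distr \<nu> borel h)"
      by (intro AE_I2 impI) (simp add: nn_integral_distr mgf s mom)
  qed (use fin s fm in \<open>auto simp: nn_integral_distr\<close>)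
  define k where "k z = (if z \<le> 0 then \<infinity> else ennreal (- ln z))" for z :: real
  have [measurable]: "k \<in> borel_measurable borel" unfolding k_def by measurable
  have kh: "k (h a) = a" for a
    by (cases a) (auto simp: k_def h_def neg_exp_def)
  have "distr (distr M borel h) borel k = M" if [measurable_cong]: "sets M = sets borel" for M :: "ennreal measure"
  proof -
    have "distr (distr M borel h) borel k = distr M borel (\<lambda>a. a)"
      by (subst distr_distr) (auto simp: comp_def kh)
    also have "\<dots> = M" by (rule distr_id2) (simp add: that)
    finally show ?thesis .
  qed
  then show "\<mu> = \<nu>" using D s by metis
qed measurable

text \<open>Uniqueness passes to finite products: once the integrals of all products of test functions
  agree, the one-dimensional property exchanges the test function in one coordinate after the other
  for an indicator.\<close>

lemma determining_prod:
  fixes \<phi> :: "'p \<Rightarrow> 'b \<Rightarrow> ennreal"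
  assumes det: "determining S \<phi>" and I: "finite I"
    and fm: "finite_measure \<mu>" "finite_measure \<nu>"
    and s: "sets \<mu> = sets (PiM I (\<lambda>_. S))" "sets \<nu> = sets (PiM I (\<lambda>_. S))"
    and fin: "\<And>p. (\<integral>\<^sup>+g. (\<Prod>i\<in>I. \<phi> (p i) (g i)) \<partial>\<mu>) < \<infinity>"
    and eq: "\<And>p. (\<integral>\<^sup>+g. (\<Prod>i\<in>I. \<phi> (p i) (g i)) \<partial>\<mu>) = (\<integral>\<^sup>+g. (\<Prod>i\<in>I. \<phi> (p i) (g i)) \<partial>\<nu>)"
  shows "\<mu> = \<nu>"
proof -
  note [measurable_cong] = s
  have [measurable]: "\<phi> p \<in> borel_measurable S" for p using det by (auto simp: determining_def)
  obtain p0 where p0: "\<phi> p0 = (\<lambda>_. 1)" using det by (auto simp: determining_def)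
  have detD: "m = n" if "finite_measure m" "finite_measure n" "sets m = sets S" "sets n = sets S"
    "\<And>p. (\<integral>\<^sup>+x. \<phi> p x \<partial>m) < \<infinity>" "\<And>p. (\<integral>\<^sup>+x. \<phi> p x \<partial>m) = (\<integral>\<^sup>+x. \<phi> p x \<partial>n)" for m n
    using det that unfolding determining_def by blast
  \<comment> \<open>The factors are exchanged for indicators one coordinate at a time.\<close>
  have claim: "(\<integral>\<^sup>+g. (\<Prod>i\<in>I. if i \<in> J then indicator (A i) (g i) else \<phi> (p i) (g i)) \<partial>\<mu>)
      = (\<integral>\<^sup>+g. (\<Prod>i\<in>I. if i \<in> J then indicator (A i) (g i) else \<phi> (p i) (g i)) \<partial>\<nu>)"
    if "finite J" "J \<subseteq> I" "\<And>i. i \<in> J \<Longrightarrow> A i \<in> sets S" for J A p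
    using that
  proof (induction J arbitrary: p A rule: finite_induct)
    case empty
    then show ?case by (simp add: eq)
  next
    case (insert j J)
    then have j: "j \<in> I" and [measurable]: "\<And>i. i \<in> J \<Longrightarrow> A i \<in> sets S" "A j \<in> sets S" by auto
    define w where "w q g = (\<Prod>i\<in>I-{j}. if i \<in> J then indicator (A i) (g i) else \<phi> (q i) (g i))" for q and g :: "'a \<Rightarrow> 'b"
    have [measurable]: "w q \<in> borel_measurable (PiM I (\<lambda>_. S))" for q
      unfolding w_def
    proof (intro borel_measurable_prod_ennreal)
      fix i assume i: "i \<in> I - {j}"
      then have [measurable]: "(\<lambda>g. g i) \<in> measurable (PiM I (\<lambda>_. S)) S"
        by (intro measurable_component_singleton) auto
      show "(\<lambda>g. if i \<in> J then indicator (A i) (g i) else \<phi> (q i) (g i)) \<in> borel_measurable (PiM I (\<lambda>_. S))"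
        by (cases "i \<in> J") auto
    qed
    have [measurable]: "(\<lambda>g. g j) \<in> measurable (PiM I (\<lambda>_. S)) S"
      using j by measurable
    have split: "(\<Prod>i\<in>I. if i \<in> J then indicator (A i) (g i) else \<phi> (q i) (g i)) = w q g * \<phi> (q j) (g j)" for q g
      using I j insert.hyps unfolding w_def by (subst prod.remove[of _ j]) (auto simp: mult.commute)
    define D where "D m = distr (density m (w p)) S (\<lambda>g. g j)" for m
    have wq: "w (p(j := q)) = w p" for q
      unfolding w_def by (intro ext prod.cong) auto
    have IH: "(\<integral>\<^sup>+g. w p g * \<phi> q (g j) \<partial>\<mu>) = (\<integral>\<^sup>+g. w p g * \<phi> q (g j) \<partial>\<nu>)" for q
      using insert.IH[of A "p(j := q)"] insert.prems unfolding split wq by auto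
    have Dint: "(\<integral>\<^sup>+x. f x \<partial>D m) = (\<integral>\<^sup>+g. w p g * f (g j) \<partial>m)"
      if [measurable_cong]: "sets m = sets (PiM I (\<lambda>_. S))" and [measurable]: "f \<in> borel_measurable S" for m f
      unfolding D_def by (subst nn_integral_distr, simp, simp, subst nn_integral_density) auto
    have finw: "(\<integral>\<^sup>+g. w p g * \<phi> q (g j) \<partial>\<mu>) < \<infinity>" for q
    proof -
      let ?r = "\<lambda>i. if i = j then q else if i \<in> J then p0 else p i"
      have "(\<integral>\<^sup>+g. w p g * \<phi> q (g j) \<partial>\<mu>) \<le> (\<integral>\<^sup>+g. (\<Prod>i\<in>I. \<phi> (?r i) (g i)) \<partial>\<mu>)"
      proof (rule nn_integral_mono)
        fix g
        have "w p g \<le> (\<Prod>i\<in>I-{j}. \<phi> (?r i) (g i))"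
          unfolding w_def by (intro prod_mono_ennreal) (auto simp: p0 indicator_def)
        then have "w p g * \<phi> q (g j) \<le> (\<Prod>i\<in>I-{j}. \<phi> (?r i) (g i)) * \<phi> (?r j) (g j)"
          by (intro mult_mono) auto
        also have "\<dots> = (\<Prod>i\<in>I. \<phi> (?r i) (g i))"
          using I j by (subst prod.remove[of I j]) (auto simp: mult.commute)
        finally show "w p g * \<phi> q (g j) \<le> (\<Prod>i\<in>I. \<phi> (?r i) (g i))" .
      qed
      also have "\<dots> < \<infinity>" by (rule fin)
      finally show ?thesis .
    qed
    have "D \<mu> = D \<nu>"
    proof (rule detD)
      show *: "(\<integral>\<^sup>+ x. \<phi> p x \<partial>D \<mu>) = (\<integral>\<^sup>+ x. \<phi> p x \<partial>D \<nu>)" for p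
        by (simp add: Dint s IH)
      show "finite_measure (D \<mu>)"
        using finw[of p0] Dint[OF s(1), of "\<lambda>_. 1"] by (intro finite_measureI) (simp add: p0)
      show "finite_measure (D \<nu>)"
        using finw[of p0] IH[of p0] Dint[OF s(2), of "\<lambda>_. 1"] by (intro finite_measureI) (simp add: p0)
      show "(\<integral>\<^sup>+ x. \<phi> p x \<partial>D \<mu>) < \<infinity>" for p
        using finw by (simp add: Dint s)
    qed (simp_all add: D_def)
    then have "(\<integral>\<^sup>+x. indicator (A j) x \<partial>D \<mu>) = (\<integral>\<^sup>+x. indicator (A j) x \<partial>D \<nu>)" by simp
    then have X: "(\<integral>\<^sup>+g. w p g * indicator (A j) (g j) \<partial>\<mu>) = (\<integral>\<^sup>+g. w p g * indicator (A j) (g j) \<partial>\<nu>)"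
      by (subst (asm) (1 2) Dint) (auto simp: s)
    have "(\<Prod>i\<in>I. if i \<in> insert j J then indicator (A i) (g i) else \<phi> (p i) (g i)) = w p g * indicator (A j) (g j)" for g
      using I j insert.hyps unfolding w_def by (subst prod.remove[of _ j]) (auto simp: mult.commute intro!: prod.cong arg_cong2[where f="(*)"])
    then show ?case using X by simp
  qed
  interpret m: finite_measure \<mu> by fact
  show ?thesis
  proof (rule measure_eqI_PiM_finite[OF I s, where A="\<lambda>_::nat. space (PiM I (\<lambda>_. S))"])
    fix A assume A: "\<And>i. i \<in> I \<Longrightarrow> A i \<in> sets S"
    have "indicator (PiE I A) g = (\<Prod>i\<in>I. indicator (A i) (g i) :: ennreal)" if "g \<in> extensional I" for g
      using I that by (auto simp: indicator_def PiE_def Pi_def prod_eq_1_iff split: if_splits)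
    moreover have "g \<in> extensional I" if "g \<in> space \<mu> \<or> g \<in> space \<nu>" for g
      using that by (auto simp: sets_eq_imp_space_eq[OF s(1)] sets_eq_imp_space_eq[OF s(2)] space_PiM PiE_def)
    ultimately have *: "(\<integral>\<^sup>+g. indicator (PiE I A) g \<partial>m) = (\<integral>\<^sup>+g. (\<Prod>i\<in>I. indicator (A i) (g i)) \<partial>m)"
      if "m = \<mu> \<or> m = \<nu>" for m
      using that by (intro nn_integral_cong) auto
    have "PiE I A \<in> sets (PiM I (\<lambda>_. S))" using A I by (intro sets_PiM_I_finite) auto
    then show "emeasure \<mu> (PiE I A) = emeasure \<nu> (PiE I A)"
      using claim[OF I order_refl, of A] A *[of \<mu>] *[of \<nu>] by (simp add: s cong: prod.cong)
  qed (use prod_algebraI_finite[OF I, of "\<lambda>_. space S" "\<lambda>_. S"] m.emeasure_finite in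
       \<open>auto simp: space_PiM\<close>)
qed

section \<open>Poisson processes and particle systems\<close>

text \<open>An explicit inverse of \<open>neg_exp\<close>, used to write a product of numbers in \<open>[0, 1]\<close> as a Laplace
  functional.\<close>

lemma neg_exp_surj:
  assumes "a \<le> 1"
  shows "neg_exp (if a = 0 then \<infinity> else ennreal (- ln (enn2real a))) = a"
proof (cases "a = 0")
  case False
  then obtain r where r: "a = ennreal r" "0 < r" using assms by (cases a) (auto simp: top_unique)
  then have "r \<le> 1" using assms by simp
  then show ?thesis using r by (simp add: neg_exp_ennreal)
qed simp

text \<open>The hypothesis concerns finite values only; they carry full mass because the Poisson weights
  sum to one, so \<open>X\<close> is almost surely a natural number.\<close>

lemma poisson_variable_laplace:
  fixes X :: "'o \<Rightarrow> ennreal"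
  assumes P: "prob_space P" and [measurable]: "X \<in> borel_measurable P" and c: "c \<ge> 0"
    and dist: "\<And>k::nat. measure P {\<omega>\<in>space P. X \<omega> = of_nat k} = c ^ k / fact k * exp (- c)"
  shows "(\<integral>\<^sup>+\<omega>. neg_exp (y * X \<omega>) \<partial>P) = neg_exp ((1 - neg_exp y) * ennreal c)"
proof -
  interpret prob_space P by fact
  define E where "E k = {\<omega>\<in>space P. X \<omega> = of_nat k}" for k :: nat
  have [measurable]: "E k \<in> sets P" for k unfolding E_def by measurable
  have emE: "emeasure P (E k) = ennreal (c ^ k / fact k * exp (- c))" for k
    using dist[of k] by (simp add: E_def emeasure_eq_measure)
  have ser: "(\<lambda>k. (r * c) ^ k / fact k * exp (- c)) sums exp (- ((1 - r) * c))" for r :: real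
  proof -
    have "(\<lambda>k. (r * c) ^ k /\<^sub>R fact k * exp (- c)) sums (exp (r * c) * exp (- c))"
      by (intro sums_mult2 exp_converges)
    then show ?thesis by (simp add: divide_inverse mult.commute algebra_simps flip: exp_add)
  qed
  have "disjoint_family E" by (auto simp: disjoint_family_on_def E_def)
  then have "emeasure P (\<Union>k. E k) = (\<Sum>k. emeasure P (E k))"
    by (intro suminf_emeasure[symmetric]) auto
  also have "\<dots> = ennreal 1"
    unfolding emE using ser[of 1] c by (intro sums_unique[symmetric]) (subst sums_ennreal, auto)
  finally have "AE \<omega> in P. \<omega> \<in> (\<Union>k. E k)"
    by (subst AE_in_set_eq_1) (auto simp: emeasure_eq_measure)
  then have "AE \<omega> in P. neg_exp (y * X \<omega>) = (\<Sum>k. neg_exp y ^ k * indicator (E k) \<omega>)"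
  proof eventually_elim
    case (elim \<omega>)
    then obtain k where k: "\<omega> \<in> E k" by auto
    then have ind: "indicator (E j) \<omega> = (if j = k then 1 else 0 :: ennreal)" for j
      by (auto simp: E_def indicator_def)
    have "(\<Sum>j. neg_exp y ^ j * indicator (E j) \<omega>) = (\<Sum>j\<in>{k}. neg_exp y ^ j * indicator (E j) \<omega>)"
      by (rule suminf_finite) (auto simp: ind)
    also have "\<dots> = neg_exp y ^ k" by (simp add: ind)
    finally show ?case using k neg_exp_of_nat_mult[of k y] by (simp add: E_def mult.commute)
  qed
  then have "(\<integral>\<^sup>+\<omega>. neg_exp (y * X \<omega>) \<partial>P) = (\<integral>\<^sup>+\<omega>. (\<Sum>k. neg_exp y ^ k * indicator (E k) \<omega>) \<partial>P)"
    by (rule nn_integral_cong_AE)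
  also have "\<dots> = (\<Sum>k. neg_exp y ^ k * emeasure P (E k))"
    by (simp add: nn_integral_suminf nn_integral_cmult)
  also have "\<dots> = neg_exp ((1 - neg_exp y) * ennreal c)"
  proof -
    obtain z where z: "neg_exp y = ennreal z" "0 \<le> z" "z \<le> 1"
      using neg_exp_le_1[of y] by (cases "neg_exp y") auto
    have "(1 - neg_exp y) * ennreal c = ennreal ((1 - z) * c)"
      using z c by (simp add: ennreal_mult ennreal_minus flip: ennreal_1)
    then have "neg_exp ((1 - neg_exp y) * ennreal c) = ennreal (exp (- ((1 - z) * c)))"
      using z c by (simp only: neg_exp_ennreal mult_nonneg_nonneg diff_ge_0_iff_ge)
    moreover have "(\<lambda>k. neg_exp y ^ k * emeasure P (E k)) sums ennreal (exp (- ((1 - z) * c)))"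
    proof -
      have "neg_exp y ^ k * emeasure P (E k) = ennreal ((z * c) ^ k / fact k * exp (- c))" for k
        unfolding emE z(1) using z(2) c by (simp add: ennreal_power power_mult_distrib flip: ennreal_mult)
      then show ?thesis using ser[of z] z c by (simp only:) (subst sums_ennreal, auto)
    qed
    ultimately show ?thesis by (simp add: sums_iff)
  qed
  finally show ?thesis .
qed

lemma nn_integral_finite_range:
  fixes f :: "'b \<Rightarrow> ennreal" and g :: "ennreal \<Rightarrow> ennreal"
  assumes e: "bij_betw e {..<n::nat} (f ` space L)" and s: "sets N = sets L" and f: "f \<in> borel_measurable L"
  shows "(\<integral>\<^sup>+x. g (f x) \<partial>N) = (\<Sum>k<n. g (e k) * emeasure N (f -` {e k} \<inter> space L))"
proof -
  have sp: "space N = space L" by (rule sets_eq_imp_space_eq[OF s])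
  have [measurable]: "f -` {e k} \<inter> space L \<in> sets N" for k using f s by auto
  have "g (f x) = (\<Sum>k<n. g (e k) * indicator (f -` {e k} \<inter> space L) x)" if x: "x \<in> space N" for x
  proof -
    obtain k where k: "k < n" "f x = e k" using e x unfolding bij_betw_def sp by (metis imageE imageI lessThan_iff)
    have ej: "f x = e j \<longleftrightarrow> j = k" if "j < n" for j
      using e k that unfolding bij_betw_def by (metis inj_on_def lessThan_iff)
    have "indicator (f -` {e j} \<inter> space L) x = (if j = k then 1 else 0 :: ennreal)" if "j < n" for j
      using ej[OF that] x sp by (auto simp: indicator_def)
    then have "(\<Sum>k<n. g (e k) * indicator (f -` {e k} \<inter> space L) x) = (\<Sum>j<n. if j = k then g (e k) else 0)"
      by (intro sum.cong) auto
    then show ?thesis using k by simp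
  qed
  then have "(\<integral>\<^sup>+x. g (f x) \<partial>N) = (\<integral>\<^sup>+x. (\<Sum>k<n. g (e k) * indicator (f -` {e k} \<inter> space L) x) \<partial>N)"
    by (rule nn_integral_cong)
  also have "\<dots> = (\<Sum>k<n. g (e k) * emeasure N (f -` {e k} \<inter> space L))"
    by (subst nn_integral_sum) (auto simp: nn_integral_cmult)
  finally show ?thesis .
qed

text \<open>For a function with finitely many values the counts on the level sets are independent and
  Poisson. The general case follows by monotone approximation.\<close>

lemma poisson_process_laplace:
  fixes f :: "'b \<Rightarrow> ennreal"
  assumes P: "prob_space P" and pp: "poisson_process P L N" and sN: "\<And>\<omega>. sets (N \<omega>) = sets L"
    and f: "f \<in> borel_measurable L"
  shows "(\<integral>\<^sup>+\<omega>. neg_exp (\<integral>\<^sup>+z. f z \<partial>N \<omega>) \<partial>P) = neg_exp (\<integral>\<^sup>+z. 1 - neg_exp (f z) \<partial>L)"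
proof -
  interpret prob_space P by fact
  have meas: "(\<lambda>\<omega>. emeasure (N \<omega>) B) \<in> borel_measurable P" if "B \<in> sets L" for B
    using pp that unfolding poisson_process_def by blast
  note [measurable_cong] = sN
  have one: "(\<integral>\<^sup>+\<omega>. neg_exp (y * emeasure (N \<omega>) B) \<partial>P) = neg_exp ((1 - neg_exp y) * emeasure L B)"
    if B: "B \<in> sets L" and y: "y < top" for B y
  proof (cases "emeasure L B = \<infinity>")
    case False
    then have "emeasure L B = ennreal (measure L B)" by (simp add: emeasure_eq_ennreal_measure)
    moreover have "(\<integral>\<^sup>+\<omega>. neg_exp (y * emeasure (N \<omega>) B) \<partial>P) = neg_exp ((1 - neg_exp y) * ennreal (measure L B))"
      using pp B False unfolding poisson_process_def
      by (intro poisson_variable_laplace[OF P meas[OF B]]) (auto simp: less_top)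
    ultimately show ?thesis by simp
  next
    case True
    then have ae: "AE \<omega> in P. emeasure (N \<omega>) B = \<infinity>"
      using pp B unfolding poisson_process_def by blast
    show ?thesis
    proof (cases "y = 0")
      case True then show ?thesis by (simp add: emeasure_space_1)
    next
      case False
      then have "neg_exp y \<noteq> 1" using neg_exp_inj[of y 0] by auto
      then have "1 - neg_exp y \<noteq> 0" using neg_exp_le_1[of y] by (auto simp: diff_eq_0_iff_ennreal)
      then have R: "neg_exp ((1 - neg_exp y) * emeasure L B) = 0" using True by (simp add: ennreal_mult_top)
      have "(\<integral>\<^sup>+\<omega>. neg_exp (y * emeasure (N \<omega>) B) \<partial>P) = (\<integral>\<^sup>+\<omega>. 0 \<partial>P)"
        using ae by (intro nn_integral_cong_AE, eventually_elim) (use False in \<open>simp add: ennreal_mult_top\<close>)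
      then show ?thesis using R by simp
    qed
  qed
  have simple: "(\<integral>\<^sup>+\<omega>. neg_exp (\<integral>\<^sup>+z. s z \<partial>N \<omega>) \<partial>P) = neg_exp (\<integral>\<^sup>+z. 1 - neg_exp (s z) \<partial>L) \<and>
      (\<lambda>\<omega>. \<integral>\<^sup>+z. s z \<partial>N \<omega>) \<in> borel_measurable P"
    if s: "simple_function L s" "\<And>x. s x < top" for s
  proof -
    obtain e where e: "bij_betw e {..<card (s ` space L)} (s ` space L)"
      using ex_bij_betw_nat_finite[OF simple_functionD(1)[OF s(1)]] by (auto simp: atLeast0LessThan)
    let ?n = "card (s ` space L)"
    define B where "B k = s -` {e k} \<inter> space L" for k
    have sm: "s \<in> borel_measurable L" by (rule borel_measurable_simple_function) fact
    have B: "B k \<in> sets L" for k unfolding B_def using s(1) by (auto dest: simple_functionD)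
    have ek: "e k < top" if "k < ?n" for k using e s(2) that unfolding bij_betw_def by (metis imageE imageI lessThan_iff)
    have N: "(\<integral>\<^sup>+z. s z \<partial>N \<omega>) = (\<Sum>k<?n. e k * emeasure (N \<omega>) (B k))" for \<omega>
      unfolding B_def by (rule nn_integral_finite_range[OF e sN sm, where g="\<lambda>x. x"])
    have disj: "disjoint_family_on B {..<?n}"
      using e by (auto simp: disjoint_family_on_def B_def bij_betw_def inj_on_def)
    have "indep_vars (\<lambda>_. borel) (\<lambda>i \<omega>. emeasure (N \<omega>) (B i)) {..<?n}"
      using pp B disj unfolding poisson_process_def by blast
    then have ind: "indep_vars (\<lambda>_. borel) (\<lambda>i \<omega>. neg_exp (e i * emeasure (N \<omega>) (B i))) {..<?n}"
      by (rule indep_vars_compose2) measurable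
    have "(\<integral>\<^sup>+\<omega>. neg_exp (\<integral>\<^sup>+z. s z \<partial>N \<omega>) \<partial>P) = (\<integral>\<^sup>+\<omega>. (\<Prod>k<?n. neg_exp (e k * emeasure (N \<omega>) (B k))) \<partial>P)"
      by (simp add: N neg_exp_sum)
    also have "\<dots> = (\<Prod>k<?n. \<integral>\<^sup>+\<omega>. neg_exp (e k * emeasure (N \<omega>) (B k)) \<partial>P)"
      by (rule indep_vars_nn_integral[OF _ ind]) auto
    also have "\<dots> = (\<Prod>k<?n. neg_exp ((1 - neg_exp (e k)) * emeasure L (B k)))"
      by (intro prod.cong refl one B ek) auto
    also have "\<dots> = neg_exp (\<integral>\<^sup>+z. 1 - neg_exp (s z) \<partial>L)"
      unfolding nn_integral_finite_range[OF e refl sm, where g="\<lambda>x. 1 - neg_exp x"] by (simp add: neg_exp_sum B_def)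
    finally show ?thesis unfolding N using meas[OF B] by simp
  qed
  obtain F where F: "\<And>i. simple_function L (F i)" "incseq F" "\<And>i x. F i x < top" "\<And>x. (SUP i. F i x) = f x"
    using borel_measurable_implies_simple_function_sequence'[OF f] by blast
  have Fm[measurable]: "F i \<in> borel_measurable L" for i using F(1) by (rule borel_measurable_simple_function)
  have Fl: "(\<lambda>i. F i x) \<longlonglongrightarrow> f x" for x
    using LIMSEQ_SUP[of "\<lambda>i. F i x"] F(2,4) by (auto simp: incseq_def le_fun_def)
  have lim: "(\<lambda>i. \<integral>\<^sup>+z. F i z \<partial>N \<omega>) \<longlonglongrightarrow> (\<integral>\<^sup>+z. f z \<partial>N \<omega>)" for \<omega>
    by (rule nn_integral_LIMSEQ) (use F(2) Fl in auto)
  have m[measurable]: "(\<lambda>\<omega>. \<integral>\<^sup>+z. F i z \<partial>N \<omega>) \<in> borel_measurable P" for i using simple[OF F(1,3)] by blast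
  have [measurable]: "(\<lambda>\<omega>. \<integral>\<^sup>+z. f z \<partial>N \<omega>) \<in> borel_measurable P"
    by (rule borel_measurable_LIMSEQ_order[OF lim m])
  have "(\<lambda>i. \<integral>\<^sup>+\<omega>. neg_exp (\<integral>\<^sup>+z. F i z \<partial>N \<omega>) \<partial>P) \<longlonglongrightarrow> (\<integral>\<^sup>+\<omega>. neg_exp (\<integral>\<^sup>+z. f z \<partial>N \<omega>) \<partial>P)"
    by (rule nn_integral_dominated_convergence[where w="\<lambda>_. 1"])
       (use lim in \<open>auto simp: neg_exp_le_1 emeasure_space_1 intro!: tendsto_neg_exp\<close>)
  moreover have "(\<lambda>i. neg_exp (\<integral>\<^sup>+z. 1 - neg_exp (F i z) \<partial>L)) \<longlonglongrightarrow> neg_exp (\<integral>\<^sup>+z. 1 - neg_exp (f z) \<partial>L)"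
  proof (intro tendsto_neg_exp nn_integral_LIMSEQ)
    show "incseq (\<lambda>i x. 1 - neg_exp (F i x))"
      using F(2) by (auto simp: incseq_def le_fun_def intro!: ennreal_minus_mono neg_exp_antimono)
    show "(\<lambda>i. 1 - neg_exp (F i x)) \<longlonglongrightarrow> 1 - neg_exp (f x)" for x
      by (intro tendsto_diff_ennreal tendsto_const tendsto_neg_exp Fl) auto
  qed auto
  ultimately show ?thesis
    using simple[OF F(1,3)] by (simp add: LIMSEQ_unique)
qed

lemma nn_integral_count_initial:
  "(\<integral>\<^sup>+i. f i \<partial>count_space {i. enat i < k}) = (\<Sum>i. if enat i < k then f i else 0)"
  by (subst nn_integral_count_space_indicator)
     (auto simp: nn_integral_count_space_nat indicator_def intro!: suminf_cong)

lemma neg_exp_suminf: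
  "(\<lambda>n. \<Prod>i<n. neg_exp (f i)) \<longlonglongrightarrow> neg_exp (\<Sum>i. f i)"
proof -
  have "(\<lambda>n. neg_exp (\<Sum>i<n. f i)) \<longlonglongrightarrow> neg_exp (\<Sum>i. f i)"
    by (intro tendsto_neg_exp summable_LIMSEQ) auto
  then show ?thesis by (simp add: neg_exp_sum)
qed

lemma (in prob_space) distr_pair_indep_set:
  assumes X[measurable]: "X \<in> measurable M S" and Y[measurable]: "Y \<in> measurable M T"
    and ind: "indep_set (sets (vimage_algebra (space M) X S)) (sets (vimage_algebra (space M) Y T))"
  shows "distr M (S \<Otimes>\<^sub>M T) (\<lambda>\<omega>. (X \<omega>, Y \<omega>)) = distr M S X \<Otimes>\<^sub>M distr M T Y"
proof (rule pair_measure_eqI[symmetric])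
  interpret X: prob_space "distr M S X" by (rule prob_space_distr) fact
  interpret Y: prob_space "distr M T Y" by (rule prob_space_distr) fact
  show "sigma_finite_measure (distr M S X)" "sigma_finite_measure (distr M T Y)" by unfold_locales
  fix A B assume "A \<in> sets (distr M S X)" "B \<in> sets (distr M T Y)"
  then have [measurable]: "A \<in> sets S" "B \<in> sets T" by auto
  have "prob ((X -` A \<inter> space M) \<inter> (Y -` B \<inter> space M)) = prob (X -` A \<inter> space M) * prob (Y -` B \<inter> space M)"
    by (rule indep_setD[OF ind]) (auto intro: in_vimage_algebra)
  moreover have "(\<lambda>\<omega>. (X \<omega>, Y \<omega>)) -` (A \<times> B) \<inter> space M = (X -` A \<inter> space M) \<inter> (Y -` B \<inter> space M)" by auto
  ultimately show "emeasure (distr M S X) A * emeasure (distr M T Y) B = emeasure (distr M (S \<Otimes>\<^sub>M T) (\<lambda>\<omega>. (X \<omega>, Y \<omega>))) (A \<times> B)"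
    by (simp add: emeasure_distr emeasure_eq_measure ennreal_mult)
qed (simp cong: sets_pair_measure_cong)

text \<open>Given the starting points, the displacements are independent, so the expectation of a product
  over the first \<open>n\<close> particles is the product of the one-particle expectations \<open>g\<close>. Letting \<open>n\<close> grow,
  what remains is the Laplace functional of the starting points at \<open>- ln g\<close>.\<close>

lemma particle_data_laplace:
  fixes F :: "(real^'d) \<times> (real \<Rightarrow> real^'d) \<Rightarrow> ennreal"
  assumes pd: "particle_data \<Lambda> M \<xi> P K x Y" and M: "prob_space M"
    and xi[measurable]: "\<And>t. \<xi> t \<in> borel_measurable M" and sL: "sets \<Lambda> = sets borel"
    and F[measurable]: "F \<in> borel_measurable (borel \<Otimes>\<^sub>M (\<Pi>\<^sub>M t\<in>UNIV. borel))"
  shows "(\<integral>\<^sup>+\<omega>. neg_exp (\<integral>\<^sup>+i. F (x i \<omega>, \<lambda>t. Y i t \<omega>) \<partial>count_space {i. enat i < K \<omega>}) \<partial>P) =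
         neg_exp (\<integral>\<^sup>+z. (1 - (\<integral>\<^sup>+y. neg_exp (F (z, y)) \<partial>process_law M \<xi>)) \<partial>\<Lambda>)"
proof -
  have P: "prob_space P" and K[measurable]: "K \<in> measurable P (count_space UNIV)"
    and x[measurable]: "\<And>i. x i \<in> borel_measurable P" and Y[measurable]: "\<And>i t. Y i t \<in> borel_measurable P"
    and pp: "poisson_process P \<Lambda> (\<lambda>\<omega>. distr (count_space {i. enat i < K \<omega>}) borel (\<lambda>i. x i \<omega>))"
    and law: "\<And>i. process_law P (Y i) = process_law M \<xi>"
    and iY: "prob_space.indep_vars P (\<lambda>_. \<Pi>\<^sub>M t\<in>UNIV. borel) (\<lambda>i \<omega> t. Y i t \<omega>) UNIV"
    and ixY: "prob_space.indep_set P
       (sets (vimage_algebra (space P) (\<lambda>\<omega>. (K \<omega>, \<lambda>i. x i \<omega>)) (count_space UNIV \<Otimes>\<^sub>M (\<Pi>\<^sub>M i\<in>UNIV. borel))))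
       (sets (vimage_algebra (space P) (\<lambda>\<omega> i t. Y i t \<omega>) (\<Pi>\<^sub>M i\<in>UNIV. \<Pi>\<^sub>M t\<in>UNIV. borel)))"
    using pd unfolding particle_data_def by auto
  interpret P: prob_space P by fact
  interpret M: prob_space M by fact
  note [measurable_cong] = sL
  let ?U = "(\<Pi>\<^sub>M t\<in>UNIV. borel) :: (real \<Rightarrow> real^'d) measure"
  let ?S = "(count_space UNIV \<Otimes>\<^sub>M (\<Pi>\<^sub>M i\<in>UNIV. borel)) :: (enat \<times> (nat \<Rightarrow> real^'d)) measure"
  let ?T = "(\<Pi>\<^sub>M i\<in>UNIV. ?U) :: (nat \<Rightarrow> real \<Rightarrow> real^'d) measure"
  define X where "X \<omega> = (K \<omega>, \<lambda>i. x i \<omega>)" for \<omega>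
  define YY where "YY \<omega> = (\<lambda>i t. Y i t \<omega>)" for \<omega>
  have xim[measurable]: "(\<lambda>\<omega> t. \<xi> t \<omega>) \<in> measurable M ?U" by (rule measurable_PiM_single') auto
  have Yi[measurable]: "(\<lambda>\<omega> t. Y i t \<omega>) \<in> measurable P ?U" for i by (rule measurable_PiM_single') auto
  have X[measurable]: "X \<in> measurable P ?S"
    unfolding X_def by (intro measurable_Pair K measurable_PiM_single') auto
  have YY[measurable]: "YY \<in> measurable P ?T"
    unfolding YY_def by (rule measurable_PiM_single') (auto simp: space_PiM)
  have J: "distr P (?S \<Otimes>\<^sub>M ?T) (\<lambda>\<omega>. (X \<omega>, YY \<omega>)) = distr P ?S X \<Otimes>\<^sub>M distr P ?T YY"
    using ixY by (intro P.distr_pair_indep_set X YY) (simp add: X_def[abs_def] YY_def[abs_def])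
  interpret YT: prob_space "distr P ?T YY" by (rule P.prob_space_distr) fact
  interpret L: prob_space "process_law M \<xi>"
    unfolding process_law_def by (rule M.prob_space_distr) fact
  have sPL[measurable_cong]: "sets (process_law M \<xi>) = sets ?U" by (simp add: process_law_def)
  define g where "g z = (\<integral>\<^sup>+y. neg_exp (F (z, y)) \<partial>process_law M \<xi>)" for z
  have [measurable]: "g \<in> borel_measurable borel" unfolding g_def by measurable
  have g1: "g z \<le> 1" for z
  proof -
    have "g z \<le> (\<integral>\<^sup>+y. 1 \<partial>process_law M \<xi>)" unfolding g_def by (intro nn_integral_mono) (simp add: neg_exp_le_1)
    then show ?thesis by (simp add: L.emeasure_space_1)
  qed
  define H where "H n a = (\<Prod>i<n. if enat i < fst (fst a) then neg_exp (F (snd (fst a) i, snd a i)) else 1)"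
    for n :: nat and a :: "(enat \<times> (nat \<Rightarrow> real^'d)) \<times> (nat \<Rightarrow> real \<Rightarrow> real^'d)"
  have [measurable]: "H n \<in> borel_measurable (?S \<Otimes>\<^sub>M ?T)" for n
    unfolding H_def by measurable
  have fin: "(\<integral>\<^sup>+\<omega>. H n (X \<omega>, YY \<omega>) \<partial>P) = (\<integral>\<^sup>+\<omega>. (\<Prod>i<n. if enat i < K \<omega> then g (x i \<omega>) else 1) \<partial>P)" for n
  proof -
    have "(\<integral>\<^sup>+\<omega>. H n (X \<omega>, YY \<omega>) \<partial>P) = (\<integral>\<^sup>+a. H n a \<partial>distr P (?S \<Otimes>\<^sub>M ?T) (\<lambda>\<omega>. (X \<omega>, YY \<omega>)))"
      by (subst nn_integral_distr) auto
    also have "\<dots> = (\<integral>\<^sup>+a. \<integral>\<^sup>+b. H n (a, b) \<partial>distr P ?T YY \<partial>distr P ?S X)"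
      unfolding J by (subst YT.nn_integral_fst) auto
    also have "\<dots> = (\<integral>\<^sup>+\<omega>. \<integral>\<^sup>+\<omega>'. H n (X \<omega>, YY \<omega>') \<partial>P \<partial>P)"
      by (subst nn_integral_distr) (auto simp: nn_integral_distr intro!: nn_integral_cong)
    also have "\<dots> = (\<integral>\<^sup>+\<omega>. (\<Prod>i<n. if enat i < K \<omega> then g (x i \<omega>) else 1) \<partial>P)"
    proof (rule nn_integral_cong)
      fix \<omega>
      define h where "h i y = (if enat i < K \<omega> then neg_exp (F (x i \<omega>, y)) else 1)" for i y
      have [measurable]: "h i \<in> borel_measurable ?U" for i unfolding h_def by measurable
      have "P.indep_vars (\<lambda>_. ?U) (\<lambda>i \<omega> t. Y i t \<omega>) {..<n}"
        by (rule P.indep_vars_subset[OF iY]) auto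
      then have ind: "P.indep_vars (\<lambda>_. borel) (\<lambda>i \<omega>. h i (\<lambda>t. Y i t \<omega>)) {..<n}"
        by (rule P.indep_vars_compose2) measurable
      have "(\<integral>\<^sup>+\<omega>'. H n (X \<omega>, YY \<omega>') \<partial>P) = (\<integral>\<^sup>+\<omega>'. (\<Prod>i<n. h i (\<lambda>t. Y i t \<omega>')) \<partial>P)"
        unfolding H_def X_def YY_def h_def by (simp cong: if_cong)
      also have "\<dots> = (\<Prod>i<n. \<integral>\<^sup>+\<omega>'. h i (\<lambda>t. Y i t \<omega>') \<partial>P)"
        by (rule P.indep_vars_nn_integral[OF _ ind]) auto
      also have "\<dots> = (\<Prod>i<n. if enat i < K \<omega> then g (x i \<omega>) else 1)"
      proof (intro prod.cong refl)
        fix i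
        have "(\<integral>\<^sup>+\<omega>'. h i (\<lambda>t. Y i t \<omega>') \<partial>P) = (\<integral>\<^sup>+y. h i y \<partial>process_law P (Y i))"
          unfolding process_law_def by (subst nn_integral_distr) auto
        also have "\<dots> = (if enat i < K \<omega> then g (x i \<omega>) else 1)"
          unfolding law by (simp add: h_def g_def L.emeasure_space_1)
        finally show "(\<integral>\<^sup>+\<omega>'. h i (\<lambda>t. Y i t \<omega>') \<partial>P) = (if enat i < K \<omega> then g (x i \<omega>) else 1)" .
      qed
      finally show "(\<integral>\<^sup>+\<omega>'. H n (X \<omega>, YY \<omega>') \<partial>P) = (\<Prod>i<n. if enat i < K \<omega> then g (x i \<omega>) else 1)" .
    qed
    finally show ?thesis .
  qed
  have H1: "H n a \<le> 1" for n a unfolding H_def by (intro prod_le_1) (auto simp: neg_exp_le_1)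
  have lim1: "(\<lambda>n. H n (X \<omega>, YY \<omega>)) \<longlonglongrightarrow> neg_exp (\<integral>\<^sup>+i. F (x i \<omega>, \<lambda>t. Y i t \<omega>) \<partial>count_space {i. enat i < K \<omega>})" for \<omega>
  proof -
    have "H n (X \<omega>, YY \<omega>) = (\<Prod>i<n. neg_exp (if enat i < K \<omega> then F (x i \<omega>, \<lambda>t. Y i t \<omega>) else 0))" for n
      unfolding H_def X_def YY_def by (intro prod.cong) auto
    then show ?thesis unfolding nn_integral_count_initial by (simp only: neg_exp_suminf)
  qed
  define f where "f z = (if g z = 0 then \<infinity> else ennreal (- ln (enn2real (g z))))" for z
  have [measurable]: "f \<in> borel_measurable borel" unfolding f_def by measurable
  have nf: "neg_exp (f z) = g z" for z unfolding f_def by (rule neg_exp_surj[OF g1])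
  have [measurable]: "Measurable.pred P (\<lambda>\<omega>. enat i < K \<omega>)" for i by measurable
  have lim2: "(\<lambda>n. \<Prod>i<n. if enat i < K \<omega> then g (x i \<omega>) else 1) \<longlonglongrightarrow>
      neg_exp (\<integral>\<^sup>+z. f z \<partial>distr (count_space {i. enat i < K \<omega>}) borel (\<lambda>i. x i \<omega>))" for \<omega>
  proof -
    have "(\<Prod>i<n. if enat i < K \<omega> then g (x i \<omega>) else 1) = (\<Prod>i<n. neg_exp (if enat i < K \<omega> then f (x i \<omega>) else 0))" for n
      by (intro prod.cong) (auto simp: nf)
    moreover have "(\<integral>\<^sup>+z. f z \<partial>distr (count_space {i. enat i < K \<omega>}) borel (\<lambda>i. x i \<omega>)) = (\<Sum>i. if enat i < K \<omega> then f (x i \<omega>) else 0)"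
      by (subst nn_integral_distr) (auto simp: nn_integral_count_initial)
    ultimately show ?thesis by (simp only: neg_exp_suminf)
  qed
  have m2[measurable]: "(\<lambda>\<omega>. \<Prod>i<n. if enat i < K \<omega> then g (x i \<omega>) else 1) \<in> borel_measurable P" for n
    by measurable
  have m1[measurable]: "(\<lambda>\<omega>. H n (X \<omega>, YY \<omega>)) \<in> borel_measurable P" for n by measurable
  have "(\<lambda>n. \<integral>\<^sup>+\<omega>. H n (X \<omega>, YY \<omega>) \<partial>P) \<longlonglongrightarrow> (\<integral>\<^sup>+\<omega>. neg_exp (\<integral>\<^sup>+i. F (x i \<omega>, \<lambda>t. Y i t \<omega>) \<partial>count_space {i. enat i < K \<omega>}) \<partial>P)"
    by (rule nn_integral_dominated_convergence[where w="\<lambda>_. 1", OF m1 borel_measurable_LIMSEQ_order[OF lim1 m1]])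
       (auto simp: H1 lim1 P.emeasure_space_1)
  moreover have "(\<lambda>n. \<integral>\<^sup>+\<omega>. (\<Prod>i<n. if enat i < K \<omega> then g (x i \<omega>) else 1) \<partial>P) \<longlonglongrightarrow>
      (\<integral>\<^sup>+\<omega>. neg_exp (\<integral>\<^sup>+z. f z \<partial>distr (count_space {i. enat i < K \<omega>}) borel (\<lambda>i. x i \<omega>)) \<partial>P)"
    by (rule nn_integral_dominated_convergence[where w="\<lambda>_. 1", OF m2 borel_measurable_LIMSEQ_order[OF lim2 m2]])
       (auto simp: lim2 P.emeasure_space_1 g1 intro!: prod_le_1)
  ultimately have "(\<integral>\<^sup>+\<omega>. neg_exp (\<integral>\<^sup>+i. F (x i \<omega>, \<lambda>t. Y i t \<omega>) \<partial>count_space {i. enat i < K \<omega>}) \<partial>P) =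
      (\<integral>\<^sup>+\<omega>. neg_exp (\<integral>\<^sup>+z. f z \<partial>distr (count_space {i. enat i < K \<omega>}) borel (\<lambda>i. x i \<omega>)) \<partial>P)"
    unfolding fin by (rule LIMSEQ_unique)
  also have "\<dots> = neg_exp (\<integral>\<^sup>+z. 1 - neg_exp (f z) \<partial>\<Lambda>)"
    by (rule poisson_process_laplace[OF P pp]) (auto simp: sL)
  finally show ?thesis by (simp add: nf g_def)
qed

definition intensity :: "(real^'d) measure \<Rightarrow> 'a measure \<Rightarrow> (real \<Rightarrow> 'a \<Rightarrow> real^'d) \<Rightarrow> nat \<Rightarrow> (nat \<Rightarrow> real) \<Rightarrow> (nat \<Rightarrow> real^'d) measure" where
  "intensity \<Lambda> M \<xi> n t = distr (\<Lambda> \<Otimes>\<^sub>M M) (\<Pi>\<^sub>M j\<in>{..<n}. borel) (\<lambda>(x, \<omega>). \<lambda>j\<in>{..<n}. x + \<xi> (t j) \<omega>)"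

lemma sets_intensity [simp, measurable_cong]: "sets (intensity \<Lambda> M \<xi> n t) = sets (\<Pi>\<^sub>M j\<in>{..<n}. borel)"
  by (simp add: intensity_def)

lemma nn_integral_intensity:
  fixes \<xi> :: "real \<Rightarrow> 'a \<Rightarrow> real^'d"
  assumes M: "prob_space M" and xi[measurable]: "\<And>t. \<xi> t \<in> borel_measurable M" and sL[measurable_cong]: "sets \<Lambda> = sets borel"
    and H[measurable]: "H \<in> borel_measurable (\<Pi>\<^sub>M j\<in>{..<n}. borel)"
  shows "(\<integral>\<^sup>+z. H z \<partial>intensity \<Lambda> M \<xi> n t) = (\<integral>\<^sup>+x. \<integral>\<^sup>+\<omega>. H (\<lambda>j\<in>{..<n}. x + \<xi> (t j) \<omega>) \<partial>M \<partial>\<Lambda>)"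
proof -
  interpret prob_space M by fact
  have [measurable]: "(\<lambda>(x, \<omega>). \<lambda>j\<in>{..<n}. x + \<xi> (t j) \<omega>) \<in> measurable (\<Lambda> \<Otimes>\<^sub>M M) (\<Pi>\<^sub>M j\<in>{..<n}. borel)"
    by measurable
  show ?thesis unfolding intensity_def
    by (subst nn_integral_distr, simp, simp, subst nn_integral_fst[symmetric]) auto
qed

lemma particle_system_laplace:
  fixes \<xi> :: "real \<Rightarrow> 'a \<Rightarrow> real^'d"
  assumes pd: "particle_data \<Lambda> M \<xi> P K x Y" and M: "prob_space M"
    and xi[measurable]: "\<And>t. \<xi> t \<in> borel_measurable M" and sL: "sets \<Lambda> = sets borel"
    and H[measurable]: "H \<in> borel_measurable (\<Pi>\<^sub>M j\<in>{..<n}. borel)"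
  shows "(\<integral>\<^sup>+\<omega>. neg_exp (\<integral>\<^sup>+z. H z \<partial>particle_system K x Y n t \<omega>) \<partial>P) =
    neg_exp (\<integral>\<^sup>+z. 1 - neg_exp (H z) \<partial>intensity \<Lambda> M \<xi> n t)"
proof -
  interpret M: prob_space M by fact
  let ?F = "\<lambda>(z, y). H (\<lambda>j\<in>{..<n}. z + y (t j))"
  have Fm[measurable]: "?F \<in> borel_measurable (borel \<Otimes>\<^sub>M (\<Pi>\<^sub>M t\<in>UNIV. borel))" by measurable
  have [measurable]: "(\<lambda>\<omega> t. \<xi> t \<omega>) \<in> measurable M (\<Pi>\<^sub>M t\<in>UNIV. borel)" by (rule measurable_PiM_single') auto
  have e1: "(\<integral>\<^sup>+y. neg_exp (?F (z, y)) \<partial>process_law M \<xi>) = (\<integral>\<^sup>+\<omega>. neg_exp (H (\<lambda>j\<in>{..<n}. z + \<xi> (t j) \<omega>)) \<partial>M)" for z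
    unfolding process_law_def by (subst nn_integral_distr) auto
  have e2: "1 - (\<integral>\<^sup>+\<omega>. neg_exp (H (\<lambda>j\<in>{..<n}. z + \<xi> (t j) \<omega>)) \<partial>M) = (\<integral>\<^sup>+\<omega>. 1 - neg_exp (H (\<lambda>j\<in>{..<n}. z + \<xi> (t j) \<omega>)) \<partial>M)" for z
  proof (subst nn_integral_diff)
    have "(\<integral>\<^sup>+\<omega>. neg_exp (H (\<lambda>j\<in>{..<n}. z + \<xi> (t j) \<omega>)) \<partial>M) \<le> (\<integral>\<^sup>+\<omega>. 1 \<partial>M)"
      by (intro nn_integral_mono) (simp add: neg_exp_le_1)
    then show "(\<integral>\<^sup>+\<omega>. neg_exp (H (\<lambda>j\<in>{..<n}. z + \<xi> (t j) \<omega>)) \<partial>M) \<noteq> \<infinity>"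
      by (auto simp: M.emeasure_space_1 top_unique)
  qed (auto simp: neg_exp_le_1 M.emeasure_space_1)
  have "(\<integral>\<^sup>+z. H z \<partial>particle_system K x Y n t \<omega>) = (\<integral>\<^sup>+i. ?F (x i \<omega>, \<lambda>t. Y i t \<omega>) \<partial>count_space {i. enat i < K \<omega>})" for \<omega>
    unfolding particle_system_def by (subst nn_integral_distr) (auto simp: space_PiM)
  then have "(\<integral>\<^sup>+\<omega>. neg_exp (\<integral>\<^sup>+z. H z \<partial>particle_system K x Y n t \<omega>) \<partial>P) =
    neg_exp (\<integral>\<^sup>+z. (1 - (\<integral>\<^sup>+y. neg_exp (?F (z, y)) \<partial>process_law M \<xi>)) \<partial>\<Lambda>)"
    using particle_data_laplace[OF pd M xi sL Fm] by simp
  also have "\<dots> = neg_exp (\<integral>\<^sup>+z. \<integral>\<^sup>+\<omega>. 1 - neg_exp (H (\<lambda>j\<in>{..<n}. z + \<xi> (t j) \<omega>)) \<partial>M \<partial>\<Lambda>)"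
    by (simp only: e1 e2)
  finally show ?thesis using M xi sL by (subst nn_integral_intensity) auto
qed

text \<open>The void probabilities \<open>P(N(B) = 0) = exp (- Q(B))\<close> recover the intensity \<open>Q\<close> from the law. For
  the converse, the Laplace functional at sums of multiples of indicators is the joint Laplace
  transform of finitely many counts at integer arguments.\<close>

lemma point_process_law_eq_iff:
  fixes \<xi> :: "real \<Rightarrow> 'a \<Rightarrow> real^'d"
  assumes pd: "particle_data \<Lambda> M \<xi> P K x Y" and M: "prob_space M"
    and xi: "\<And>t. \<xi> t \<in> borel_measurable M" and sL: "sets \<Lambda> = sets borel"
  shows "point_process_law P (\<Pi>\<^sub>M j\<in>{..<n}. borel) (particle_system K x Y n t) =
         point_process_law P (\<Pi>\<^sub>M j\<in>{..<n}. borel) (particle_system K x Y n t') \<longleftrightarrow>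
         intensity \<Lambda> M \<xi> n t = intensity \<Lambda> M \<xi> n t'"
proof -
  have P: "prob_space P" and K[measurable]: "K \<in> measurable P (count_space UNIV)"
    and x[measurable]: "\<And>i. x i \<in> borel_measurable P" and Y[measurable]: "\<And>i t. Y i t \<in> borel_measurable P"
    using pd unfolding particle_data_def by auto
  interpret P: prob_space P by fact
  let ?E = "(\<Pi>\<^sub>M j\<in>{..<n}. borel) :: (nat \<Rightarrow> real^'d) measure"
  let ?N = "particle_system K x Y n"
  note laplace = particle_system_laplace[OF pd M xi sL]
  have N[measurable]: "(\<lambda>\<omega>. emeasure (?N t \<omega>) B) \<in> borel_measurable P" if [measurable]: "B \<in> sets ?E" for B t
  proof -
    have "emeasure (?N t \<omega>) B = (\<Sum>i. if enat i < K \<omega> then indicator B (\<lambda>j\<in>{..<n}. x i \<omega> + Y i (t j) \<omega>) else 0)" for \<omega>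
    proof -
      have "emeasure (?N t \<omega>) B = (\<integral>\<^sup>+z. indicator B z \<partial>?N t \<omega>)"
        using that by (simp add: particle_system_def)
      also have "\<dots> = (\<integral>\<^sup>+i. indicator B (\<lambda>j\<in>{..<n}. x i \<omega> + Y i (t j) \<omega>) \<partial>count_space {i. enat i < K \<omega>})"
        unfolding particle_system_def by (subst nn_integral_distr) (auto simp: space_PiM)
      finally show ?thesis by (simp add: nn_integral_count_initial)
    qed
    moreover have "(\<lambda>\<omega>. indicator B (\<lambda>j\<in>{..<n}. x i \<omega> + Y i (t j) \<omega>) :: ennreal) \<in> borel_measurable P" for i
      by measurable
    ultimately show ?thesis by simp
  qed
  have NN[measurable]: "(\<lambda>\<omega>. \<lambda>B\<in>sets ?E. emeasure (?N t \<omega>) B) \<in> measurable P (\<Pi>\<^sub>M B\<in>sets ?E. borel)" for t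
    by (rule measurable_restrict) (rule N)
  show ?thesis
  proof
    assume eq: "point_process_law P ?E (?N t) = point_process_law P ?E (?N t')"
    show "intensity \<Lambda> M \<xi> n t = intensity \<Lambda> M \<xi> n t'"
    proof (rule measure_eqI)
      fix B assume "B \<in> sets (intensity \<Lambda> M \<xi> n t)"
      then have B[measurable]: "B \<in> sets ?E" by simp
      have [measurable]: "(\<lambda>g. neg_exp (\<infinity> * g B)) \<in> borel_measurable (\<Pi>\<^sub>M B\<in>sets ?E. (borel :: ennreal measure))"
        using B by measurable
      have "neg_exp (emeasure (intensity \<Lambda> M \<xi> n s) B) = (\<integral>\<^sup>+g. neg_exp (\<infinity> * g B) \<partial>point_process_law P ?E (?N s))" for s
      proof -
        have "(\<integral>\<^sup>+g. neg_exp (\<infinity> * g B) \<partial>point_process_law P ?E (?N s)) = (\<integral>\<^sup>+\<omega>. neg_exp (\<infinity> * emeasure (?N s \<omega>) B) \<partial>P)"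
          unfolding point_process_law_def by (subst nn_integral_distr) (auto simp: B)
        also have "\<dots> = (\<integral>\<^sup>+\<omega>. neg_exp (\<integral>\<^sup>+z. \<infinity> * indicator B z \<partial>?N s \<omega>) \<partial>P)"
          by (subst nn_integral_cmult_indicator) (auto simp: particle_system_def)
        also have "\<dots> = neg_exp (\<integral>\<^sup>+z. 1 - neg_exp (\<infinity> * indicator B z) \<partial>intensity \<Lambda> M \<xi> n s)"
          by (rule laplace) measurable
        also have "(\<lambda>z. 1 - neg_exp (\<infinity> * indicator B z)) = indicator B"
          by (auto simp: indicator_def fun_eq_iff)
        finally show ?thesis by simp
      qed
      then have "neg_exp (emeasure (intensity \<Lambda> M \<xi> n t) B) = neg_exp (emeasure (intensity \<Lambda> M \<xi> n t') B)"
        by (simp only: eq)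
      then show "emeasure (intensity \<Lambda> M \<xi> n t) B = emeasure (intensity \<Lambda> M \<xi> n t') B"
        by (rule neg_exp_inj)
    qed simp
  next
    assume eq: "intensity \<Lambda> M \<xi> n t = intensity \<Lambda> M \<xi> n t'"
    show "point_process_law P ?E (?N t) = point_process_law P ?E (?N t')"
    proof (rule measure_eqI_PiM_infinite[where I="sets ?E" and M="\<lambda>_. borel"])
      show "finite_measure (point_process_law P ?E (?N t))"
        unfolding point_process_law_def by (intro prob_space.finite_measure P.prob_space_distr NN)
      fix A and J assume J: "finite J" "J \<subseteq> sets ?E" and A: "\<And>i. i \<in> J \<Longrightarrow> A i \<in> sets (borel :: ennreal measure)"
      have JB: "\<And>B. B \<in> J \<Longrightarrow> B \<in> sets ?E" using J by auto
      define D where "D s = distr P (\<Pi>\<^sub>M B\<in>J. borel) (\<lambda>\<omega>. \<lambda>B\<in>J. emeasure (?N s \<omega>) B)" for s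
      have JN[measurable]: "(\<lambda>\<omega>. \<lambda>B\<in>J. emeasure (?N s \<omega>) B) \<in> measurable P (\<Pi>\<^sub>M B\<in>J. borel)" for s
        by (rule measurable_restrict) (rule N[OF JB])
      have Dint: "(\<integral>\<^sup>+g. (\<Prod>B\<in>J. neg_exp (of_nat (p B) * g B)) \<partial>D s) =
          neg_exp (\<integral>\<^sup>+z. 1 - neg_exp (\<Sum>B\<in>J. of_nat (p B) * indicator B z) \<partial>intensity \<Lambda> M \<xi> n s)" for p s
      proof -
        have m: "(\<lambda>z. \<Sum>B\<in>J. of_nat (p B) * indicator B z :: ennreal) \<in> borel_measurable ?E"
          using JB by (intro borel_measurable_sum borel_measurable_times_ennreal borel_measurable_indicator) auto
        have "(\<integral>\<^sup>+g. (\<Prod>B\<in>J. neg_exp (of_nat (p B) * g B)) \<partial>D s) = (\<integral>\<^sup>+\<omega>. (\<Prod>B\<in>J. neg_exp (of_nat (p B) * emeasure (?N s \<omega>) B)) \<partial>P)"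
          unfolding D_def by (subst nn_integral_distr) auto
        also have "\<dots> = (\<integral>\<^sup>+\<omega>. neg_exp (\<integral>\<^sup>+z. (\<Sum>B\<in>J. of_nat (p B) * indicator B z) \<partial>?N s \<omega>) \<partial>P)"
        proof (rule nn_integral_cong)
          fix \<omega>
          have "(\<integral>\<^sup>+z. (\<Sum>B\<in>J. of_nat (p B) * indicator B z) \<partial>?N s \<omega>) = (\<Sum>B\<in>J. of_nat (p B) * emeasure (?N s \<omega>) B)"
            using JB by (subst nn_integral_sum) (auto simp: particle_system_def nn_integral_cmult_indicator)
          then show "(\<Prod>B\<in>J. neg_exp (of_nat (p B) * emeasure (?N s \<omega>) B)) = neg_exp (\<integral>\<^sup>+z. (\<Sum>B\<in>J. of_nat (p B) * indicator B z) \<partial>?N s \<omega>)"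
            by (simp add: neg_exp_sum)
        qed
        finally show ?thesis using laplace[OF m, of s] by simp
      qed
      have "D t = D t'"
      proof (rule determining_prod[OF determining_laplace J(1)])
        fix p :: "(nat \<Rightarrow> real^'d) set \<Rightarrow> nat"
        show "(\<integral>\<^sup>+g. (\<Prod>B\<in>J. neg_exp (of_nat (p B) * g B)) \<partial>D t) = (\<integral>\<^sup>+g. (\<Prod>B\<in>J. neg_exp (of_nat (p B) * g B)) \<partial>D t')"
          by (simp only: Dint eq)
        show "(\<integral>\<^sup>+g. (\<Prod>B\<in>J. neg_exp (of_nat (p B) * g B)) \<partial>D t) < \<infinity>"
          unfolding Dint by (simp add: less_top[symmetric])
      qed (auto simp: D_def intro!: prob_space.finite_measure P.prob_space_distr JN)
      moreover have "emeasure (point_process_law P ?E (?N s)) (prod_emb (sets ?E) (\<lambda>_. borel) J (PiE J A)) = emeasure (D s) (PiE J A)" for s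
      proof -
        have m1: "PiE J A \<in> sets (\<Pi>\<^sub>M B\<in>J. borel)" using J A by (intro sets_PiM_I_finite) auto
        have m2: "prod_emb (sets ?E) (\<lambda>_. borel) J (PiE J A) \<in> sets (\<Pi>\<^sub>M B\<in>sets ?E. borel)"
          using J A by (intro sets_PiM_I) auto
        show ?thesis
          unfolding D_def point_process_law_def emeasure_distr[OF NN m2] emeasure_distr[OF JN m1]
          by (rule arg_cong[where f="emeasure P"])
             (use J in \<open>auto simp: prod_emb_def space_PiM PiE_def Pi_def extensional_def restrict_def\<close>)
      qed
      ultimately show "emeasure (point_process_law P ?E (?N t)) (prod_emb (sets ?E) (\<lambda>_. borel) J (PiE J A)) =
          emeasure (point_process_law P ?E (?N t')) (prod_emb (sets ?E) (\<lambda>_. borel) J (PiE J A))" by simp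
    qed (simp_all add: point_process_law_def)
  qed
qed

lemma stationary_particle_system_iff:
  fixes \<xi> :: "real \<Rightarrow> 'a \<Rightarrow> real^'d"
  assumes pd: "particle_data \<Lambda> M \<xi> P K x Y" and M: "prob_space M"
    and xi: "\<And>t. \<xi> t \<in> borel_measurable M" and sL: "sets \<Lambda> = sets borel"
  shows "stationary_particle_system P K x Y \<longleftrightarrow>
    (\<forall>n\<ge>1. \<forall>s t. intensity \<Lambda> M \<xi> n t = intensity \<Lambda> M \<xi> n (\<lambda>j. t j + s))"
  unfolding stationary_particle_system_def point_process_law_eq_iff[OF assms] ..

section \<open>Spaces of Gaussian variables\<close>

text \<open>Completing the square: an exponential weight shifts the mean of a normal density.\<close>

lemma normal_density_exp:
  "\<sigma> > 0 \<Longrightarrow> normal_density \<mu> \<sigma> u * exp u = exp (\<mu> + \<sigma>\<^sup>2 / 2) * normal_density (\<mu> + \<sigma>\<^sup>2) \<sigma> u"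
  unfolding normal_density_def
proof -
  assume "\<sigma> > 0"
  then have "- (u - \<mu>)\<^sup>2 / (2 * \<sigma>\<^sup>2) + u = \<mu> + \<sigma>\<^sup>2 / 2 + (- (u - (\<mu> + \<sigma>\<^sup>2))\<^sup>2 / (2 * \<sigma>\<^sup>2))"
    by (simp add: field_simps power2_eq_square)
  then have "exp (- (u - \<mu>)\<^sup>2 / (2 * \<sigma>\<^sup>2)) * exp u = exp (\<mu> + \<sigma>\<^sup>2 / 2) * exp (- (u - (\<mu> + \<sigma>\<^sup>2))\<^sup>2 / (2 * \<sigma>\<^sup>2))"
    by (simp only: exp_add[symmetric])
  then show "1 / sqrt (2 * pi * \<sigma>\<^sup>2) * exp (- (u - \<mu>)\<^sup>2 / (2 * \<sigma>\<^sup>2)) * exp u =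
    exp (\<mu> + \<sigma>\<^sup>2 / 2) * (1 / sqrt (2 * pi * \<sigma>\<^sup>2) * exp (- (u - (\<mu> + \<sigma>\<^sup>2))\<^sup>2 / (2 * \<sigma>\<^sup>2)))"
    by (simp only: mult.assoc mult.left_commute[of "exp (\<mu> + \<sigma>\<^sup>2 / 2)"])
qed

lemma gaussian_rv_cases:
  assumes "prob_space M" "gaussian_rv M X"
  obtains (const) \<mu> where "AE \<omega> in M. X \<omega> = \<mu>"
  | (normal) \<mu> \<sigma> where "\<sigma> > 0" "distributed M lborel X (normal_density \<mu> \<sigma>)"
proof -
  interpret prob_space M by fact
  have X[measurable]: "X \<in> borel_measurable M" using assms(2) by (simp add: gaussian_rv_def)
  from assms(2) consider \<mu> where "distr M borel X = return borel \<mu>" | \<mu> \<sigma> where "\<sigma> > 0" "distr M borel X = density lborel (normal_density \<mu> \<sigma>)"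
    unfolding gaussian_rv_def by auto
  then show thesis
  proof cases
    case 1
    have "AE u in distr M borel X. u = \<mu>" unfolding 1 by (subst AE_return) auto
    then have "AE \<omega> in M. X \<omega> = \<mu>" by (subst (asm) AE_distr_iff) auto
    then show thesis by (rule const)
  next
    case 2
    then have "distributed M lborel X (normal_density \<mu> \<sigma>)"
      unfolding distributed_def by (auto simp: measurable_lborel1 cong: distr_cong)
    then show thesis using 2 by (intro normal)
  qed
qed

lemma gaussian_rv_moments:
  assumes M: "prob_space M" and G: "gaussian_rv M X"
  shows gaussian_rv_integrable: "integrable M X"
    and gaussian_rv_integrable_square: "integrable M (\<lambda>\<omega>. (X \<omega>)\<^sup>2)"
    and gaussian_rv_mgf: "(\<integral>\<^sup>+\<omega>. ennreal (exp (X \<omega>)) \<partial>M) =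
           ennreal (exp (integral\<^sup>L M X + (\<integral>\<omega>. (X \<omega> - integral\<^sup>L M X)\<^sup>2 \<partial>M) / 2))"
proof -
  interpret prob_space M by fact
  have X[measurable]: "X \<in> borel_measurable M" using G by (simp add: gaussian_rv_def)
  have "integrable M X \<and> integrable M (\<lambda>\<omega>. (X \<omega>)\<^sup>2) \<and> (\<integral>\<^sup>+\<omega>. ennreal (exp (X \<omega>)) \<partial>M) =
           ennreal (exp (integral\<^sup>L M X + (\<integral>\<omega>. (X \<omega> - integral\<^sup>L M X)\<^sup>2 \<partial>M) / 2))"
    using M G
  proof (cases rule: gaussian_rv_cases)
    case (const \<mu>)
    have "integrable M X \<longleftrightarrow> integrable M (\<lambda>_. \<mu>)" by (rule integrable_cong_AE) (use const in auto)
    moreover have "integrable M (\<lambda>\<omega>. (X \<omega>)\<^sup>2) \<longleftrightarrow> integrable M (\<lambda>_. \<mu>\<^sup>2)"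
      by (rule integrable_cong_AE) (use const in auto)
    moreover have E: "integral\<^sup>L M X = (\<integral>\<omega>. \<mu> \<partial>M)" by (rule integral_cong_AE) (use const in auto)
    moreover have "(\<integral>\<omega>. (X \<omega> - integral\<^sup>L M X)\<^sup>2 \<partial>M) = (\<integral>\<omega>. 0 \<partial>M)"
      by (rule integral_cong_AE) (use const E in \<open>auto simp: prob_space\<close>)
    moreover have "(\<integral>\<^sup>+\<omega>. ennreal (exp (X \<omega>)) \<partial>M) = (\<integral>\<^sup>+\<omega>. ennreal (exp \<mu>) \<partial>M)"
      by (rule nn_integral_cong_AE) (use const in auto)
    ultimately show ?thesis by (simp add: prob_space emeasure_space_1)
  next
    case (normal \<mu> \<sigma>)
    note D = normal(2) and s = normal(1)
    have E: "expectation X = \<mu>" and V: "variance X = \<sigma>\<^sup>2"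
      using normal_distributed_expectation[OF s D] normal_distributed_variance[OF s D] by auto
    have i1: "integrable lborel (\<lambda>u. normal_density \<mu> \<sigma> u * u)"
      by (rule integrable_normal_moment_nz_1) fact
    have i2: "integrable lborel (\<lambda>u. normal_density \<mu> \<sigma> u * (u - \<mu>)^2)"
      by (rule integrable_normal_moment) fact
    have i0: "integrable lborel (normal_density \<mu> \<sigma>)" using s by simp
    have "integrable lborel (\<lambda>u. normal_density \<mu> \<sigma> u * (u - \<mu>)^2 + 2 * \<mu> * (normal_density \<mu> \<sigma> u * u) - \<mu>^2 * normal_density \<mu> \<sigma> u)"
      using i0 i1 i2 by simp
    also have "(\<lambda>u. normal_density \<mu> \<sigma> u * (u - \<mu>)^2 + 2 * \<mu> * (normal_density \<mu> \<sigma> u * u) - \<mu>^2 * normal_density \<mu> \<sigma> u) = (\<lambda>u. normal_density \<mu> \<sigma> u * u\<^sup>2)"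
      by (auto simp: fun_eq_iff power2_eq_square algebra_simps)
    finally have i3: "integrable lborel (\<lambda>u. normal_density \<mu> \<sigma> u * u\<^sup>2)" .
    have I1: "integrable M X"
      using distributed_integrable[OF D, of "\<lambda>u. u"] i1 by simp
    have I2: "integrable M (\<lambda>\<omega>. (X \<omega>)\<^sup>2)"
      using distributed_integrable[OF D, of "\<lambda>u. u\<^sup>2"] i3 by simp
    have "(\<integral>\<^sup>+\<omega>. ennreal (exp (X \<omega>)) \<partial>M) = (\<integral>\<^sup>+u. ennreal (normal_density \<mu> \<sigma> u) * ennreal (exp u) \<partial>lborel)"
      by (rule distributed_nn_integral[OF D, symmetric]) auto
    also have "\<dots> = (\<integral>\<^sup>+u. ennreal (exp (\<mu> + \<sigma>\<^sup>2 / 2)) * ennreal (normal_density (\<mu> + \<sigma>\<^sup>2) \<sigma> u) \<partial>lborel)"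
      by (simp add: normal_density_exp[OF s] flip: ennreal_mult)
    also have "\<dots> = ennreal (exp (\<mu> + \<sigma>\<^sup>2 / 2)) * (\<integral>\<^sup>+u. ennreal (normal_density (\<mu> + \<sigma>\<^sup>2) \<sigma> u) \<partial>lborel)"
      by (rule nn_integral_cmult) auto
    also have "(\<integral>\<^sup>+u. ennreal (normal_density (\<mu> + \<sigma>\<^sup>2) \<sigma> u) \<partial>lborel) = 1"
      using s by (subst nn_integral_eq_integral) auto
    finally show ?thesis using I1 I2 E V by simp
  qed
  then show "integrable M X" "integrable M (\<lambda>\<omega>. (X \<omega>)\<^sup>2)" "(\<integral>\<^sup>+\<omega>. ennreal (exp (X \<omega>)) \<partial>M) =
           ennreal (exp (integral\<^sup>L M X + (\<integral>\<omega>. (X \<omega> - integral\<^sup>L M X)\<^sup>2 \<partial>M) / 2))" by auto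
qed

definition cov :: "'a measure \<Rightarrow> ('a \<Rightarrow> real) \<Rightarrow> ('a \<Rightarrow> real) \<Rightarrow> real" where
  "cov M X Y = (\<integral>\<omega>. (X \<omega> - integral\<^sup>L M X) * (Y \<omega> - integral\<^sup>L M Y) \<partial>M)"

lemma cov_commute: "cov M X Y = cov M Y X"
  by (simp add: cov_def mult.commute)

text \<open>A vector space of Gaussian variables containing the constants. Its elements are jointly
  Gaussian, so all laws below are determined by means and covariances.\<close>

locale gaussian_space = prob_space M for M :: "'a measure" +
  fixes V :: "('a \<Rightarrow> real) set"
  assumes gaussian: "X \<in> V \<Longrightarrow> gaussian_rv M X"
    and const: "(\<lambda>_. c) \<in> V"
    and add: "X \<in> V \<Longrightarrow> Y \<in> V \<Longrightarrow> (\<lambda>\<omega>. X \<omega> + Y \<omega>) \<in> V"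
    and scale: "X \<in> V \<Longrightarrow> (\<lambda>\<omega>. c * X \<omega>) \<in> V"
begin

lemma diff: "X \<in> V \<Longrightarrow> Y \<in> V \<Longrightarrow> (\<lambda>\<omega>. X \<omega> - Y \<omega>) \<in> V"
  using add[OF _ scale[of Y "-1"], of X] by simp

lemma sum: "(\<And>i. i \<in> I \<Longrightarrow> X i \<in> V) \<Longrightarrow> (\<lambda>\<omega>. \<Sum>i\<in>I. X i \<omega>) \<in> V"
  by (induction I rule: infinite_finite_induct) (auto intro: add const)

lemma meas[measurable_dest]: "X \<in> V \<Longrightarrow> X \<in> borel_measurable M"
  using gaussian by (auto simp: gaussian_rv_def)

lemma integrable: "X \<in> V \<Longrightarrow> integrable M X"
  by (rule gaussian_rv_integrable[OF prob_space_axioms gaussian])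

lemma integrable_mult: "X \<in> V \<Longrightarrow> Y \<in> V \<Longrightarrow> integrable M (\<lambda>\<omega>. X \<omega> * Y \<omega>)"
proof -
  assume X: "X \<in> V" and Y: "Y \<in> V"
  have sq: "integrable M (\<lambda>\<omega>. (Z \<omega>)\<^sup>2)" if "Z \<in> V" for Z
    by (rule gaussian_rv_integrable_square[OF prob_space_axioms gaussian[OF that]])
  have "integrable M (\<lambda>\<omega>. ((X \<omega> + Y \<omega>)\<^sup>2 - (X \<omega>)\<^sup>2 - (Y \<omega>)\<^sup>2) / 2)"
    using sq[OF add[OF X Y]] sq[OF X] sq[OF Y] by simp
  also have "(\<lambda>\<omega>. ((X \<omega> + Y \<omega>)\<^sup>2 - (X \<omega>)\<^sup>2 - (Y \<omega>)\<^sup>2) / 2) = (\<lambda>\<omega>. X \<omega> * Y \<omega>)"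
    by (auto simp: power2_eq_square algebra_simps)
  finally show ?thesis .
qed

lemma mean_const [simp]: "(\<integral>\<omega>. c \<partial>M) = (c::real)" by (simp add: prob_space)

lemma mean_add: "X \<in> V \<Longrightarrow> Y \<in> V \<Longrightarrow> (\<integral>\<omega>. X \<omega> + Y \<omega> \<partial>M) = (\<integral>\<omega>. X \<omega> \<partial>M) + (\<integral>\<omega>. Y \<omega> \<partial>M)"
  by (rule Bochner_Integration.integral_add) (auto intro: integrable)

lemma mean_diff: "X \<in> V \<Longrightarrow> Y \<in> V \<Longrightarrow> (\<integral>\<omega>. X \<omega> - Y \<omega> \<partial>M) = (\<integral>\<omega>. X \<omega> \<partial>M) - (\<integral>\<omega>. Y \<omega> \<partial>M)"
  by (rule Bochner_Integration.integral_diff) (auto intro: integrable)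

lemma mean_sum: "(\<And>i. i \<in> I \<Longrightarrow> X i \<in> V) \<Longrightarrow> (\<integral>\<omega>. (\<Sum>i\<in>I. X i \<omega>) \<partial>M) = (\<Sum>i\<in>I. \<integral>\<omega>. X i \<omega> \<partial>M)"
  by (rule Bochner_Integration.integral_sum) (auto intro: integrable)

lemma mean_scale: "(\<integral>\<omega>. c * X \<omega> \<partial>M) = c * (\<integral>\<omega>. X \<omega> \<partial>M)" for c :: real
  by simp

lemma cov_integrable: "X \<in> V \<Longrightarrow> Y \<in> V \<Longrightarrow> integrable M (\<lambda>\<omega>. (X \<omega> - a) * (Y \<omega> - b))"
  using integrable_mult[OF diff[OF _ const] diff[OF _ const], of X Y a b] by simp

lemma cov_const [simp]: "cov M X (\<lambda>_. c) = 0" "cov M (\<lambda>_. c) X = 0"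
  by (simp_all add: cov_def prob_space)

lemma cov_add: "X \<in> V \<Longrightarrow> Y \<in> V \<Longrightarrow> Z \<in> V \<Longrightarrow> cov M (\<lambda>\<omega>. X \<omega> + Y \<omega>) Z = cov M X Z + cov M Y Z"
proof -
  assume V: "X \<in> V" "Y \<in> V" "Z \<in> V"
  have "cov M (\<lambda>\<omega>. X \<omega> + Y \<omega>) Z = (\<integral>\<omega>. (X \<omega> - integral\<^sup>L M X) * (Z \<omega> - integral\<^sup>L M Z)
      + (Y \<omega> - integral\<^sup>L M Y) * (Z \<omega> - integral\<^sup>L M Z) \<partial>M)"
    unfolding cov_def mean_add[OF V(1,2)]
    by (intro Bochner_Integration.integral_cong) (simp_all add: algebra_simps)
  also have "\<dots> = cov M X Z + cov M Y Z"
    unfolding cov_def by (intro Bochner_Integration.integral_add cov_integrable V)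
  finally show ?thesis .
qed

lemma cov_scale: "cov M (\<lambda>\<omega>. c * X \<omega>) Z = c * cov M X Z"
proof -
  have "cov M (\<lambda>\<omega>. c * X \<omega>) Z = (\<integral>\<omega>. c * ((X \<omega> - integral\<^sup>L M X) * (Z \<omega> - integral\<^sup>L M Z)) \<partial>M)"
    unfolding cov_def by (intro Bochner_Integration.integral_cong) (auto simp: algebra_simps)
  then show ?thesis by (simp add: cov_def)
qed

lemma cov_diff: "X \<in> V \<Longrightarrow> Y \<in> V \<Longrightarrow> Z \<in> V \<Longrightarrow> cov M (\<lambda>\<omega>. X \<omega> - Y \<omega>) Z = cov M X Z - cov M Y Z"
  using cov_add[OF _ scale[of Y "-1"], of X Z] cov_scale[of "-1" Y Z] by simp

lemma cov_sum: "(\<And>i. i \<in> I \<Longrightarrow> X i \<in> V) \<Longrightarrow> Z \<in> V \<Longrightarrow> cov M (\<lambda>\<omega>. \<Sum>i\<in>I. X i \<omega>) Z = (\<Sum>i\<in>I. cov M (X i) Z)"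
  by (induction I rule: infinite_finite_induct) (auto simp: cov_add sum)

lemma cov_add2: "X \<in> V \<Longrightarrow> Y \<in> V \<Longrightarrow> Z \<in> V \<Longrightarrow> cov M Z (\<lambda>\<omega>. X \<omega> + Y \<omega>) = cov M Z X + cov M Z Y"
  by (simp add: cov_commute[of M Z] cov_add)

lemma cov_diff2: "X \<in> V \<Longrightarrow> Y \<in> V \<Longrightarrow> Z \<in> V \<Longrightarrow> cov M Z (\<lambda>\<omega>. X \<omega> - Y \<omega>) = cov M Z X - cov M Z Y"
  by (simp add: cov_commute[of M Z] cov_diff)

lemma cov_scale2: "cov M Z (\<lambda>\<omega>. c * X \<omega>) = c * cov M Z X"
  by (simp add: cov_commute[of M Z] cov_scale)

lemma cov_sum2: "(\<And>i. i \<in> I \<Longrightarrow> X i \<in> V) \<Longrightarrow> Z \<in> V \<Longrightarrow> cov M Z (\<lambda>\<omega>. \<Sum>i\<in>I. X i \<omega>) = (\<Sum>i\<in>I. cov M Z (X i))"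
  by (simp add: cov_commute[of M Z] cov_sum)

lemma cov_self_nonneg: "0 \<le> cov M X X"
  by (simp add: cov_def)

lemma cov_self_zero:
  assumes X: "X \<in> V" and z: "cov M X X = 0"
  shows "AE \<omega> in M. X \<omega> = integral\<^sup>L M X"
proof -
  have "AE \<omega> in M. (X \<omega> - integral\<^sup>L M X) * (X \<omega> - integral\<^sup>L M X) = 0"
    using z unfolding cov_def by (subst (asm) integral_nonneg_eq_0_iff_AE) (auto intro: cov_integrable X)
  then show ?thesis by eventually_elim simp
qed

lemma cov_zero_left:
  assumes X: "X \<in> V" and Y: "Y \<in> V" and z: "cov M X X = 0"
  shows "cov M X Y = 0"
proof -
  note [measurable] = meas[OF X] meas[OF Y]
  have "cov M X Y = (\<integral>\<omega>. 0 \<partial>M)"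
    unfolding cov_def by (rule integral_cong_AE) (use cov_self_zero[OF X z] in auto)
  then show ?thesis by simp
qed

lemma mgf: "X \<in> V \<Longrightarrow> (\<integral>\<^sup>+\<omega>. ennreal (exp (X \<omega>)) \<partial>M) = ennreal (exp (integral\<^sup>L M X + cov M X X / 2))"
  by (subst gaussian_rv_mgf[OF prob_space_axioms gaussian]) (auto simp: cov_def power2_eq_square)

text \<open>A jointly Gaussian vector weighted by the exponential of a jointly Gaussian variable: the
  exponential moments of the weighted law depend only on its mass \<open>exp (E Z + Var Z / 2)\<close>, the shifted
  means \<open>E X\<^sub>i + Cov (Z, X\<^sub>i)\<close> and the covariances. The Cameron--Martin formula is the case in which
  \<open>Z'\<close> is constant and \<open>X'\<close> is a translate of \<open>X\<close>.\<close>

lemma tilted_laws_eq: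
  fixes X X' :: "'i \<Rightarrow> 'a \<Rightarrow> real"
  assumes I: "finite I" and Z: "Z \<in> V" "Z' \<in> V" and X: "\<And>i. i \<in> I \<Longrightarrow> X i \<in> V" "\<And>i. i \<in> I \<Longrightarrow> X' i \<in> V"
    and mass: "integral\<^sup>L M Z + cov M Z Z / 2 = integral\<^sup>L M Z' + cov M Z' Z' / 2"
    and mean: "\<And>i. i \<in> I \<Longrightarrow> integral\<^sup>L M (X i) + cov M Z (X i) = integral\<^sup>L M (X' i) + cov M Z' (X' i)"
    and covs: "\<And>i j. i \<in> I \<Longrightarrow> j \<in> I \<Longrightarrow> cov M (X i) (X j) = cov M (X' i) (X' j)"
    and H[measurable]: "H \<in> borel_measurable (\<Pi>\<^sub>M i\<in>I. borel)"
  shows "(\<integral>\<^sup>+\<omega>. ennreal (exp (Z \<omega>)) * H (\<lambda>i\<in>I. X i \<omega>) \<partial>M) = (\<integral>\<^sup>+\<omega>. ennreal (exp (Z' \<omega>)) * H (\<lambda>i\<in>I. X' i \<omega>) \<partial>M)"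
proof -
  define D where "D Z X = distr (density M (\<lambda>\<omega>. ennreal (exp (Z \<omega>)))) (\<Pi>\<^sub>M i\<in>I. borel) (\<lambda>\<omega>. \<lambda>i\<in>I. X i \<omega>)" for Z :: "'a \<Rightarrow> real" and X :: "'i \<Rightarrow> 'a \<Rightarrow> real"
  have Dint: "(\<integral>\<^sup>+g. f g \<partial>D Z X) = (\<integral>\<^sup>+\<omega>. ennreal (exp (Z \<omega>)) * f (\<lambda>i\<in>I. X i \<omega>) \<partial>M)"
    if Z: "Z \<in> V" and X: "\<And>i. i \<in> I \<Longrightarrow> X i \<in> V" and [measurable]: "f \<in> borel_measurable (\<Pi>\<^sub>M i\<in>I. borel)" for Z X f
  proof -
    note [measurable] = meas[OF Z]
    have [measurable]: "(\<lambda>\<omega>. \<lambda>i\<in>I. X i \<omega>) \<in> measurable M (\<Pi>\<^sub>M i\<in>I. borel)"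
      by (rule measurable_restrict) (rule meas[OF X])
    show ?thesis unfolding D_def by (subst nn_integral_distr, simp, simp, subst nn_integral_density) auto
  qed
  have lin: "(\<lambda>\<omega>. \<Sum>i\<in>I. p i * X i \<omega>) \<in> V" if "\<And>i. i \<in> I \<Longrightarrow> X i \<in> V" for p X
    by (intro sum scale that)
  have Dmgf: "(\<integral>\<^sup>+g. (\<Prod>i\<in>I. ennreal (exp (p i * g i))) \<partial>D Z X) =
      ennreal (exp (integral\<^sup>L M Z + cov M Z Z / 2 + (\<Sum>i\<in>I. p i * (integral\<^sup>L M (X i) + cov M Z (X i)))
         + (\<Sum>i\<in>I. \<Sum>j\<in>I. p i * p j * cov M (X i) (X j)) / 2))"
    if Z: "Z \<in> V" and X: "\<And>i. i \<in> I \<Longrightarrow> X i \<in> V" for p Z X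
  proof -
    let ?L = "\<lambda>\<omega>. \<Sum>i\<in>I. p i * X i \<omega>"
    have m: "(\<lambda>g. \<Prod>i\<in>I. ennreal (exp (p i * g i))) \<in> borel_measurable (\<Pi>\<^sub>M i\<in>I. borel)"
      by measurable
    have "(\<integral>\<^sup>+g. (\<Prod>i\<in>I. ennreal (exp (p i * g i))) \<partial>D Z X) = (\<integral>\<^sup>+\<omega>. ennreal (exp (Z \<omega> + ?L \<omega>)) \<partial>M)"
    proof -
      have "ennreal (exp (Z \<omega> + ?L \<omega>)) = ennreal (exp (Z \<omega>)) * (\<Prod>i\<in>I. ennreal (exp (p i * (\<lambda>i\<in>I. X i \<omega>) i)))" for \<omega>
        by (simp add: prod_ennreal exp_add exp_sum[OF I] ennreal_mult prod_nonneg cong: prod.cong)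
      then show ?thesis using Dint[OF Z X m] by simp
    qed
    also have "\<dots> = ennreal (exp (integral\<^sup>L M (\<lambda>\<omega>. Z \<omega> + ?L \<omega>) + cov M (\<lambda>\<omega>. Z \<omega> + ?L \<omega>) (\<lambda>\<omega>. Z \<omega> + ?L \<omega>) / 2))"
      by (intro mgf add Z lin X)
    also have "integral\<^sup>L M (\<lambda>\<omega>. Z \<omega> + ?L \<omega>) = integral\<^sup>L M Z + (\<Sum>i\<in>I. p i * integral\<^sup>L M (X i))"
      by (subst mean_add[OF Z lin[OF X]]; simp; subst mean_sum) (auto intro!: scale X)
    also have "cov M (\<lambda>\<omega>. Z \<omega> + ?L \<omega>) (\<lambda>\<omega>. Z \<omega> + ?L \<omega>) = cov M Z Z + 2 * cov M Z ?L + cov M ?L ?L"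
      using Z lin[OF X, of "\<lambda>i. i" p] by (simp add: cov_add cov_add2 add lin X cov_commute[of M ?L Z])
    also have "cov M Z ?L = (\<Sum>i\<in>I. p i * cov M Z (X i))"
      by (subst cov_sum2) (auto intro!: scale X Z simp: cov_scale2)
    also have "cov M ?L ?L = (\<Sum>i\<in>I. \<Sum>j\<in>I. p i * p j * cov M (X i) (X j))"
    proof -
      have "cov M ?L ?L = (\<Sum>i\<in>I. p i * cov M (X i) ?L)"
        by (subst cov_sum) (auto intro!: scale X lin simp: cov_scale)
      also have "\<dots> = (\<Sum>i\<in>I. p i * (\<Sum>j\<in>I. p j * cov M (X i) (X j)))"
        by (intro sum.cong refl arg_cong2[where f="(*)"], subst cov_sum2) (auto intro!: scale X simp: cov_scale2)
      finally show ?thesis by (simp add: sum_distrib_left mult.assoc)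
    qed
    finally show ?thesis
      by (simp add: sum.distrib distrib_left add_divide_distrib add_ac)
  qed
  have mm: "finite_measure (D Z X)" if "Z \<in> V" "\<And>i. i \<in> I \<Longrightarrow> X i \<in> V" for Z X
    using Dint[of Z X "\<lambda>_. 1"] mgf[OF that(1)] that by (intro finite_measureI) simp
  have "D Z X = D Z' X'"
  proof (rule determining_prod[OF determining_mgf I])
    fix p
    show "(\<integral>\<^sup>+g. (\<Prod>i\<in>I. ennreal (exp (p i * g i))) \<partial>D Z X) < \<infinity>"
      using Dmgf[of Z X p] Z X by simp
    show "(\<integral>\<^sup>+g. (\<Prod>i\<in>I. ennreal (exp (p i * g i))) \<partial>D Z X) = (\<integral>\<^sup>+g. (\<Prod>i\<in>I. ennreal (exp (p i * g i))) \<partial>D Z' X')"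
      using Dmgf[of Z X p] Dmgf[of Z' X' p] Z X by (simp add: mass mean covs cong: sum.cong)
    show "finite_measure (D Z X)" "finite_measure (D Z' X')" by (intro mm Z X; assumption)+
  qed (simp_all add: D_def)
  then show ?thesis using Dint[of Z X H] Dint[of Z' X' H] Z X by simp
qed

lemma laws_eq:
  fixes X X' :: "'i \<Rightarrow> 'a \<Rightarrow> real"
  assumes I: "finite I" and X: "\<And>i. i \<in> I \<Longrightarrow> X i \<in> V" "\<And>i. i \<in> I \<Longrightarrow> X' i \<in> V"
    and mean: "\<And>i. i \<in> I \<Longrightarrow> integral\<^sup>L M (X i) = integral\<^sup>L M (X' i)"
    and covs: "\<And>i j. i \<in> I \<Longrightarrow> j \<in> I \<Longrightarrow> cov M (X i) (X j) = cov M (X' i) (X' j)"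
    and H: "H \<in> borel_measurable (\<Pi>\<^sub>M i\<in>I. borel)"
  shows "(\<integral>\<^sup>+\<omega>. H (\<lambda>i\<in>I. X i \<omega>) \<partial>M) = (\<integral>\<^sup>+\<omega>. H (\<lambda>i\<in>I. X' i \<omega>) \<partial>M)"
  using tilted_laws_eq[OF I const[of 0] const[of 0] X _ _ covs H] mean by simp

end

section \<open>Gaussian vectors\<close>

lemma gaussian_rv_add_const:
  assumes M: "prob_space M" and X: "gaussian_rv M X"
  shows "gaussian_rv M (\<lambda>\<omega>. c + X \<omega>)"
proof -
  interpret prob_space M by fact
  have [measurable]: "X \<in> borel_measurable M" using X by (simp add: gaussian_rv_def)
  from X consider m where "distr M borel X = return borel m" | m s where "s > 0" "distr M borel X = density lborel (normal_density m s)"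
    unfolding gaussian_rv_def by auto
  then show ?thesis
  proof cases
    case 1
    have "distr M borel (\<lambda>\<omega>. c + X \<omega>) = distr (distr M borel X) borel (\<lambda>u. c + u)"
      by (subst distr_distr) (auto simp: comp_def)
    also have "\<dots> = return borel (c + m)" unfolding 1 by (rule distr_return) auto
    finally show ?thesis unfolding gaussian_rv_def by auto
  next
    case 2
    have "distr M lborel X = distr M borel X" by (rule distr_cong) auto
    then have "distributed M lborel X (normal_density m s)"
      using 2 by (auto simp: distributed_def)
    then have "distributed M lborel (\<lambda>\<omega>. c + 1 * X \<omega>) (normal_density (c + 1 * m) (\<bar>1\<bar> * s))"
      by (rule normal_density_affine) (use 2 in auto)
    then have "distr M lborel (\<lambda>\<omega>. c + X \<omega>) = density lborel (normal_density (c + m) s)"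
      by (simp add: distributed_distr_eq_density)
    moreover have "distr M lborel (\<lambda>\<omega>. c + X \<omega>) = distr M borel (\<lambda>\<omega>. c + X \<omega>)" by (rule distr_cong) auto
    ultimately show ?thesis unfolding gaussian_rv_def using 2(1) by auto
  qed
qed

text \<open>Constants are included so that centring and the regression residuals stay inside the space.\<close>

definition process_span :: "(real \<Rightarrow> 'a \<Rightarrow> 'b::euclidean_space) \<Rightarrow> ('a \<Rightarrow> real) set" where
  "process_span \<xi> = {\<lambda>\<omega>. c + (\<Sum>t\<in>T. u t \<bullet> \<xi> t \<omega>) | c T u. finite T}"

lemma gaussian_space_process_span:
  assumes M: "prob_space M" and g: "gaussian_process M \<xi>"
  shows "gaussian_space M (process_span \<xi>)"
proof -
  interpret prob_space M by fact
  show ?thesis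
  proof unfold_locales
    show "gaussian_rv M X" if "X \<in> process_span \<xi>" for X
    proof -
      obtain c T u where X: "X = (\<lambda>\<omega>. c + (\<Sum>t\<in>T. u t \<bullet> \<xi> t \<omega>))" "finite T"
        using \<open>X \<in> process_span \<xi>\<close> by (auto simp: process_span_def)
      have "gaussian_rv M (\<lambda>\<omega>. \<Sum>t\<in>T. u t \<bullet> \<xi> t \<omega>)"
        using g X(2) unfolding gaussian_process_def by blast
      then show ?thesis unfolding X by (rule gaussian_rv_add_const[OF M])
    qed
    show "(\<lambda>_. c) \<in> process_span \<xi>" for c
      unfolding process_span_def by (auto intro!: exI[of _ c] exI[of _ "{}"])
    show "(\<lambda>\<omega>. X \<omega> + Y \<omega>) \<in> process_span \<xi>" if XY: "X \<in> process_span \<xi>" "Y \<in> process_span \<xi>" for X Y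
    proof -
      obtain c T u where X: "X = (\<lambda>\<omega>. c + (\<Sum>t\<in>T. u t \<bullet> \<xi> t \<omega>))" and T: "finite T"
        using XY by (auto simp: process_span_def)
      obtain c' T' u' where Y: "Y = (\<lambda>\<omega>. c' + (\<Sum>t\<in>T'. u' t \<bullet> \<xi> t \<omega>))" and T': "finite T'"
        using XY by (auto simp: process_span_def)
      define w where "w t = (if t \<in> T then u t else 0) + (if t \<in> T' then u' t else 0)" for t
      have "(\<Sum>t\<in>T \<union> T'. w t \<bullet> \<xi> t \<omega>) = (\<Sum>t\<in>T. u t \<bullet> \<xi> t \<omega>) + (\<Sum>t\<in>T'. u' t \<bullet> \<xi> t \<omega>)" for \<omega>
      proof -
        have "(\<Sum>t\<in>T \<union> T'. w t \<bullet> \<xi> t \<omega>) = (\<Sum>t\<in>T \<union> T'. if t \<in> T then u t \<bullet> \<xi> t \<omega> else 0) + (\<Sum>t\<in>T \<union> T'. if t \<in> T' then u' t \<bullet> \<xi> t \<omega> else 0)"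
          unfolding sum.distrib[symmetric] by (intro sum.cong) (auto simp: w_def inner_add_left)
        also have "(\<Sum>t\<in>T \<union> T'. if t \<in> T then u t \<bullet> \<xi> t \<omega> else 0) = (\<Sum>t\<in>T. u t \<bullet> \<xi> t \<omega>)"
          using T T' by (intro sum.mono_neutral_cong_right) auto
        also have "(\<Sum>t\<in>T \<union> T'. if t \<in> T' then u' t \<bullet> \<xi> t \<omega> else 0) = (\<Sum>t\<in>T'. u' t \<bullet> \<xi> t \<omega>)"
          using T T' by (intro sum.mono_neutral_cong_right) auto
        finally show ?thesis .
      qed
      then have "(\<lambda>\<omega>. X \<omega> + Y \<omega>) = (\<lambda>\<omega>. (c + c') + (\<Sum>t\<in>T \<union> T'. w t \<bullet> \<xi> t \<omega>))"
        by (auto simp: X Y)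
      then show ?thesis unfolding process_span_def using T T' by blast
    qed
    show "(\<lambda>\<omega>. a * X \<omega>) \<in> process_span \<xi>" if XY: "X \<in> process_span \<xi>" for X a
    proof -
      obtain c T u where X: "X = (\<lambda>\<omega>. c + (\<Sum>t\<in>T. u t \<bullet> \<xi> t \<omega>))" and T: "finite T"
        using XY by (auto simp: process_span_def)
      have "(\<lambda>\<omega>. a * X \<omega>) = (\<lambda>\<omega>. a * c + (\<Sum>t\<in>T. (a *\<^sub>R u t) \<bullet> \<xi> t \<omega>))"
        by (auto simp: X sum_distrib_left distrib_left)
      then show ?thesis unfolding process_span_def using T
        by (auto intro!: exI[of _ "a * c"] exI[of _ T] exI[of _ "\<lambda>t. a *\<^sub>R u t"])
    qed
  qed
qed

lemma inner_in_process_span: "(\<lambda>\<omega>. v \<bullet> \<xi> t \<omega>) \<in> process_span \<xi>"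
  unfolding process_span_def
  by (intro CollectI exI[of _ 0] exI[of _ "{t}"] exI[of _ "\<lambda>_. v"]) simp

lemma borel_measurable_vec_lambda:
  fixes f :: "'i::finite \<Rightarrow> 'x \<Rightarrow> real"
  assumes "\<And>i. f i \<in> borel_measurable N"
  shows "(\<lambda>x. \<chi> i. f i x) \<in> borel_measurable N"
  unfolding borel_measurable_euclidean_space[where f="\<lambda>x. \<chi> i. f i x"]
  using assms by (auto simp: Basis_vec_def inner_axis)

context gaussian_space begin

text \<open>The vector-valued form, by listing all coordinates.\<close>

lemma tilted_vector_laws_eq:
  fixes X X' :: "'j \<Rightarrow> 'a \<Rightarrow> real^'d"
  assumes J: "finite J" and Z: "Z \<in> V" "Z' \<in> V"
    and X: "\<And>j i. j \<in> J \<Longrightarrow> (\<lambda>\<omega>. X j \<omega> $ i) \<in> V" "\<And>j i. j \<in> J \<Longrightarrow> (\<lambda>\<omega>. X' j \<omega> $ i) \<in> V"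
    and mass: "integral\<^sup>L M Z + cov M Z Z / 2 = integral\<^sup>L M Z' + cov M Z' Z' / 2"
    and mean: "\<And>j i. j \<in> J \<Longrightarrow> (\<integral>\<omega>. X j \<omega> $ i \<partial>M) + cov M Z (\<lambda>\<omega>. X j \<omega> $ i) = (\<integral>\<omega>. X' j \<omega> $ i \<partial>M) + cov M Z' (\<lambda>\<omega>. X' j \<omega> $ i)"
    and covs: "\<And>j i k l. j \<in> J \<Longrightarrow> k \<in> J \<Longrightarrow> cov M (\<lambda>\<omega>. X j \<omega> $ i) (\<lambda>\<omega>. X k \<omega> $ l) = cov M (\<lambda>\<omega>. X' j \<omega> $ i) (\<lambda>\<omega>. X' k \<omega> $ l)"
    and H[measurable]: "H \<in> borel_measurable (\<Pi>\<^sub>M j\<in>J. borel)"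
  shows "(\<integral>\<^sup>+\<omega>. ennreal (exp (Z \<omega>)) * H (\<lambda>j\<in>J. X j \<omega>) \<partial>M) = (\<integral>\<^sup>+\<omega>. ennreal (exp (Z' \<omega>)) * H (\<lambda>j\<in>J. X' j \<omega>) \<partial>M)"
proof -
  let ?I = "J \<times> (UNIV :: 'd set)"
  define H' where "H' g = H (\<lambda>j\<in>J. \<chi> i. g (j, i))" for g
  have "(\<lambda>g. \<lambda>j\<in>J. \<chi> i. g (j, i)) \<in> measurable (\<Pi>\<^sub>M p\<in>?I. (borel :: real measure)) (\<Pi>\<^sub>M j\<in>J. borel)"
  proof (rule measurable_restrict)
    fix j assume "j \<in> J"
    then show "(\<lambda>g. \<chi> i. g (j, i)) \<in> borel_measurable (\<Pi>\<^sub>M p\<in>?I. (borel :: real measure))"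
      by (intro borel_measurable_vec_lambda measurable_component_singleton) auto
  qed
  then have H': "H' \<in> borel_measurable (\<Pi>\<^sub>M p\<in>?I. borel)"
    unfolding H'_def by (rule measurable_compose) fact
  have conv: "H' (\<lambda>p\<in>?I. case p of (j, i) \<Rightarrow> X j \<omega> $ i) = H (\<lambda>j\<in>J. X j \<omega>)" for X :: "'j \<Rightarrow> 'a \<Rightarrow> real^'d" and \<omega>
    unfolding H'_def by (intro arg_cong[where f=H]) (auto simp: fun_eq_iff vec_eq_iff)
  have "(\<integral>\<^sup>+\<omega>. ennreal (exp (Z \<omega>)) * H' (\<lambda>p\<in>?I. case p of (j, i) \<Rightarrow> X j \<omega> $ i) \<partial>M) =
        (\<integral>\<^sup>+\<omega>. ennreal (exp (Z' \<omega>)) * H' (\<lambda>p\<in>?I. case p of (j, i) \<Rightarrow> X' j \<omega> $ i) \<partial>M)"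
    by (rule tilted_laws_eq[where X="\<lambda>p \<omega>. case p of (j, i) \<Rightarrow> X j \<omega> $ i" and X'="\<lambda>p \<omega>. case p of (j, i) \<Rightarrow> X' j \<omega> $ i", OF _ Z _ _ mass _ _ H'])
       (use J X mean covs in auto)
  then show ?thesis unfolding conv .
qed

lemma cov_add_const: "X \<in> V \<Longrightarrow> Y \<in> V \<Longrightarrow> cov M (\<lambda>\<omega>. X \<omega> + a) (\<lambda>\<omega>. Y \<omega> + b) = cov M X Y"
  by (simp add: cov_add cov_add2 const add)

text \<open>Both the joint law and the product law have exponential moments that split into a factor for
  \<open>X\<close> and one for \<open>Y\<close>.\<close>

lemma independent_of_uncorrelated:
  fixes Y :: "'i \<Rightarrow> 'a \<Rightarrow> real" and f :: "real \<Rightarrow> ennreal"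
  assumes I: "finite I" and X: "X \<in> V" and Y: "\<And>i. i \<in> I \<Longrightarrow> Y i \<in> V"
    and z: "\<And>i. i \<in> I \<Longrightarrow> cov M X (Y i) = 0"
    and f[measurable]: "f \<in> borel_measurable borel" and g[measurable]: "g \<in> borel_measurable (\<Pi>\<^sub>M i\<in>I. borel)"
  shows "(\<integral>\<^sup>+\<omega>. f (X \<omega>) * g (\<lambda>i\<in>I. Y i \<omega>) \<partial>M) = (\<integral>\<^sup>+\<omega>. f (X \<omega>) \<partial>M) * (\<integral>\<^sup>+\<omega>. g (\<lambda>i\<in>I. Y i \<omega>) \<partial>M)"
proof -
  interpret P: pair_prob_space M M ..
  note [measurable] = meas[OF X]
  have [measurable]: "(\<lambda>\<omega>. \<lambda>i\<in>I. Y i \<omega>) \<in> measurable M (\<Pi>\<^sub>M i\<in>I. borel)"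
    by (rule measurable_restrict) (rule meas[OF Y])
  let ?K = "insert None (Some ` I)"
  let ?E = "(\<Pi>\<^sub>M k\<in>?K. borel) :: ('i option \<Rightarrow> real) measure"
  \<comment> \<open>The index \<open>None\<close> carries \<open>X\<close>, the indices \<open>Some i\<close> carry the \<open>Y i\<close>.\<close>
  define T where "T a b = (\<lambda>k\<in>?K. case k of None \<Rightarrow> a | Some i \<Rightarrow> b i)" for a :: real and b :: "'i \<Rightarrow> real"
  have Tm: "(\<lambda>p. T (fst p) (snd p)) \<in> measurable (borel \<Otimes>\<^sub>M (\<Pi>\<^sub>M i\<in>I. borel)) ?E"
    unfolding T_def by (rule measurable_restrict) auto
  have TI: "(\<Prod>k\<in>?K. \<phi> k (T a b k)) = \<phi> None a * (\<Prod>i\<in>I. \<phi> (Some i) (b i))" for \<phi> :: "'i option \<Rightarrow> real \<Rightarrow> ennreal" and a b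
    using I by (subst prod.insert) (auto simp: T_def prod.reindex)
  define D1 where "D1 = distr M ?E (\<lambda>\<omega>. T (X \<omega>) (\<lambda>i\<in>I. Y i \<omega>))"
  define D2 where "D2 = distr (M \<Otimes>\<^sub>M M) ?E (\<lambda>(\<omega>, \<omega>'). T (X \<omega>) (\<lambda>i\<in>I. Y i \<omega>'))"
  have m1[measurable]: "(\<lambda>\<omega>. T (X \<omega>) (\<lambda>i\<in>I. Y i \<omega>)) \<in> measurable M ?E"
    using measurable_compose[OF measurable_Pair Tm, of X M "\<lambda>\<omega>. \<lambda>i\<in>I. Y i \<omega>"] by simp
  have m2[measurable]: "(\<lambda>(\<omega>, \<omega>'). T (X \<omega>) (\<lambda>i\<in>I. Y i \<omega>')) \<in> measurable (M \<Otimes>\<^sub>M M) ?E"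
    using measurable_compose[OF measurable_Pair Tm, of "\<lambda>p. X (fst p)" "M \<Otimes>\<^sub>M M" "\<lambda>p. \<lambda>i\<in>I. Y i (snd p)"]
    by (simp add: case_prod_beta')
  have int1: "(\<integral>\<^sup>+x. h x \<partial>D1) = (\<integral>\<^sup>+\<omega>. h (T (X \<omega>) (\<lambda>i\<in>I. Y i \<omega>)) \<partial>M)" if [measurable]: "h \<in> borel_measurable ?E" for h
    unfolding D1_def by (subst nn_integral_distr) auto
  have int2: "(\<integral>\<^sup>+x. h x \<partial>D2) = (\<integral>\<^sup>+\<omega>. \<integral>\<^sup>+\<omega>'. h (T (X \<omega>) (\<lambda>i\<in>I. Y i \<omega>')) \<partial>M \<partial>M)" if [measurable]: "h \<in> borel_measurable ?E" for h
    unfolding D2_def by (subst nn_integral_distr, simp, simp, subst nn_integral_fst[symmetric]) auto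
  have lin: "(\<lambda>\<omega>. \<Sum>i\<in>I. p (Some i) * Y i \<omega>) \<in> V" for p :: "'i option \<Rightarrow> real"
    by (intro sum scale Y)
  have mgf12: "(\<integral>\<^sup>+x. (\<Prod>k\<in>?K. ennreal (exp (p k * x k))) \<partial>D) =
      ennreal (exp (integral\<^sup>L M (\<lambda>\<omega>. p None * X \<omega>) + cov M (\<lambda>\<omega>. p None * X \<omega>) (\<lambda>\<omega>. p None * X \<omega>) / 2)) *
      ennreal (exp (integral\<^sup>L M (\<lambda>\<omega>. \<Sum>i\<in>I. p (Some i) * Y i \<omega>) + cov M (\<lambda>\<omega>. \<Sum>i\<in>I. p (Some i) * Y i \<omega>) (\<lambda>\<omega>. \<Sum>i\<in>I. p (Some i) * Y i \<omega>) / 2))"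
    if "D = D1 \<or> D = D2" for D p
  proof -
    let ?A = "\<lambda>\<omega>. p None * X \<omega>" and ?L = "\<lambda>\<omega>. \<Sum>i\<in>I. p (Some i) * Y i \<omega>"
    have hm: "(\<lambda>x. \<Prod>k\<in>?K. ennreal (exp (p k * x k))) \<in> borel_measurable ?E"
      by (intro borel_measurable_prod_ennreal) measurable
    have L: "(\<Prod>i\<in>I. ennreal (exp (p (Some i) * (\<lambda>i\<in>I. Y i \<omega>) i))) = ennreal (exp (?L \<omega>))" for \<omega>
      by (simp add: prod_ennreal exp_sum[OF I] cong: prod.cong)
    note [measurable] = meas[OF lin[of p]]
    note TI = TI[of "\<lambda>k x. ennreal (exp (p k * x))"]
    from that show ?thesis
    proof
      assume D: "D = D1"
      have "(\<integral>\<^sup>+x. (\<Prod>k\<in>?K. ennreal (exp (p k * x k))) \<partial>D) = (\<integral>\<^sup>+\<omega>. ennreal (exp (?A \<omega> + ?L \<omega>)) \<partial>M)"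
        unfolding D int1[OF hm] TI L by (simp add: exp_add ennreal_mult)
      also have "\<dots> = ennreal (exp (integral\<^sup>L M (\<lambda>\<omega>. ?A \<omega> + ?L \<omega>) + cov M (\<lambda>\<omega>. ?A \<omega> + ?L \<omega>) (\<lambda>\<omega>. ?A \<omega> + ?L \<omega>) / 2))"
        by (intro mgf add scale X lin)
      also have "integral\<^sup>L M (\<lambda>\<omega>. ?A \<omega> + ?L \<omega>) = integral\<^sup>L M ?A + integral\<^sup>L M ?L"
        by (intro mean_add scale X lin)
      also have "cov M (\<lambda>\<omega>. ?A \<omega> + ?L \<omega>) (\<lambda>\<omega>. ?A \<omega> + ?L \<omega>) = cov M ?A ?A + cov M ?L ?L"
      proof -
        have "cov M ?A ?L = 0"
          by (subst cov_sum2) (auto intro!: scale X Y simp: cov_scale cov_scale2 z)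
        then show ?thesis
          using scale[OF X, of "p None"] lin[of p] by (simp add: cov_add cov_add2 add cov_commute[of M ?L ?A])
      qed
      finally show ?thesis by (simp add: exp_add add_divide_distrib ennreal_mult mult_ac)
    next
      assume D: "D = D2"
      have "(\<integral>\<^sup>+x. (\<Prod>k\<in>?K. ennreal (exp (p k * x k))) \<partial>D) = (\<integral>\<^sup>+\<omega>. ennreal (exp (?A \<omega>)) * (\<integral>\<^sup>+\<omega>'. ennreal (exp (?L \<omega>')) \<partial>M) \<partial>M)"
        unfolding D int2[OF hm] TI L by (intro nn_integral_cong nn_integral_cmult) measurable
      also have "\<dots> = (\<integral>\<^sup>+\<omega>. ennreal (exp (?A \<omega>)) \<partial>M) * (\<integral>\<^sup>+\<omega>'. ennreal (exp (?L \<omega>')) \<partial>M)"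
        by (rule nn_integral_multc) measurable
      finally show ?thesis unfolding mgf[OF scale[OF X, of "p None"]] mgf[OF lin[of p]] .
    qed
  qed
  have "D1 = D2"
  proof (rule determining_prod[OF determining_mgf, of ?K])
    show "finite_measure D1" unfolding D1_def by (intro prob_space.finite_measure prob_space_distr m1)
    show "finite_measure D2" unfolding D2_def by (intro prob_space.finite_measure P.prob_space_distr m2)
    fix p
    show "(\<integral>\<^sup>+x. (\<Prod>k\<in>?K. ennreal (exp (p k * x k))) \<partial>D1) < \<infinity>"
      using mgf12[of D1 p] by (simp add: ennreal_mult_less_top)
    show "(\<integral>\<^sup>+x. (\<Prod>k\<in>?K. ennreal (exp (p k * x k))) \<partial>D1) = (\<integral>\<^sup>+x. (\<Prod>k\<in>?K. ennreal (exp (p k * x k))) \<partial>D2)"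
      using mgf12[of D1 p] mgf12[of D2 p] by simp
  qed (use I in \<open>simp_all add: D1_def D2_def\<close>)
  define h where "h x = f (x None) * g (\<lambda>i\<in>I. x (Some i))" for x
  have hm: "h \<in> borel_measurable ?E"
  proof -
    have "(\<lambda>x. \<lambda>i\<in>I. x (Some i)) \<in> measurable ?E (\<Pi>\<^sub>M i\<in>I. borel)"
      by (intro measurable_restrict measurable_component_singleton) auto
    from measurable_compose[OF this g] show ?thesis unfolding h_def by measurable
  qed
  have hT: "h (T a (\<lambda>i\<in>I. b i)) = f a * g (\<lambda>i\<in>I. b i)" for a b
    unfolding h_def T_def by (auto intro!: arg_cong2[where f="(*)"] arg_cong[where f=g])
  have "(\<integral>\<^sup>+\<omega>. f (X \<omega>) * g (\<lambda>i\<in>I. Y i \<omega>) \<partial>M) = (\<integral>\<^sup>+\<omega>. \<integral>\<^sup>+\<omega>'. f (X \<omega>) * g (\<lambda>i\<in>I. Y i \<omega>') \<partial>M \<partial>M)"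
    using int1[OF hm] int2[OF hm] \<open>D1 = D2\<close> by (simp only: hT)
  also have "\<dots> = (\<integral>\<^sup>+\<omega>. f (X \<omega>) * (\<integral>\<^sup>+\<omega>'. g (\<lambda>i\<in>I. Y i \<omega>') \<partial>M) \<partial>M)"
    by (intro nn_integral_cong nn_integral_cmult) measurable
  also have "\<dots> = (\<integral>\<^sup>+\<omega>. f (X \<omega>) \<partial>M) * (\<integral>\<^sup>+\<omega>. g (\<lambda>i\<in>I. Y i \<omega>) \<partial>M)"
    by (rule nn_integral_multc) measurable
  finally show ?thesis .
qed

text \<open>The normal equations \<open>A l = k\<close> for the covariance matrix \<open>A\<close> of \<open>Y\<close> are solvable even if \<open>A\<close> is
  singular: the component \<open>z\<close> of \<open>k\<close> orthogonal to the range of \<open>A\<close> gives a combination of the \<open>Y i\<close> of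
  variance \<open>z \<bullet> A z = 0\<close>, which is uncorrelated with \<open>X\<close>, and so \<open>z \<bullet> z = z \<bullet> k = 0\<close>.\<close>

lemma regression:
  fixes Y :: "'d::finite \<Rightarrow> 'a \<Rightarrow> real"
  assumes X: "X \<in> V" and Y: "\<And>i. Y i \<in> V"
  shows "\<exists>l::real^'d. \<forall>i. cov M (\<lambda>\<omega>. X \<omega> - (\<Sum>j\<in>UNIV. l $ j * Y j \<omega>)) (Y i) = 0"
proof -
  define A where "A = (\<chi> i j. cov M (Y i) (Y j))"
  define k where "k = (\<chi> i. cov M X (Y i))"
  have lin: "(\<lambda>\<omega>. \<Sum>j\<in>UNIV. l $ j * Y j \<omega>) \<in> V" for l by (intro sum scale Y)
  have cl: "cov M (\<lambda>\<omega>. \<Sum>j\<in>UNIV. l $ j * Y j \<omega>) Z = (\<Sum>j\<in>UNIV. l $ j * cov M (Y j) Z)" if "Z \<in> V" for l and Z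
    by (subst cov_sum) (auto intro!: scale Y that simp: cov_scale)
  have AY: "(A *v l) $ i = cov M (\<lambda>\<omega>. \<Sum>j\<in>UNIV. l $ j * Y j \<omega>) (Y i)" for l i
    unfolding cl[OF Y] by (simp add: A_def matrix_vector_mult_def mult.commute cov_commute)
  have "linear ((*v) A)" by simp
  then have sub: "subspace (range ((*v) A))" by (rule linear_subspace_image[OF _ subspace_UNIV])
  obtain y z where yz: "y \<in> span (range ((*v) A))" "\<And>w. w \<in> span (range ((*v) A)) \<Longrightarrow> orthogonal z w" "k = y + z"
    using orthogonal_subspace_decomp_exists[of "range ((*v) A)" k] by metis
  have span: "span (range ((*v) A)) = range ((*v) A)" using sub by (simp add: span_eq_iff)
  obtain l where l: "y = A *v l" using yz(1) unfolding span by auto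
  let ?Z = "\<lambda>\<omega>. \<Sum>j\<in>UNIV. z $ j * Y j \<omega>"
  have "0 = z \<bullet> (A *v z)" using yz(2)[unfolded span, of "A *v z"] by (simp add: orthogonal_def)
  also have "\<dots> = cov M ?Z ?Z"
    unfolding inner_vec_def AY cl[OF lin] by (simp add: cov_commute)
  finally have "cov M ?Z X = 0" using cov_zero_left[OF lin X] by simp
  then have "z \<bullet> k = 0" unfolding cl[OF X] by (simp add: inner_vec_def k_def cov_commute)
  moreover have "z \<bullet> y = 0" using yz(2)[OF yz(1)] by (simp add: orthogonal_def)
  ultimately have "z = 0" using yz(3) by (simp add: inner_add_right)
  then have "k = A *v l" using yz(3) l by simp
  then have "cov M X (Y i) = cov M (\<lambda>\<omega>. \<Sum>j\<in>UNIV. l $ j * Y j \<omega>) (Y i)" for i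
    using AY[of l i] by (simp add: k_def vec_eq_iff)
  then show ?thesis by (intro exI[of _ l]) (simp add: cov_diff X lin Y)
qed

end

section \<open>Deconvolution and translation invariance on the line\<close>

text \<open>The convolution with a normal law of mean \<open>m\<close> and deviation \<open>s\<close> has the density
  \<open>y \<mapsto> \<integral> normal_density m s (y - u) \<mu>(du)\<close>. Expanding the square, this is an explicit positive factor
  times the Laplace transform, at \<open>(y - m) / s\<^sup>2\<close>, of the measure with density \<open>exp (- u\<^sup>2 / (2 s\<^sup>2))\<close>
  with respect to \<open>\<mu>\<close>.\<close>

lemma gaussian_deconvolution_normal:
  fixes \<mu> \<nu> :: "real measure" and m s :: real
  assumes s: "s > 0"
    and sf: "sigma_finite_measure \<mu>" "sigma_finite_measure \<nu>"
    and sets1[measurable_cong]: "sets \<mu> = sets borel" and sets2[measurable_cong]: "sets \<nu> = sets borel"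
    and eq: "\<And>f :: real \<Rightarrow> ennreal. f \<in> borel_measurable borel \<Longrightarrow>
       (\<integral>\<^sup>+u. \<integral>\<^sup>+w. f (u + w) * ennreal (normal_density m s w) \<partial>lborel \<partial>\<mu>) =
       (\<integral>\<^sup>+u. \<integral>\<^sup>+w. f (u + w) * ennreal (normal_density m s w) \<partial>lborel \<partial>\<nu>)"
    and fin: "\<And>R. (\<integral>\<^sup>+u. \<integral>\<^sup>+w. indicator (cball 0 R) (u + w) * ennreal (normal_density m s w) \<partial>lborel \<partial>\<mu>) < \<infinity>"
  shows "\<mu> = \<nu>"
proof -
  define h where "h L y = (\<integral>\<^sup>+u. ennreal (normal_density m s (y - u)) \<partial>L)" for L :: "real measure" and y
  have hm: "h L \<in> borel_measurable borel"
    if "sigma_finite_measure L" and [measurable_cong]: "sets L = sets borel" for L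
  proof -
    interpret sigma_finite_measure L by fact
    show ?thesis unfolding h_def by measurable
  qed
  have conv: "(\<integral>\<^sup>+u. \<integral>\<^sup>+w. f (u + w) * ennreal (normal_density m s w) \<partial>lborel \<partial>L) = (\<integral>\<^sup>+y. f y * h L y \<partial>lborel)"
    if "sigma_finite_measure L" and [measurable_cong]: "sets L = sets borel" and [measurable]: "f \<in> borel_measurable borel" for L f
  proof -
    interpret L: sigma_finite_measure L by fact
    interpret P: pair_sigma_finite L lborel ..
    have "(\<integral>\<^sup>+w. f (u + w) * ennreal (normal_density m s w) \<partial>lborel) = (\<integral>\<^sup>+y. f y * ennreal (normal_density m s (y - u)) \<partial>lborel)" for u
      by (subst nn_integral_real_affine[where t="-u" and c=1]) auto
    then have "(\<integral>\<^sup>+u. \<integral>\<^sup>+w. f (u + w) * ennreal (normal_density m s w) \<partial>lborel \<partial>L) =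
        (\<integral>\<^sup>+u. \<integral>\<^sup>+y. f y * ennreal (normal_density m s (y - u)) \<partial>lborel \<partial>L)"
      by simp
    also have "\<dots> = (\<integral>\<^sup>+y. \<integral>\<^sup>+u. f y * ennreal (normal_density m s (y - u)) \<partial>L \<partial>lborel)"
      by (rule P.Fubini'[symmetric]) measurable
    also have "\<dots> = (\<integral>\<^sup>+y. f y * h L y \<partial>lborel)"
      unfolding h_def by (intro nn_integral_cong, subst nn_integral_cmult) auto
    finally show ?thesis .
  qed
  note h1[measurable] = hm[OF sf(1) sets1] and h2[measurable] = hm[OF sf(2) sets2]
  have ae_eq: "AE y in lborel. h \<mu> y = h \<nu> y"
  proof (rule sigma_finite_measure.density_unique2[OF sigma_finite_lborel])
    fix A assume "A \<in> sets (lborel :: real measure)"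
    then have [measurable]: "A \<in> sets borel" by simp
    have "(indicator A :: real \<Rightarrow> ennreal) \<in> borel_measurable borel" by simp
    from eq[OF this] conv[OF sf(1) sets1 this] conv[OF sf(2) sets2 this]
    show "(\<integral>\<^sup>+x\<in>A. h \<mu> x \<partial>lborel) = (\<integral>\<^sup>+x\<in>A. h \<nu> x \<partial>lborel)" by (simp add: mult.commute)
  qed auto
  have ae_fin: "AE y in lborel. h \<mu> y < \<infinity>"
  proof -
    have "AE y in lborel. \<forall>n::nat. indicator (cball 0 (real n)) y * h \<mu> y \<noteq> \<infinity>"
      unfolding AE_all_countable
    proof
      fix n :: nat
      have "(indicator (cball 0 (real n)) :: real \<Rightarrow> ennreal) \<in> borel_measurable borel"
        by (rule borel_measurable_indicator) (intro borel_closed closed_cball)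
      from conv[OF sf(1) sets1 this] fin[of "real n"]
      show "AE y in lborel. indicator (cball 0 (real n)) y * h \<mu> y \<noteq> \<infinity>"
        by (intro nn_integral_PInf_AE borel_measurable_times_ennreal)
           (auto intro!: borel_measurable_indicator borel_closed closed_cball simp del: cball_eq_atLeastAtMost)
    qed
    then show ?thesis
    proof eventually_elim
      case (elim y)
      obtain n :: nat where "\<bar>y\<bar> \<le> real n" using real_arch_simple by blast
      with elim[rule_format, of n] show ?case by (auto simp: indicator_def less_top)
    qed
  qed
  \<comment> \<open>Up to the factor \<open>c\<close>, the density \<open>h L\<close> is the Laplace transform of \<open>N L\<close>.\<close>
  define N where "N L = density L (\<lambda>u. ennreal (exp (- u\<^sup>2 / (2 * s\<^sup>2))))" for L :: "real measure"
  have sN[measurable_cong]: "sets (N L) = sets L" for L by (simp add: N_def)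
  define c where "c y = exp (- (y - m)\<^sup>2 / (2 * s\<^sup>2)) / sqrt (2 * pi * s\<^sup>2)" for y
  have cpos: "c y > 0" for y using s by (simp add: c_def)
  have hN: "h L (m + s\<^sup>2 * y) = ennreal (c (m + s\<^sup>2 * y)) * (\<integral>\<^sup>+u. ennreal (exp (y * u)) \<partial>N L)"
    if [measurable_cong]: "sets L = sets borel" for L y
  proof -
    have "normal_density m s (m + s\<^sup>2 * y - u) = c (m + s\<^sup>2 * y) * (exp (- u\<^sup>2 / (2 * s\<^sup>2)) * exp (y * u))" for u
    proof -
      have "- ((m + s\<^sup>2 * y - u) - m)\<^sup>2 / (2 * s\<^sup>2) = - (m + s\<^sup>2 * y - m)\<^sup>2 / (2 * s\<^sup>2) + (- u\<^sup>2 / (2 * s\<^sup>2) + y * u)"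
        using s by (simp add: field_simps power2_eq_square)
      then have "exp (- ((m + s\<^sup>2 * y - u) - m)\<^sup>2 / (2 * s\<^sup>2)) =
          exp (- (m + s\<^sup>2 * y - m)\<^sup>2 / (2 * s\<^sup>2)) * (exp (- u\<^sup>2 / (2 * s\<^sup>2)) * exp (y * u))"
        by (simp only: exp_add)
      then show ?thesis unfolding normal_density_def c_def by (simp only: times_divide_eq_left mult_1)
    qed
    then have "h L (m + s\<^sup>2 * y) = (\<integral>\<^sup>+u. ennreal (c (m + s\<^sup>2 * y)) * (ennreal (exp (- u\<^sup>2 / (2 * s\<^sup>2))) * ennreal (exp (y * u))) \<partial>L)"
      unfolding h_def using cpos by (intro nn_integral_cong) (simp add: ennreal_mult less_imp_le)
    also have "\<dots> = ennreal (c (m + s\<^sup>2 * y)) * (\<integral>\<^sup>+u. ennreal (exp (- u\<^sup>2 / (2 * s\<^sup>2))) * ennreal (exp (y * u)) \<partial>L)"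
      by (rule nn_integral_cmult) measurable
    also have "(\<integral>\<^sup>+u. ennreal (exp (- u\<^sup>2 / (2 * s\<^sup>2))) * ennreal (exp (y * u)) \<partial>L) = (\<integral>\<^sup>+u. ennreal (exp (y * u)) \<partial>N L)"
      unfolding N_def by (subst nn_integral_density) auto
    finally show ?thesis .
  qed
  have "AE y in lborel. h \<mu> y = h \<nu> y \<and> h \<mu> y < \<infinity>" using ae_eq ae_fin by eventually_elim simp
  then have "AE y in lborel. h \<mu> (m + s\<^sup>2 * y) = h \<nu> (m + s\<^sup>2 * y) \<and> h \<mu> (m + s\<^sup>2 * y) < \<infinity>"
    using s by (intro AE_borel_affine) auto
  then have ae: "AE y in lborel. (\<integral>\<^sup>+u. ennreal (exp (y * u)) \<partial>N \<mu>) = (\<integral>\<^sup>+u. ennreal (exp (y * u)) \<partial>N \<nu>) \<and>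
      (\<integral>\<^sup>+u. ennreal (exp (y * u)) \<partial>N \<mu>) < \<infinity>"
  proof eventually_elim
    case (elim y)
    then show ?case using cpos[of "m + s\<^sup>2 * y"] unfolding hN[OF sets1] hN[OF sets2]
      by (auto simp: ennreal_mult_cancel_left ennreal_mult_less_top)
  qed
  have "N \<mu> = N \<nu>"
  proof (rule measure_eqI_mgf)
    show "AE y in lborel. 0 < y \<longrightarrow> (\<integral>\<^sup>+ u. ennreal (exp (y * u)) \<partial>N \<mu>) = (\<integral>\<^sup>+ u. ennreal (exp (y * u)) \<partial>N \<nu>)"
      "AE y in lborel. (\<integral>\<^sup>+ u. ennreal (exp (y * u)) \<partial>N \<mu>) < \<infinity>"
      "AE y in lborel. (\<integral>\<^sup>+ u. ennreal (exp (y * u)) \<partial>N \<nu>) < \<infinity>"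
      by (rule eventually_mono[OF ae], elim conjE, simp)+
  qed (simp_all add: sN sets1 sets2)
  moreover have "density (N L) (\<lambda>u. ennreal (exp (u\<^sup>2 / (2 * s\<^sup>2)))) = L" if [measurable_cong]: "sets L = sets borel" for L
  proof -
    have "density (N L) (\<lambda>u. ennreal (exp (u\<^sup>2 / (2 * s\<^sup>2)))) = density L (\<lambda>u. ennreal (exp (- u\<^sup>2 / (2 * s\<^sup>2))) * ennreal (exp (u\<^sup>2 / (2 * s\<^sup>2))))"
      unfolding N_def by (rule density_density_eq) measurable
    also have "\<dots> = density L (\<lambda>_. 1)"
      by (intro density_cong) (auto simp flip: ennreal_mult exp_add)
    finally show ?thesis by (simp add: density_1)
  qed
  ultimately show ?thesis using sets1 sets2 by metis
qed

lemma gaussian_deconvolution: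
  fixes \<mu> \<nu> :: "real measure" and X :: "'a \<Rightarrow> real"
  assumes M: "prob_space M" and X: "gaussian_rv M X"
    and sf: "sigma_finite_measure \<mu>" "sigma_finite_measure \<nu>"
    and sets1[measurable_cong]: "sets \<mu> = sets borel" and sets2[measurable_cong]: "sets \<nu> = sets borel"
    and eq: "\<And>f :: real \<Rightarrow> ennreal. f \<in> borel_measurable borel \<Longrightarrow>
       (\<integral>\<^sup>+u. \<integral>\<^sup>+\<omega>. f (u + X \<omega>) \<partial>M \<partial>\<mu>) = (\<integral>\<^sup>+u. \<integral>\<^sup>+\<omega>. f (u + X \<omega>) \<partial>M \<partial>\<nu>)"
    and fin: "\<And>R. (\<integral>\<^sup>+u. \<integral>\<^sup>+\<omega>. indicator (cball 0 R) (u + X \<omega>) \<partial>M \<partial>\<mu>) < \<infinity>"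
  shows "\<mu> = \<nu>"
proof -
  interpret prob_space M by fact
  have [measurable]: "X \<in> borel_measurable M" using X by (simp add: gaussian_rv_def)
  have law: "(\<integral>\<^sup>+\<omega>. f (u + X \<omega>) \<partial>M) = (\<integral>\<^sup>+w. f (u + w) \<partial>distr M borel X)" if [measurable]: "f \<in> borel_measurable borel" for f :: "real \<Rightarrow> ennreal" and u
    by (subst nn_integral_distr) auto
  from X consider m where "distr M borel X = return borel m" | m s where "s > 0" "distr M borel X = density lborel (normal_density m s)"
    unfolding gaussian_rv_def by auto
  then show ?thesis
  proof cases
    case 1
    show ?thesis
    proof (rule measure_eqI)
      fix A assume "A \<in> sets \<mu>"
      then have [measurable]: "A \<in> sets borel" using sets1 by simp
      define f where "f w = (indicator A (w - m) :: ennreal)" for w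
      have [measurable]: "f \<in> borel_measurable borel" unfolding f_def by measurable
      have "(\<integral>\<^sup>+\<omega>. f (u + X \<omega>) \<partial>M) = indicator A u" for u
        unfolding law[OF \<open>f \<in> _\<close>] 1 by (subst nn_integral_return) (auto simp: f_def)
      with eq[of f] show "emeasure \<mu> A = emeasure \<nu> A" by (simp add: sets1 sets2)
    qed (simp add: sets1 sets2)
  next
    case 2
    have law2: "(\<integral>\<^sup>+\<omega>. f (u + X \<omega>) \<partial>M) = (\<integral>\<^sup>+w. f (u + w) * ennreal (normal_density m s w) \<partial>lborel)"
      if [measurable]: "f \<in> borel_measurable borel" for f :: "real \<Rightarrow> ennreal" and u
      unfolding law[OF that] 2(2) by (subst nn_integral_density) (auto simp: mult.commute)
    show ?thesis
    proof (rule gaussian_deconvolution_normal[OF 2(1) sf sets1 sets2])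
      show "(\<integral>\<^sup>+u. \<integral>\<^sup>+w. indicator (cball 0 R) (u + w) * ennreal (normal_density m s w) \<partial>lborel \<partial>\<mu>) < \<infinity>" for R
        using fin[of R] law2[OF borel_measurable_indicator[OF borel_closed[OF closed_cball]]] by simp
    qed (use eq law2 in simp)
  qed
qed

text \<open>Invariance under the fractions \<open>b / n\<close> forces all cells of a grid of mesh \<open>\<bar>b\<bar> / n\<close> to have the
  same mass, proportional to \<open>1 / n\<close>. Sandwiching an interval between unions of cells gives a mass
  proportional to its length.\<close>

lemma translation_invariant_measure:
  fixes \<nu> :: "real measure"
  assumes s: "sets \<nu> = sets borel" and b: "b \<noteq> 0" and nz: "emeasure \<nu> UNIV \<noteq> 0"
    and fin: "\<And>R. emeasure \<nu> (cball 0 R) < \<infinity>"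
    and inv: "\<And>(n::nat) A. n \<ge> 1 \<Longrightarrow> A \<in> sets borel \<Longrightarrow> emeasure \<nu> ((\<lambda>u. u + b / real n) -` A) = emeasure \<nu> A"
  shows "\<exists>c>0. \<nu> = density lborel (\<lambda>_. ennreal c)"
proof -
  define d where "d = \<bar>b\<bar>"
  have d: "d > 0" using b by (simp add: d_def)
  have sp: "space \<nu> = UNIV" using sets_eq_imp_space_eq[OF s] by simp
  have fin': "emeasure \<nu> A \<noteq> \<infinity>" if "A \<subseteq> cball 0 R" for A R
    using emeasure_mono[OF that, of \<nu>] fin[of R] s by (auto simp: top_unique)
  have inv': "emeasure \<nu> {x + d / real n..<y + d / real n} = emeasure \<nu> {x..<y}" if "n \<ge> 1" for n x y
  proof (cases "b \<ge> 0")
    case True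
    have "(\<lambda>u. u + b / real n) -` {x + d / real n..<y + d / real n} = {x..<y}"
      using True by (auto simp: d_def)
    with inv[OF that, of "{x + d / real n..<y + d / real n}"] show ?thesis by simp
  next
    case False
    have "(\<lambda>u. u + b / real n) -` {x..<y} = {x + d / real n..<y + d / real n}"
      using False by (auto simp: d_def field_simps)
    with inv[OF that, of "{x..<y}"] show ?thesis by simp
  qed
  define m where "m A = measure \<nu> A" for A
  have em: "emeasure \<nu> {x..<y} = ennreal (m {x..<y})" for x y
  proof -
    have "{x..<y} \<subseteq> cball 0 (max \<bar>x\<bar> \<bar>y\<bar>)" by (auto simp: dist_real_def)
    then show ?thesis using fin' unfolding m_def by (intro emeasure_eq_ennreal_measure) auto
  qed
  have madd: "m {x..<z} = m {x..<y} + m {y..<z}" if "x \<le> y" "y \<le> z" for x y z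
  proof -
    have "ennreal (m {x..<z}) = emeasure \<nu> ({x..<y} \<union> {y..<z})" using that by (simp add: em[symmetric] ivl_disj_un)
    also have "\<dots> = emeasure \<nu> {x..<y} + emeasure \<nu> {y..<z}"
      by (rule plus_emeasure[symmetric]) (auto simp: s)
    also have "\<dots> = ennreal (m {x..<y} + m {y..<z})" by (simp add: em m_def)
    finally show ?thesis by (subst (asm) ennreal_inj) (auto simp: m_def)
  qed
  have minv: "m {x + d / real n..<y + d / real n} = m {x..<y}" if "n \<ge> 1" for n x y
    using inv'[OF that, of x y] by (simp add: m_def measure_def)
  define c where "c = m {0..<d} / d"
  have step: "m {x..<x + real k * (d / real n)} = real k * m {0..<d / real n}" if n: "n \<ge> 1" and x: "x = of_int i * (d / real n)" for n k i x
  proof -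
    have dn: "d / real n > 0" using d n by simp
    have one: "m {of_int i * (d / real n)..<of_int i * (d / real n) + d / real n} = m {0..<d / real n}" for i
    proof (induction i rule: int_induct[where k=0])
      case (step1 i)
      have e: "of_int (i + 1) * (d / real n) = of_int i * (d / real n) + d / real n"
        by (simp add: distrib_right add_divide_distrib)
      show ?case using minv[OF n, of "of_int i * (d / real n)" "of_int i * (d / real n) + d / real n"] step1
        unfolding e by simp
    next
      case (step2 i)
      have e: "of_int i * (d / real n) = of_int (i - 1) * (d / real n) + d / real n"
        by (simp add: left_diff_distrib diff_divide_distrib)
      show ?case using minv[OF n, of "of_int (i - 1) * (d / real n)" "of_int (i - 1) * (d / real n) + d / real n"] step2(2)
        unfolding e by simp
    qed simp
    show ?thesis
    proof (induction k)
      case 0 show ?case by (simp add: m_def)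
    next
      case (Suc k)
      have "x + real k * (d / real n) = of_int (i + int k) * (d / real n)" by (simp add: x algebra_simps)
      then have "m {x + real k * (d / real n)..<x + real k * (d / real n) + d / real n} = m {0..<d / real n}"
        using one[of "i + int k"] by simp
      moreover have "x + real (Suc k) * (d / real n) = x + real k * (d / real n) + d / real n"
        by (simp add: distrib_right add_divide_distrib)
      moreover have "0 \<le> real k * (d / real n)" using dn by (intro mult_nonneg_nonneg) auto
      ultimately show ?case using madd[of x "x + real k * (d / real n)" "x + real (Suc k) * (d / real n)"] Suc dn
        by (simp add: distrib_right add.assoc)
    qed
  qed
  have cell: "m {0..<d / real n} = c * (d / real n)" if "n \<ge> 1" for n
    using step[OF that, of 0 0 n] that d by (simp add: c_def field_simps)
  have grid: "m {of_int i * (d / real n)..<of_int j * (d / real n)} = c * (of_int j - of_int i) * (d / real n)"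
    if n: "n \<ge> 1" and ij: "i \<le> j" for n i j
  proof -
    have "of_int j * (d / real n) = of_int i * (d / real n) + real (nat (j - i)) * (d / real n)"
      using ij by (simp add: algebra_simps)
    then show ?thesis using step[OF n refl, of i "nat (j - i)"] cell[OF n] ij by simp
  qed
  have c0: "c \<ge> 0" using d by (simp add: c_def m_def)
  have box: "measure \<nu> {x<..<y} = c * (y - x)" if xy: "x < y" for x y
  proof -
    have "{x - d..y + d} \<subseteq> cball 0 (\<bar>x\<bar> + \<bar>y\<bar> + d)" by (auto simp: dist_real_def)
    then have fm: "A \<in> fmeasurable \<nu>" if "A \<in> sets borel" "A \<subseteq> {x - d..y + d}" for A
      using fin'[of A "\<bar>x\<bar> + \<bar>y\<bar> + d"] that s by (intro fmeasurableI) (auto simp: less_top[symmetric])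
    have upper: "measure \<nu> {x<..<y} \<le> c * (y - x) + 2 * c * d / real n" if n: "n \<ge> 1" for n
    proof -
      define \<delta> where "\<delta> = d / real n"
      have \<delta>: "\<delta> > 0" "\<delta> \<le> d" using n d by (auto simp: \<delta>_def field_simps)
      define i where "i = \<lfloor>x / \<delta>\<rfloor>" define j where "j = \<lfloor>y / \<delta>\<rfloor> + 1"
      have i: "of_int i * \<delta> \<le> x" "x \<le> of_int i * \<delta> + \<delta>" and j: "y \<le> of_int j * \<delta>" "of_int j * \<delta> \<le> y + \<delta>"
      proof -
        have "of_int i \<le> x / \<delta>" "x / \<delta> \<le> of_int i + 1" "y / \<delta> \<le> of_int j" "of_int j \<le> y / \<delta> + 1"
          unfolding i_def j_def by linarith+
        then show "of_int i * \<delta> \<le> x" "x \<le> of_int i * \<delta> + \<delta>" "y \<le> of_int j * \<delta>" "of_int j * \<delta> \<le> y + \<delta>"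
          using \<delta> by (simp_all add: field_simps)
      qed
      have "of_int i * \<delta> \<le> of_int j * \<delta>" using i j xy by linarith
      then have ij: "i \<le> j" using \<delta> by simp
      have "measure \<nu> {x<..<y} \<le> m {of_int i * \<delta>..<of_int j * \<delta>}"
        unfolding m_def using i j \<delta> by (intro measure_mono_fmeasurable fm) (auto simp: s)
      also have "\<dots> = c * (of_int j * \<delta> - of_int i * \<delta>)" using grid[OF n ij] by (simp add: \<delta>_def algebra_simps)
      also have "\<dots> \<le> c * (y - x + 2 * \<delta>)" using i j c0 by (intro mult_left_mono) auto
      finally show ?thesis by (simp add: \<delta>_def algebra_simps)
    qed
    have lower: "c * (y - x) - 2 * c * d / real n \<le> measure \<nu> {x<..<y}" if n: "n \<ge> 1" for n
    proof -
      define \<delta> where "\<delta> = d / real n"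
      have \<delta>: "\<delta> > 0" "\<delta> \<le> d" using n d by (auto simp: \<delta>_def field_simps)
      define i where "i = \<lfloor>x / \<delta>\<rfloor> + 1" define j where "j = \<lfloor>y / \<delta>\<rfloor>"
      have i: "x < of_int i * \<delta>" "of_int i * \<delta> \<le> x + \<delta>" and j: "of_int j * \<delta> \<le> y" "y \<le> of_int j * \<delta> + \<delta>"
      proof -
        have "x / \<delta> < of_int i" "of_int i \<le> x / \<delta> + 1" "of_int j \<le> y / \<delta>" "y / \<delta> \<le> of_int j + 1"
          unfolding i_def j_def by linarith+
        then show "x < of_int i * \<delta>" "of_int i * \<delta> \<le> x + \<delta>" "of_int j * \<delta> \<le> y" "y \<le> of_int j * \<delta> + \<delta>"
          using \<delta> by (simp_all add: field_simps)
      qed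
      show ?thesis
      proof (cases "i \<le> j")
        case True
        have "c * (y - x - 2 * \<delta>) \<le> c * (of_int j * \<delta> - of_int i * \<delta>)" using i j c0 by (intro mult_left_mono) auto
        also have "\<dots> = m {of_int i * \<delta>..<of_int j * \<delta>}" using grid[OF n True] by (simp add: \<delta>_def algebra_simps)
        also have "\<dots> \<le> measure \<nu> {x<..<y}"
          unfolding m_def using i j \<delta> d by (intro measure_mono_fmeasurable fm) (auto simp: s)
        finally show ?thesis by (simp add: \<delta>_def algebra_simps)
      next
        case False
        then have "of_int j \<le> (of_int i :: real) - 1" by linarith
        then have "of_int j * \<delta> \<le> (of_int i - 1) * \<delta>" using \<delta> by (intro mult_right_mono) auto
        then have "y - x - 2 * \<delta> \<le> 0" using i j by (simp add: algebra_simps)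
        then have "c * (y - x - 2 * \<delta>) \<le> 0" using c0 by (simp add: mult_nonneg_nonpos)
        then have "c * (y - x) - 2 * c * d / real n \<le> 0" by (simp add: \<delta>_def algebra_simps)
        then show ?thesis by (rule order_trans) simp
      qed
    qed
    have lim: "(\<lambda>n. a + 2 * c * d / real n * e) \<longlonglongrightarrow> a + 0 * e" for a e :: real
      by (intro tendsto_intros tendsto_divide_0[OF tendsto_const] filterlim_real_sequentially[THEN filterlim_mono] order_refl)
    have "measure \<nu> {x<..<y} \<le> c * (y - x)"
      using lim[of "c * (y - x)" 1] by (intro tendsto_lowerbound[where f="\<lambda>n. c * (y - x) + 2 * c * d / real n * 1"])
        (auto intro!: eventually_sequentiallyI[of 1] upper[simplified])
    moreover have "c * (y - x) \<le> measure \<nu> {x<..<y}"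
      using lim[of "c * (y - x)" "-1"] by (intro tendsto_upperbound[where f="\<lambda>n. c * (y - x) + 2 * c * d / real n * -1"])
        (auto intro!: eventually_sequentiallyI[of 1] lower[simplified])
    ultimately show ?thesis by simp
  qed
  have ebox: "emeasure \<nu> {x<..<y} = ennreal (c * (y - x))" if "x \<le> y" for x y
  proof (cases "x = y")
    case False
    have "{x<..<y} \<subseteq> cball 0 (max \<bar>x\<bar> \<bar>y\<bar>)" by (auto simp: dist_real_def)
    then have "emeasure \<nu> {x<..<y} = ennreal (measure \<nu> {x<..<y})"
      using fin' by (intro emeasure_eq_ennreal_measure) auto
    then show ?thesis using box[of x y] that False by simp
  qed simp
  have cpos: "c > 0"
  proof (rule ccontr)
    assume "\<not> c > 0"
    with c0 have "c = 0" by simp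
    then have z: "emeasure \<nu> {- real n<..<real n} = 0" for n by (subst ebox) auto
    have "emeasure \<nu> (\<Union>n. {- real n<..<real n}) = 0"
      by (rule emeasure_UN_eq_0) (use z s in auto)
    moreover have "(\<Union>n. {- real n<..<real n}) = UNIV"
    proof (intro set_eqI iffI UNIV_I)
      fix u :: real
      obtain n where "\<bar>u\<bar> < real n" using reals_Archimedean2 by blast
      then show "u \<in> (\<Union>n. {- real n<..<real n})" by (auto intro!: exI[of _ n])
    qed
    ultimately show False using nz by simp
  qed
  have "lborel = density \<nu> (\<lambda>_. ennreal (1 / c))"
  proof (rule lborel_eqI)
    fix l u :: real assume "\<And>b. b \<in> Basis \<Longrightarrow> l \<bullet> b \<le> u \<bullet> b"
    then have lu: "l \<le> u" by simp
    have "emeasure (density \<nu> (\<lambda>_. ennreal (1 / c))) (box l u) = ennreal (1 / c) * emeasure \<nu> {l<..<u}"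
      by (subst emeasure_density) (auto simp: nn_integral_cmult_indicator box_real s)
    also have "\<dots> = ennreal (u - l)" using lu cpos by (simp add: ebox flip: ennreal_mult)
    finally show "emeasure (density \<nu> (\<lambda>_. ennreal (1 / c))) (box l u) = ennreal (prod ((\<bullet>) (u - l)) Basis)" by simp
  qed (simp add: s)
  then have "density lborel (\<lambda>_. ennreal c) = density (density \<nu> (\<lambda>_. ennreal (1 / c))) (\<lambda>_. ennreal c)" by simp
  also have "\<dots> = density \<nu> (\<lambda>_. ennreal (1 / c) * ennreal c)"
    by (rule density_density_eq) auto
  also have "\<dots> = \<nu>" using cpos by (simp add: density_1 flip: ennreal_mult)
  finally show ?thesis using cpos by (intro exI[of _ c]) auto
qed

section \<open>Measures on the diagonal\<close>

lemma coord_mean_inner: "coord_mean x = vec (1 / real CARD('d)) \<bullet> (x :: real^'d)"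
  by (simp add: coord_mean_def inner_vec_def sum_divide_distrib)

lemma coord_mean_vec [simp]: "coord_mean (vec u :: real^'d) = u"
  by (simp add: coord_mean_def)

lemma coord_mean_add [simp]: "coord_mean (x + y) = coord_mean x + coord_mean y"
  by (simp add: coord_mean_inner inner_add_right)

lemma vec_inner_vec: "(vec u :: real^'d) \<bullet> x = u * (real CARD('d) * coord_mean x)"
  by (simp add: coord_mean_def inner_vec_def flip: sum_distrib_left)

lemma perp_part_inner: "perp_part x $ i = x $ i - coord_mean x"
  by (simp add: perp_part_def diag_part_def)

lemma perp_part_vec_add [simp]: "perp_part (vec u + x) = perp_part x"
  by (simp add: vec_eq_iff perp_part_inner)

lemma perp_inner_eq: "perp_part x $ i = (axis i 1 - vec (1 / real CARD('d))) \<bullet> (x :: real^'d)"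
  by (simp add: perp_part_inner coord_mean_inner inner_diff_left inner_axis')

lemma diagonal_iff: "x \<in> diagonal \<longleftrightarrow> x = vec (coord_mean x)"
  unfolding diagonal_def by (metis coord_mean_vec rangeE rangeI)

lemma measurable_coord_mean [measurable]: "coord_mean \<in> borel_measurable borel"
  unfolding coord_mean_inner[abs_def] by measurable

lemma measurable_vec [measurable]: "(vec :: real \<Rightarrow> real^'d) \<in> borel_measurable borel"
  unfolding vec_def by (intro borel_measurable_vec_lambda) auto

lemma measurable_perp_part [measurable]: "perp_part \<in> borel_measurable borel"
  unfolding perp_part_def[abs_def] diag_part_def by measurable

lemma measurable_diagonal [measurable]: "(diagonal :: (real^'d) set) \<in> sets borel"
proof -
  have "(diagonal :: (real^'d) set) = {x. perp_part x = 0}"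
    by (auto simp: diagonal_iff perp_part_def diag_part_def)
  also have "\<dots> \<in> sets borel" by measurable
  finally show ?thesis .
qed

lemma norm_le_coord_mean_perp:
  "norm (x :: real^'d) \<le> \<bar>coord_mean x\<bar> * norm (vec 1 :: real^'d) + norm (perp_part x)"
proof -
  have "x = coord_mean x *\<^sub>R vec 1 + perp_part x"
    by (simp add: vec_eq_iff perp_part_inner)
  then have "norm x \<le> norm (coord_mean x *\<^sub>R (vec 1 :: real^'d)) + norm (perp_part x)"
    by (metis norm_triangle_ineq)
  then show ?thesis by simp
qed

lemma sigma_finite_of_bounded_finite:
  fixes L :: "'b::real_normed_vector measure"
  assumes s: "sets L = sets borel" and fin: "\<And>R. emeasure L (cball 0 R) < \<infinity>"
  shows "sigma_finite_measure L"
proof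
  have "\<Union> (range (\<lambda>n. cball 0 (real n))) = (UNIV :: 'b set)"
    using real_arch_simple by (auto simp: set_eq_iff) 
  then show "\<exists>A. countable A \<and> A \<subseteq> sets L \<and> \<Union> A = space L \<and> (\<forall>a\<in>A. emeasure L a \<noteq> \<infinity>)"
    using fin s sets_eq_imp_space_eq[OF s]
    by (intro exI[of _ "range (\<lambda>n. cball 0 (real n))"]) (auto simp: less_top)
qed

lemma diagonal_integral:
  fixes \<Lambda> :: "(real^'d) measure"
  assumes s[measurable_cong]: "sets \<Lambda> = sets borel" and diag: "emeasure \<Lambda> (- diagonal) = 0"
    and f[measurable]: "f \<in> borel_measurable borel"
  shows "(\<integral>\<^sup>+x. f x \<partial>\<Lambda>) = (\<integral>\<^sup>+u. f (vec u) \<partial>distr \<Lambda> borel coord_mean)"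
proof -
  have "AE x in \<Lambda>. x \<in> diagonal"
    using diag by (subst AE_iff_measurable[where N="- diagonal"]) (auto simp: s sets_eq_imp_space_eq[OF s])
  then have "(\<integral>\<^sup>+x. f x \<partial>\<Lambda>) = (\<integral>\<^sup>+x. f (vec (coord_mean x)) \<partial>\<Lambda>)"
    by (intro nn_integral_cong_AE) (auto simp: diagonal_iff)
  also have "\<dots> = (\<integral>\<^sup>+u. f (vec u) \<partial>distr \<Lambda> borel coord_mean)"
    by (subst nn_integral_distr) auto
  finally show ?thesis .
qed

lemma measure_eqI_nn_integral:
  assumes "sets \<mu> = sets \<nu>" "\<And>f. f \<in> borel_measurable \<mu> \<Longrightarrow> (\<integral>\<^sup>+x. f x \<partial>\<mu>) = (\<integral>\<^sup>+x. f x \<partial>\<nu>)"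
  shows "\<mu> = \<nu>"
proof (rule measure_eqI[OF assms(1)])
  fix A assume "A \<in> sets \<mu>"
  then show "emeasure \<mu> A = emeasure \<nu> A"
    using assms(2)[of "indicator A"] assms(1) by simp
qed

lemma diagonal_bounded_finite:
  fixes \<Lambda> :: "(real^'d) measure"
  assumes s[measurable_cong]: "sets \<Lambda> = sets borel" and diag: "emeasure \<Lambda> (- diagonal) = 0"
    and fin: "\<And>R. emeasure \<Lambda> (cball 0 R) < \<infinity>"
  shows "emeasure (distr \<Lambda> borel coord_mean) (cball 0 R) < \<infinity>"
proof -
  let ?R = "R * norm (vec 1 :: real^'d)"
  have "emeasure (distr \<Lambda> borel coord_mean) (cball 0 R) = (\<integral>\<^sup>+u. indicator (cball 0 R) u \<partial>distr \<Lambda> borel coord_mean)"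
    by (rule nn_integral_indicator[symmetric]) (simp del: cball_eq_atLeastAtMost)
  also have "\<dots> \<le> (\<integral>\<^sup>+u. indicator (cball 0 ?R) (vec u :: real^'d) \<partial>distr \<Lambda> borel coord_mean)"
  proof (intro nn_integral_mono)
    fix u :: real
    have "norm (vec u :: real^'d) = \<bar>u\<bar> * norm (vec 1 :: real^'d)"
    proof -
      have "(vec u :: real^'d) = u *\<^sub>R vec 1" by (simp add: vec_eq_iff)
      then show ?thesis by simp
    qed
    then show "indicator (cball 0 R) u \<le> (indicator (cball 0 ?R) (vec u :: real^'d) :: ennreal)"
      by (auto simp: indicator_def mult_right_mono)
  qed
  also have "\<dots> = emeasure \<Lambda> (cball 0 ?R)"
    by (subst diagonal_integral[OF s diag borel_measurable_indicator[OF borel_closed[OF closed_cball]], symmetric]) (simp add: s)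
  also have "\<dots> < \<infinity>" by (rule fin)
  finally show ?thesis .
qed

text \<open>The factor \<open>sqrt d\<close> is the length of the vector \<open>(1, \<dots>, 1)\<close>, by which the parametrisation
  \<open>v \<mapsto> vec v\<close> differs from the one of unit speed.\<close>

lemma nn_integral_exp_diagonal:
  fixes f :: "real^'d \<Rightarrow> ennreal"
  assumes [measurable]: "f \<in> borel_measurable borel"
  shows "(\<integral>\<^sup>+z. f z \<partial>exp_diagonal l) = ennreal (sqrt (real CARD('d))) * (\<integral>\<^sup>+v. ennreal (exp (- (l * v))) * f (vec v) \<partial>lborel)"
proof -
  let ?d = "sqrt (real CARD('d))"
  have d: "?d > 0" by simp
  have dv: "diag_vec l \<bullet> (vec v :: real^'d) = l * v" for v
    by (simp add: diag_vec_def vec_inner_vec)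
  have [measurable]: "(\<lambda>z::real^'d. diag_vec l \<bullet> z) \<in> borel_measurable borel" by measurable
  have "(\<integral>\<^sup>+z. f z \<partial>exp_diagonal l) = (\<integral>\<^sup>+z. ennreal (exp (- (diag_vec l \<bullet> z))) * f z \<partial>lebesgue_diagonal)"
    unfolding exp_diagonal_def lebesgue_diagonal_def by (rule nn_integral_density) measurable
  also have "\<dots> = (\<integral>\<^sup>+u. ennreal (exp (- (l * (u / ?d)))) * f (vec (u / ?d)) \<partial>lborel)"
    unfolding lebesgue_diagonal_def by (subst nn_integral_distr) (auto simp: dv)
  also have "\<dots> = ennreal ?d * (\<integral>\<^sup>+v. ennreal (exp (- (l * v))) * f (vec v) \<partial>lborel)"
    by (subst nn_integral_real_affine[where c="?d" and t=0]) (auto simp: field_simps)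
  finally show ?thesis .
qed

lemma sets_exp_diagonal [simp]: "sets (exp_diagonal l) = sets borel"
  by (simp add: exp_diagonal_def lebesgue_diagonal_def)

lemma nn_integral_scale_exp_diagonal:
  fixes f :: "real^'d \<Rightarrow> ennreal"
  assumes "f \<in> borel_measurable borel" "a \<ge> 0"
  shows "(\<integral>\<^sup>+z. f z \<partial>scale_measure (ennreal a) (exp_diagonal l)) =
    ennreal (a * sqrt (real CARD('d))) * (\<integral>\<^sup>+v. ennreal (exp (- (l * v))) * f (vec v) \<partial>lborel)"
  using assms by (subst nn_integral_scale_measure)
    (auto simp: nn_integral_exp_diagonal ennreal_mult mult.assoc measurable_cong_sets[OF sets_exp_diagonal refl])

lemma exp_diagonal_shift:
  fixes f :: "real^'d \<Rightarrow> ennreal"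
  assumes f[measurable]: "f \<in> borel_measurable borel" and a: "a \<ge> 0"
  shows "(\<integral>\<^sup>+z. f (z + vec w) \<partial>scale_measure (ennreal a) (exp_diagonal l)) =
    ennreal (exp (l * w)) * (\<integral>\<^sup>+z. f z \<partial>scale_measure (ennreal a) (exp_diagonal l))"
proof -
  have vv: "vec v + vec w = (vec (v + w) :: real^'d)" for v by (simp add: vec_eq_iff)
  have "(\<integral>\<^sup>+v. ennreal (exp (- (l * v))) * f (vec v + vec w) \<partial>lborel) = (\<integral>\<^sup>+v. ennreal (exp (- (l * (v - w)))) * f (vec v) \<partial>lborel)"
    by (subst nn_integral_real_affine[where c=1 and t="-w"]) (auto simp: vv)
  also have "\<dots> = (\<integral>\<^sup>+v. ennreal (exp (l * w)) * (ennreal (exp (- (l * v))) * f (vec v)) \<partial>lborel)"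
    by (intro nn_integral_cong) (simp add: algebra_simps exp_diff exp_minus exp_add ennreal_mult[symmetric] mult.assoc[symmetric] flip: divide_inverse)
  also have "\<dots> = ennreal (exp (l * w)) * (\<integral>\<^sup>+v. ennreal (exp (- (l * v))) * f (vec v) \<partial>lborel)"
    by (rule nn_integral_cmult) measurable
  finally show ?thesis
    using a by (simp add: nn_integral_scale_exp_diagonal mult.left_commute)
qed

text \<open>The measure with density \<open>exp (l u)\<close> with respect to \<open>\<Lambda>\<close> is invariant under the same shifts.\<close>

lemma exp_diagonal_of_quasi_invariant:
  fixes \<Lambda> :: "(real^'d) measure"
  assumes s[measurable_cong]: "sets \<Lambda> = sets borel" and diag: "emeasure \<Lambda> (- diagonal) = 0"
    and fin: "\<And>R. emeasure \<Lambda> (cball 0 R) < \<infinity>" and nz: "emeasure \<Lambda> UNIV \<noteq> 0" and b: "b \<noteq> 0"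
    and inv: "\<And>(n::nat) f. n \<ge> 1 \<Longrightarrow> f \<in> borel_measurable borel \<Longrightarrow>
      (\<integral>\<^sup>+x. f (x + vec (b / real n)) \<partial>\<Lambda>) = ennreal (exp (l * (b / real n))) * (\<integral>\<^sup>+x. f x \<partial>\<Lambda>)"
  shows "\<exists>a>0. \<Lambda> = scale_measure (ennreal a) (exp_diagonal l)"
proof -
  define L where "L = distr \<Lambda> borel coord_mean"
  have sL[measurable_cong]: "sets L = sets borel" by (simp add: L_def)
  have Lint: "(\<integral>\<^sup>+x. f x \<partial>\<Lambda>) = (\<integral>\<^sup>+u. f (vec u) \<partial>L)" if "f \<in> borel_measurable borel" for f
    unfolding L_def by (rule diagonal_integral[OF s diag that])
  have finL: "emeasure L (cball 0 R) < \<infinity>" for R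
    unfolding L_def by (rule diagonal_bounded_finite[OF s diag fin])
  define N where "N = density L (\<lambda>u. ennreal (exp (l * u)))"
  have sN: "sets N = sets borel" by (simp add: N_def sL)
  have emN: "emeasure N A = (\<integral>\<^sup>+u. ennreal (exp (l * u)) * indicator A u \<partial>L)" if "A \<in> sets borel" for A
    unfolding N_def using that by (subst emeasure_density) (auto simp: sL)
  have "\<exists>c>0. N = density lborel (\<lambda>_. ennreal c)"
  proof (rule translation_invariant_measure[OF sN b])
    show "emeasure N UNIV \<noteq> 0"
    proof
      assume "emeasure N UNIV = 0"
      then have "AE u in L. ennreal (exp (l * u)) = 0"
        unfolding emN[OF space_in_borel] by (subst (asm) nn_integral_0_iff_AE) auto
      then have "AE u in L. False" by simp
      then have "emeasure L UNIV = 0" by (subst (asm) AE_iff_measurable[where N=UNIV]) (auto simp: sL sets_eq_imp_space_eq[OF sL])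
      moreover have "emeasure L UNIV = emeasure \<Lambda> UNIV"
        by (simp add: L_def emeasure_distr sets_eq_imp_space_eq[OF s])
      ultimately show False using nz by simp
    qed
    show "emeasure N (cball 0 R) < \<infinity>" for R
    proof -
      have m: "cball 0 R \<in> sets (borel :: real measure)" by (rule borel_closed[OF closed_cball])
      have "emeasure N (cball 0 R) \<le> (\<integral>\<^sup>+u. ennreal (exp (\<bar>l\<bar> * R)) * indicator (cball 0 R) u \<partial>L)"
        unfolding emN[OF m]
      proof (intro nn_integral_mono)
        fix u
        have "l * u \<le> \<bar>l\<bar> * R" if "\<bar>u\<bar> \<le> R"
        proof -
          have "l * u \<le> \<bar>l\<bar> * \<bar>u\<bar>" by (simp flip: abs_mult)
          also have "\<dots> \<le> \<bar>l\<bar> * R" using that by (intro mult_left_mono) auto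
          finally show ?thesis .
        qed
        then show "ennreal (exp (l * u)) * indicator (cball 0 R) u \<le> ennreal (exp (\<bar>l\<bar> * R)) * indicator (cball 0 R) u"
          by (auto simp: indicator_def dist_real_def ennreal_leI)
      qed
      also have "\<dots> = ennreal (exp (\<bar>l\<bar> * R)) * emeasure L (cball 0 R)"
        using m by (intro nn_integral_cmult_indicator) (simp add: sL del: cball_eq_atLeastAtMost)
      also have "\<dots> < \<infinity>" using finL[of R] by (simp add: ennreal_mult_less_top)
      finally show ?thesis .
    qed
    fix n :: nat and A assume n: "n \<ge> 1" and A[measurable]: "A \<in> sets (borel :: real measure)"
    let ?w = "b / real n"
    define f where "f x = ennreal (exp (l * coord_mean x)) * indicator A (coord_mean x)" for x :: "real^'d"
    have f[measurable]: "f \<in> borel_measurable borel" unfolding f_def by measurable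
    have "emeasure N ((\<lambda>u. u + ?w) -` A) = (\<integral>\<^sup>+u. ennreal (exp (l * u)) * indicator ((\<lambda>u. u + ?w) -` A) u \<partial>L)"
      by (rule emN) (rule measurable_sets_borel[OF _ A], simp)
    also have "\<dots> = (\<integral>\<^sup>+u. ennreal (exp (- (l * ?w))) * f (vec u + vec ?w) \<partial>L)"
    proof (intro nn_integral_cong)
      fix u
      have "exp (l * u) = exp (- (l * ?w)) * exp (l * (u + ?w))" by (simp add: algebra_simps flip: exp_add)
      then show "ennreal (exp (l * u)) * indicator ((\<lambda>u. u + ?w) -` A) u = ennreal (exp (- (l * ?w))) * f (vec u + vec ?w)"
        by (simp add: f_def indicator_def ennreal_mult)
    qed
    also have "\<dots> = ennreal (exp (- (l * ?w))) * (\<integral>\<^sup>+u. f (vec u + vec ?w) \<partial>L)"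
      by (rule nn_integral_cmult) measurable
    also have "(\<integral>\<^sup>+u. f (vec u + vec ?w) \<partial>L) = (\<integral>\<^sup>+x. f (x + vec ?w) \<partial>\<Lambda>)"
      by (rule Lint[symmetric]) measurable
    also have "\<dots> = ennreal (exp (l * ?w)) * (\<integral>\<^sup>+x. f x \<partial>\<Lambda>)" by (rule inv[OF n f])
    also have "ennreal (exp (- (l * ?w))) * (ennreal (exp (l * ?w)) * (\<integral>\<^sup>+x. f x \<partial>\<Lambda>)) = (\<integral>\<^sup>+x. f x \<partial>\<Lambda>)"
      by (simp add: mult.assoc[symmetric] flip: ennreal_mult exp_add)
    also have "\<dots> = emeasure N A" unfolding Lint[OF f] emN[OF A] by (simp add: f_def)
    finally show "emeasure N ((\<lambda>u. u + ?w) -` A) = emeasure N A" .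
  qed
  then obtain c where c: "c > 0" "N = density lborel (\<lambda>_. ennreal c)" by blast
  have LN: "(\<integral>\<^sup>+u. g u \<partial>L) = (\<integral>\<^sup>+u. ennreal c * (ennreal (exp (- (l * u))) * g u) \<partial>lborel)" if [measurable]: "g \<in> borel_measurable borel" for g
  proof -
    have "(\<integral>\<^sup>+u. g u \<partial>L) = (\<integral>\<^sup>+u. ennreal (exp (l * u)) * (ennreal (exp (- (l * u))) * g u) \<partial>L)"
      by (simp add: mult.assoc[symmetric] flip: ennreal_mult exp_add)
    also have "\<dots> = (\<integral>\<^sup>+u. ennreal (exp (- (l * u))) * g u \<partial>N)"
      unfolding N_def by (rule nn_integral_density[symmetric]) measurable
    also have "\<dots> = (\<integral>\<^sup>+u. ennreal c * (ennreal (exp (- (l * u))) * g u) \<partial>lborel)"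
      unfolding c(2) by (rule nn_integral_density) measurable
    finally show ?thesis .
  qed
  let ?d = "sqrt (real CARD('d))"
  have "\<Lambda> = scale_measure (ennreal (c / ?d)) (exp_diagonal l)"
  proof (rule measure_eqI_nn_integral)
    fix f :: "real^'d \<Rightarrow> ennreal" assume "f \<in> borel_measurable \<Lambda>"
    then have [measurable]: "f \<in> borel_measurable borel" by (simp add: measurable_cong_sets[OF s refl])
    have "(\<integral>\<^sup>+x. f x \<partial>\<Lambda>) = ennreal c * (\<integral>\<^sup>+u. ennreal (exp (- (l * u))) * f (vec u) \<partial>lborel)"
      by (subst Lint, simp, subst LN, simp, subst nn_integral_cmult) auto
    also have "\<dots> = (\<integral>\<^sup>+x. f x \<partial>scale_measure (ennreal (c / ?d)) (exp_diagonal l))"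
      using c(1) by (subst nn_integral_scale_exp_diagonal) auto
    finally show "(\<integral>\<^sup>+x. f x \<partial>\<Lambda>) = (\<integral>\<^sup>+x. f x \<partial>scale_measure (ennreal (c / ?d)) (exp_diagonal l))" .
  qed (simp add: s)
  then show ?thesis using c(1) by (intro exI[of _ "c / ?d"]) auto
qed

locale gaussian_vector_process = prob_space M for M :: "'a measure" +
  fixes \<xi> :: "real \<Rightarrow> 'a \<Rightarrow> real^'d"
  assumes gaussian_xi: "gaussian_process M \<xi>"

sublocale gaussian_vector_process \<subseteq> gaussian_space M "process_span \<xi>"
  by (rule gaussian_space_process_span) (unfold_locales, rule gaussian_xi)

context gaussian_vector_process begin

abbreviation "V \<equiv> process_span \<xi>"

lemma measurable_xi [measurable]: "\<xi> t \<in> borel_measurable M"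
  using gaussian_xi by (simp add: gaussian_process_def)

lemmas inner_V = inner_in_process_span[where \<xi>=\<xi>]

lemma component_V: "(\<lambda>\<omega>. \<xi> t \<omega> $ i) \<in> V"
  using inner_V[of "axis i 1" t] by (simp add: inner_axis')

lemma coord_mean_V: "(\<lambda>\<omega>. coord_mean (\<xi> t \<omega>)) \<in> V"
  unfolding coord_mean_inner by (rule inner_V)

lemma perp_V: "(\<lambda>\<omega>. perp_part (\<xi> t \<omega>) $ i) \<in> V"
  unfolding perp_inner_eq by (rule inner_V)

text \<open>With \<open>\<eta> = l \<bullet> \<zeta> + r\<close>, where \<open>r\<close> is independent of \<open>\<zeta>\<close>, the test functions
  \<open>f(coord_mean z - l \<bullet> perp_part z) \<cdot> 1{\<bar>perp_part z\<bar> \<le> k}\<close> see the convolution of the starting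
  measure with the law of \<open>r\<close>, multiplied by the probability of \<open>\<bar>\<zeta>\<bar> \<le> k\<close>. They have bounded support
  if \<open>f\<close> has, so local finiteness is inherited, and the one-dimensional case applies.\<close>

lemma diagonal_deconvolution:
  fixes \<Lambda>1 \<Lambda>2 :: "(real^'d) measure"
  assumes s1[measurable_cong]: "sets \<Lambda>1 = sets borel" and s2[measurable_cong]: "sets \<Lambda>2 = sets borel"
    and d1: "emeasure \<Lambda>1 (- diagonal) = 0" and d2: "emeasure \<Lambda>2 (- diagonal) = 0"
    and f1: "\<And>R. emeasure \<Lambda>1 (cball 0 R) < \<infinity>" and f2: "\<And>R. emeasure \<Lambda>2 (cball 0 R) < \<infinity>"
    and eq: "\<And>f. f \<in> borel_measurable borel \<Longrightarrow> (\<integral>\<^sup>+x. \<integral>\<^sup>+\<omega>. f (x + \<xi> t \<omega>) \<partial>M \<partial>\<Lambda>1) = (\<integral>\<^sup>+x. \<integral>\<^sup>+\<omega>. f (x + \<xi> t \<omega>) \<partial>M \<partial>\<Lambda>2)"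
    and fin: "\<And>R. (\<integral>\<^sup>+x. \<integral>\<^sup>+\<omega>. indicator (cball 0 R) (x + \<xi> t \<omega>) \<partial>M \<partial>\<Lambda>1) < \<infinity>"
  shows "\<Lambda>1 = \<Lambda>2"
proof -
  obtain l :: "real^'d" where l: "\<And>i. cov M (\<lambda>\<omega>. coord_mean (\<xi> t \<omega>) - (\<Sum>j\<in>UNIV. l $ j * perp_part (\<xi> t \<omega>) $ j)) (\<lambda>\<omega>. perp_part (\<xi> t \<omega>) $ i) = 0"
    using regression[OF coord_mean_V[of t], of "\<lambda>i \<omega>. perp_part (\<xi> t \<omega>) $ i"] perp_V by blast
  define r where "r \<omega> = coord_mean (\<xi> t \<omega>) - l \<bullet> perp_part (\<xi> t \<omega>)" for \<omega>
  have r_eq: "r = (\<lambda>\<omega>. coord_mean (\<xi> t \<omega>) - (\<Sum>j\<in>UNIV. l $ j * perp_part (\<xi> t \<omega>) $ j))"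
    by (auto simp: r_def inner_vec_def)
  have rV: "r \<in> V" unfolding r_eq by (intro diff sum scale coord_mean_V perp_V)
  note [measurable] = meas[OF rV]
  have rcov: "cov M r (\<lambda>\<omega>. perp_part (\<xi> t \<omega>) $ i) = 0" for i unfolding r_eq by (rule l)
  have indep: "(\<integral>\<^sup>+\<omega>. f (r \<omega>) * g (perp_part (\<xi> t \<omega>)) \<partial>M) = (\<integral>\<^sup>+\<omega>. f (r \<omega>) \<partial>M) * (\<integral>\<^sup>+\<omega>. g (perp_part (\<xi> t \<omega>)) \<partial>M)"
    if [measurable]: "f \<in> borel_measurable borel" "g \<in> borel_measurable borel" for f g
  proof -
    have "(\<lambda>h. \<chi> i. h i) \<in> measurable (\<Pi>\<^sub>M i\<in>(UNIV::'d set). (borel :: real measure)) borel"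
      by (intro borel_measurable_vec_lambda measurable_component_singleton) auto
    then have g': "(\<lambda>h. g (\<chi> i. h i)) \<in> borel_measurable (\<Pi>\<^sub>M i\<in>(UNIV::'d set). (borel :: real measure))"
      by (rule measurable_compose) fact
    have "(\<chi> i. restrict (\<lambda>i. perp_part (\<xi> t \<omega>) $ i) UNIV i) = perp_part (\<xi> t \<omega>)" for \<omega>
      by (simp add: vec_eq_iff)
    then show ?thesis
      using independent_of_uncorrelated[OF finite_class.finite_UNIV rV, where Y="\<lambda>i \<omega>. perp_part (\<xi> t \<omega>) $ i", OF perp_V rcov that(1) g'] by simp
  qed
  define B where "B k = {z :: real^'d. norm z \<le> real k}" for k :: nat
  have [measurable]: "B k \<in> sets borel" for k unfolding B_def by measurable
  define q where "q k = (\<integral>\<^sup>+\<omega>. indicator (B k) (perp_part (\<xi> t \<omega>)) \<partial>M)" for k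
  have q1: "q k \<le> 1" for k
  proof -
    have "q k \<le> (\<integral>\<^sup>+\<omega>. 1 \<partial>M)" unfolding q_def by (intro nn_integral_mono) (simp add: indicator_def)
    then show ?thesis by (simp add: emeasure_space_1)
  qed
  obtain k where k: "q k \<noteq> 0"
  proof (rule ccontr)
    assume "\<not> thesis"
    then have "q k = 0" for k using that by blast
    then have "AE \<omega> in M. \<forall>k. indicator (B k) (perp_part (\<xi> t \<omega>)) = (0 :: ennreal)"
      unfolding AE_all_countable q_def by (subst (asm) nn_integral_0_iff_AE) auto
    then have "AE \<omega> in M. False"
    proof eventually_elim
      case (elim \<omega>)
      obtain k :: nat where "norm (perp_part (\<xi> t \<omega>)) \<le> real k" using real_arch_simple by blast
      then show ?case using elim[rule_format, of k] by (simp add: B_def)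
    qed
    then show False by simp
  qed
  \<comment> \<open>A test function of bounded support that only sees the residual and the event \<open>\<zeta>(t) \<in> B k\<close>.\<close>
  define F where "F f z = f (coord_mean z - l \<bullet> perp_part z) * indicator (B k) (perp_part z)" for f :: "real \<Rightarrow> ennreal" and z :: "real^'d"
  have Fm[measurable]: "F f \<in> borel_measurable borel" if [measurable]: "f \<in> borel_measurable borel" for f
    unfolding F_def by measurable
  have FL: "(\<integral>\<^sup>+x. \<integral>\<^sup>+\<omega>. F f (x + \<xi> t \<omega>) \<partial>M \<partial>\<Lambda>) = q k * (\<integral>\<^sup>+u. \<integral>\<^sup>+\<omega>. f (u + r \<omega>) \<partial>M \<partial>distr \<Lambda> borel coord_mean)"
    if s[measurable_cong]: "sets \<Lambda> = sets borel" and d: "emeasure \<Lambda> (- diagonal) = 0" and [measurable]: "f \<in> borel_measurable borel" for f and \<Lambda> :: "(real^'d) measure"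
  proof -
    have "(\<integral>\<^sup>+x. \<integral>\<^sup>+\<omega>. F f (x + \<xi> t \<omega>) \<partial>M \<partial>\<Lambda>) = (\<integral>\<^sup>+u. \<integral>\<^sup>+\<omega>. F f (vec u + \<xi> t \<omega>) \<partial>M \<partial>distr \<Lambda> borel coord_mean)"
      by (rule diagonal_integral[OF s d]) measurable
    also have "\<dots> = (\<integral>\<^sup>+u. (\<integral>\<^sup>+\<omega>. f (u + r \<omega>) \<partial>M) * q k \<partial>distr \<Lambda> borel coord_mean)"
    proof (intro nn_integral_cong)
      fix u
      have "(\<integral>\<^sup>+\<omega>. F f (vec u + \<xi> t \<omega>) \<partial>M) = (\<integral>\<^sup>+\<omega>. f (u + r \<omega>) * indicator (B k) (perp_part (\<xi> t \<omega>)) \<partial>M)"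
        unfolding F_def r_def by (simp add: algebra_simps)
      also have "\<dots> = (\<integral>\<^sup>+\<omega>. f (u + r \<omega>) \<partial>M) * q k"
        unfolding q_def by (rule indep[of "\<lambda>v. f (u + v)" "indicator (B k)"]) measurable
      finally show "(\<integral>\<^sup>+\<omega>. F f (vec u + \<xi> t \<omega>) \<partial>M) = (\<integral>\<^sup>+\<omega>. f (u + r \<omega>) \<partial>M) * q k" .
    qed
    also have "\<dots> = (\<integral>\<^sup>+u. \<integral>\<^sup>+\<omega>. f (u + r \<omega>) \<partial>M \<partial>distr \<Lambda> borel coord_mean) * q k"
      by (rule nn_integral_multc) measurable
    finally show ?thesis by (simp add: mult.commute)
  qed
  have "distr \<Lambda>1 borel coord_mean = distr \<Lambda>2 borel coord_mean"
  proof (rule gaussian_deconvolution[OF prob_space_axioms gaussian[OF rV]])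
    show "sigma_finite_measure (distr \<Lambda>1 borel coord_mean)" "sigma_finite_measure (distr \<Lambda>2 borel coord_mean)"
      by (intro sigma_finite_of_bounded_finite diagonal_bounded_finite s1 s2 d1 d2 f1 f2; simp)+
    show "(\<integral>\<^sup>+u. \<integral>\<^sup>+\<omega>. f (u + r \<omega>) \<partial>M \<partial>distr \<Lambda>1 borel coord_mean) = (\<integral>\<^sup>+u. \<integral>\<^sup>+\<omega>. f (u + r \<omega>) \<partial>M \<partial>distr \<Lambda>2 borel coord_mean)"
      if f: "f \<in> borel_measurable borel" for f
    proof -
      have "q k * (\<integral>\<^sup>+u. \<integral>\<^sup>+\<omega>. f (u + r \<omega>) \<partial>M \<partial>distr \<Lambda>1 borel coord_mean) = q k * (\<integral>\<^sup>+u. \<integral>\<^sup>+\<omega>. f (u + r \<omega>) \<partial>M \<partial>distr \<Lambda>2 borel coord_mean)"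
        using eq[OF Fm[OF f]] unfolding FL[OF s1 d1 f] FL[OF s2 d2 f] .
      moreover have "q k \<noteq> top" using q1[of k] by (auto simp: top_unique)
      ultimately show ?thesis using k by (simp add: ennreal_mult_cancel_left)
    qed
    show "(\<integral>\<^sup>+u. \<integral>\<^sup>+\<omega>. indicator (cball 0 R) (u + r \<omega>) \<partial>M \<partial>distr \<Lambda>1 borel coord_mean) < \<infinity>" for R
    proof -
      define R' where "R' = (R + norm l * real k) * norm (vec 1 :: real^'d) + real k"
      have m: "(indicator (cball 0 R) :: real \<Rightarrow> ennreal) \<in> borel_measurable borel"
        by (rule borel_measurable_indicator[OF borel_closed[OF closed_cball]])
      have "F (indicator (cball 0 R)) z \<le> indicator (cball 0 R') z" for z
      proof -
        have "norm z \<le> R'" if z: "\<bar>coord_mean z - l \<bullet> perp_part z\<bar> \<le> R" "norm (perp_part z) \<le> real k"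
        proof -
          have "\<bar>l \<bullet> perp_part z\<bar> \<le> norm l * norm (perp_part z)" by (rule Cauchy_Schwarz_ineq2)
          also have "\<dots> \<le> norm l * real k" using z by (intro mult_left_mono) auto
          finally have "\<bar>coord_mean z\<bar> \<le> R + norm l * real k" using z by linarith
          then have "\<bar>coord_mean z\<bar> * norm (vec 1 :: real^'d) \<le> (R + norm l * real k) * norm (vec 1 :: real^'d)"
            by (intro mult_right_mono) auto
          with norm_le_coord_mean_perp[of z] z(2) show ?thesis unfolding R'_def by linarith
        qed
        then show ?thesis by (auto simp: F_def B_def indicator_def dist_real_def)
      qed
      then have "(\<integral>\<^sup>+x. \<integral>\<^sup>+\<omega>. F (indicator (cball 0 R)) (x + \<xi> t \<omega>) \<partial>M \<partial>\<Lambda>1) \<le> (\<integral>\<^sup>+x. \<integral>\<^sup>+\<omega>. indicator (cball 0 R') (x + \<xi> t \<omega>) \<partial>M \<partial>\<Lambda>1)"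
        by (intro nn_integral_mono) auto
      also have "\<dots> < \<infinity>" by (rule fin)
      finally show ?thesis using k unfolding FL[OF s1 d1 m] by (auto simp: ennreal_mult_less_top)
    qed
  qed simp_all
  then show ?thesis
    using diagonal_integral[OF s1 d1] diagonal_integral[OF s2 d2] s1 s2
    by (intro measure_eqI_nn_integral) (auto simp: measurable_cong_sets[OF s1 refl])
qed

end

section \<open>Pair intensities\<close>

lemma process_law_eqI:
  fixes X X' :: "real \<Rightarrow> 'a \<Rightarrow> 'b::topological_space"
  assumes M: "prob_space M" and X[measurable]: "\<And>t. X t \<in> borel_measurable M" and X'[measurable]: "\<And>t. X' t \<in> borel_measurable M"
    and eq: "\<And>J H. finite J \<Longrightarrow> H \<in> borel_measurable (\<Pi>\<^sub>M j\<in>J. (borel :: 'b measure)) \<Longrightarrow>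
       (\<integral>\<^sup>+\<omega>. H (\<lambda>j\<in>J. X j \<omega>) \<partial>M) = (\<integral>\<^sup>+\<omega>. H (\<lambda>j\<in>J. X' j \<omega>) \<partial>M)"
  shows "process_law M X = process_law M X'"
proof -
  interpret prob_space M by fact
  let ?S = "\<Pi>\<^sub>M t\<in>(UNIV :: real set). (borel :: 'b measure)"
  have m: "(\<lambda>\<omega> t. Z t \<omega>) \<in> measurable M ?S" if "\<And>t. Z t \<in> borel_measurable M" for Z :: "real \<Rightarrow> 'a \<Rightarrow> 'b"
    by (rule measurable_PiM_single') (use that in auto)
  show ?thesis
  proof (rule measure_eqI_PiM_infinite[where I=UNIV and M="\<lambda>_. borel"])
    show "finite_measure (process_law M X)"
      unfolding process_law_def by (intro prob_space.finite_measure prob_space_distr m X)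
    fix A and J :: "real set" assume J: "finite J" and A: "\<And>i. i \<in> J \<Longrightarrow> A i \<in> sets (borel :: 'b measure)"
    have emb: "prod_emb UNIV (\<lambda>_. borel) J (PiE J A) \<in> sets ?S" using J A by (intro sets_PiM_I) auto
    have H: "indicator (PiE J A) \<in> borel_measurable (\<Pi>\<^sub>M j\<in>J. (borel :: 'b measure))"
      using J A by (intro borel_measurable_indicator sets_PiM_I_finite) auto
    have "emeasure (process_law M Z) (prod_emb UNIV (\<lambda>_. borel) J (PiE J A)) = (\<integral>\<^sup>+\<omega>. indicator (PiE J A) (\<lambda>j\<in>J. Z j \<omega>) \<partial>M)"
      if Z: "\<And>t. Z t \<in> borel_measurable M" for Z
    proof -
      have "emeasure (process_law M Z) (prod_emb UNIV (\<lambda>_. borel) J (PiE J A)) = (\<integral>\<^sup>+y. indicator (prod_emb UNIV (\<lambda>_. borel) J (PiE J A)) y \<partial>process_law M Z)"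
        using emb by (simp add: process_law_def)
      also have "\<dots> = (\<integral>\<^sup>+\<omega>. indicator (prod_emb UNIV (\<lambda>_. borel) J (PiE J A)) (\<lambda>t. Z t \<omega>) \<partial>M)"
        unfolding process_law_def using emb by (intro nn_integral_distr m Z) auto
      also have "\<dots> = (\<integral>\<^sup>+\<omega>. indicator (PiE J A) (\<lambda>j\<in>J. Z j \<omega>) \<partial>M)"
        by (intro nn_integral_cong) (auto simp: indicator_def prod_emb_def restrict_def)
      finally show ?thesis .
    qed
    then show "emeasure (process_law M X) (prod_emb UNIV (\<lambda>_. borel) J (PiE J A)) = emeasure (process_law M X') (prod_emb UNIV (\<lambda>_. borel) J (PiE J A))"
      using eq[OF J H] by simp
  qed (simp_all add: process_law_def)
qed

context gaussian_space begin

lemma real_process_law_eqI: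
  assumes X: "\<And>t. X t \<in> V" "\<And>t. X' t \<in> V"
    and mean: "\<And>t. integral\<^sup>L M (X t) = integral\<^sup>L M (X' t)"
    and covs: "\<And>t u. cov M (X t) (X u) = cov M (X' t) (X' u)"
  shows "process_law M X = process_law M X'"
  by (rule process_law_eqI[OF prob_space_axioms meas[OF X(1)] meas[OF X(2)]])
     (rule laws_eq[OF _ X mean covs])

lemma vector_process_law_eqI:
  fixes X X' :: "real \<Rightarrow> 'a \<Rightarrow> real^'d"
  assumes X: "\<And>t i. (\<lambda>\<omega>. X t \<omega> $ i) \<in> V" "\<And>t i. (\<lambda>\<omega>. X' t \<omega> $ i) \<in> V"
    and mean: "\<And>t i. (\<integral>\<omega>. X t \<omega> $ i \<partial>M) = (\<integral>\<omega>. X' t \<omega> $ i \<partial>M)"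
    and covs: "\<And>t u i k. cov M (\<lambda>\<omega>. X t \<omega> $ i) (\<lambda>\<omega>. X u \<omega> $ k) = cov M (\<lambda>\<omega>. X' t \<omega> $ i) (\<lambda>\<omega>. X' u \<omega> $ k)"
  shows "process_law M X = process_law M X'"
proof (rule process_law_eqI[OF prob_space_axioms])
  show "X t \<in> borel_measurable M" "X' t \<in> borel_measurable M" for t
    using borel_measurable_vec_lambda[of "\<lambda>i \<omega>. X t \<omega> $ i" M] borel_measurable_vec_lambda[of "\<lambda>i \<omega>. X' t \<omega> $ i" M]
      meas[OF X(1)] meas[OF X(2)] by simp_all
  fix J :: "real set" and H :: "(real \<Rightarrow> real^'d) \<Rightarrow> ennreal" assume J: "finite J" and H: "H \<in> borel_measurable (\<Pi>\<^sub>M j\<in>J. (borel :: (real^'d) measure))"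
  show "(\<integral>\<^sup>+\<omega>. H (\<lambda>j\<in>J. X j \<omega>) \<partial>M) = (\<integral>\<^sup>+\<omega>. H (\<lambda>j\<in>J. X' j \<omega>) \<partial>M)"
    using tilted_vector_laws_eq[OF J const[of 0] const[of 0] X _ _ covs H] mean by simp
qed

end

text \<open>An additive function scales with the natural numbers, so a negative value would make it
  unbounded below; the value at \<open>- t\<close> is the negative of that at \<open>t\<close>.\<close>

lemma additive_bounded_below_zero:
  fixes h :: "real \<Rightarrow> real"
  assumes add: "\<And>s t. h (s + t) = h s + h t" and bd: "\<And>t. B \<le> h t"
  shows "h t = 0"
proof -
  have mult: "h (real n * t) = real n * h t" for n t
    using add[of 0 0] by (induction n) (auto simp: algebra_simps add)
  have ge: "0 \<le> h t" for t
  proof (rule ccontr)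
    assume "\<not> 0 \<le> h t"
    then have neg: "h t < 0" by simp
    obtain n :: nat where "\<bar>B\<bar> / (- h t) < real n" using reals_Archimedean2 by blast
    then have "\<bar>B\<bar> < real n * (- h t)" using neg by (simp add: field_simps)
    moreover have "B \<le> real n * h t" using bd[of "real n * t"] by (simp add: mult)
    ultimately show False by (simp add: abs_if split: if_splits)
  qed
  have "h t + h (- t) = 0" using add[of t "-t"] add[of 0 0] by simp
  with ge[of t] ge[of "-t"] show ?thesis by linarith
qed

text \<open>The last assumption is local finiteness of the convolution of \<open>\<Lambda>\<close> with the law of each \<open>\<xi> t\<close>.\<close>

locale gaussian_system = gaussian_vector_process M \<xi> for M :: "'a measure" and \<xi> :: "real \<Rightarrow> 'a \<Rightarrow> real^'d" +
  fixes \<Lambda> :: "(real^'d) measure"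
  assumes sets_Lambda [measurable_cong]: "sets \<Lambda> = sets borel"
    and off_diagonal: "emeasure \<Lambda> (- diagonal) = 0"
    and nonzero: "emeasure \<Lambda> UNIV \<noteq> 0"
    and ball_finite: "emeasure \<Lambda> (cball 0 R) < \<infinity>"
    and displaced_ball_finite: "(\<integral>\<^sup>+x. \<integral>\<^sup>+\<omega>. indicator (cball 0 R) (x + \<xi> t \<omega>) \<partial>M \<partial>\<Lambda>) < \<infinity>"
begin

lemma AE_diagonal: "AE x in \<Lambda>. x \<in> diagonal"
  using off_diagonal
  by (subst AE_iff_measurable[where N="- diagonal"]) (auto simp: sets_Lambda sets_eq_imp_space_eq[OF sets_Lambda])

text \<open>The integral of \<open>H\<close> with respect to the intensity at the two times \<open>t\<close> and \<open>u\<close>.\<close>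

definition pair_integral :: "real \<Rightarrow> real \<Rightarrow> (real^'d \<Rightarrow> real^'d \<Rightarrow> ennreal) \<Rightarrow> ennreal" where
  "pair_integral t u H = (\<integral>\<^sup>+x. \<integral>\<^sup>+\<omega>. H (x + \<xi> t \<omega>) (x + \<xi> u \<omega>) \<partial>M \<partial>\<Lambda>)"

definition same_pair_intensity :: "real \<Rightarrow> real \<Rightarrow> real \<Rightarrow> real \<Rightarrow> bool" where
  "same_pair_intensity t u t' u' \<longleftrightarrow> (\<forall>H. case_prod H \<in> borel_measurable (borel \<Otimes>\<^sub>M borel) \<longrightarrow> pair_integral t u H = pair_integral t' u' H)"

text \<open>The functional is called admissible if \<open>(a + b) \<bullet> vec 1 = 0\<close>: it then takes the same value on
  \<open>(y, z)\<close> and \<open>(y + x, z + x)\<close> for diagonal \<open>x\<close>.\<close>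

definition pair_functional :: "real^'d \<Rightarrow> real^'d \<Rightarrow> real \<Rightarrow> real \<Rightarrow> 'a \<Rightarrow> real" where
  "pair_functional a b t u = (\<lambda>\<omega>. a \<bullet> \<xi> t \<omega> + b \<bullet> \<xi> u \<omega>)"

lemma pair_functional_V: "pair_functional a b t u \<in> V"
  unfolding pair_functional_def by (intro add inner_V)

text \<open>The Cameron--Martin shift: the translation of \<open>\<xi> t\<close> produced by the weight \<open>exp X\<close>.\<close>

definition cov_vec :: "('a \<Rightarrow> real) \<Rightarrow> real \<Rightarrow> real^'d" where
  "cov_vec X t = (\<chi> i. cov M (\<lambda>\<omega>. \<xi> t \<omega> $ i) X)"

lemma inner_cov_vec: "X \<in> V \<Longrightarrow> v \<bullet> cov_vec X t = cov M (\<lambda>\<omega>. v \<bullet> \<xi> t \<omega>) X"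
proof -
  assume X: "X \<in> V"
  have "cov M (\<lambda>\<omega>. \<Sum>i\<in>UNIV. v $ i * \<xi> t \<omega> $ i) X = (\<Sum>i\<in>UNIV. v $ i * cov M (\<lambda>\<omega>. \<xi> t \<omega> $ i) X)"
    by (subst cov_sum) (auto intro!: scale component_V X simp: cov_scale)
  then show ?thesis by (simp add: cov_vec_def inner_vec_def)
qed

text \<open>Cameron--Martin for the pair intensity: an admissible functional of \<open>(x + \<xi>(t), x + \<xi>(u))\<close> is a
  Gaussian variable that does not depend on the starting point \<open>x\<close>, because \<open>x\<close> lies on the diagonal.\<close>

lemma pair_integral_tilt:
  assumes adm: "(a + b) \<bullet> vec 1 = 0" and [measurable]: "case_prod H \<in> borel_measurable (borel \<Otimes>\<^sub>M borel)"
  shows "pair_integral t u (\<lambda>y z. ennreal (exp (a \<bullet> y + b \<bullet> z)) * H y z) =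
    ennreal (exp (integral\<^sup>L M (pair_functional a b t u) + cov M (pair_functional a b t u) (pair_functional a b t u) / 2)) *
    pair_integral t u (\<lambda>y z. H (y + cov_vec (pair_functional a b t u) t) (z + cov_vec (pair_functional a b t u) u))"
proof -
  let ?T = "pair_functional a b t u"
  let ?c = "integral\<^sup>L M ?T + cov M ?T ?T / 2"
  let ?k = "\<lambda>s. cov_vec ?T s"
  have one: "(\<integral>\<^sup>+\<omega>. ennreal (exp (?T \<omega>)) * H (x + \<xi> t \<omega>) (x + \<xi> u \<omega>) \<partial>M) =
      ennreal (exp ?c) * (\<integral>\<^sup>+\<omega>. H (x + \<xi> t \<omega> + ?k t) (x + \<xi> u \<omega> + ?k u) \<partial>M)" for x
  proof -
    define X where "X b = \<xi> (if b then u else t)" for b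
    define X' where "X' b \<omega> = \<xi> (if b then u else t) \<omega> + ?k (if b then u else t)" for b \<omega>
    define H' where "H' g = H (x + g False) (x + g True)" for g :: "bool \<Rightarrow> real^'d"
    have H': "H' \<in> borel_measurable (\<Pi>\<^sub>M b\<in>UNIV. borel)" unfolding H'_def by measurable
    have m: "(\<integral>\<omega>. X j \<omega> $ i \<partial>M) + cov M ?T (\<lambda>\<omega>. X j \<omega> $ i) = (\<integral>\<omega>. X' j \<omega> $ i \<partial>M) + cov M (\<lambda>_. ?c) (\<lambda>\<omega>. X' j \<omega> $ i)" for j i
      using component_V unfolding X_def X'_def by (simp add: cov_vec_def cov_commute mean_add const prob_space.prob_space[OF prob_space_axioms])
    have cc: "cov M (\<lambda>\<omega>. X j \<omega> $ i) (\<lambda>\<omega>. X k \<omega> $ l) = cov M (\<lambda>\<omega>. X' j \<omega> $ i) (\<lambda>\<omega>. X' k \<omega> $ l)" for j k i l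
      unfolding X_def X'_def by (simp add: cov_add_const component_V)
    have XV: "(\<lambda>\<omega>. X j \<omega> $ i) \<in> V" "(\<lambda>\<omega>. X' j \<omega> $ i) \<in> V" for j i
      unfolding X_def X'_def by (auto intro!: component_V add const)
    have "(\<integral>\<^sup>+\<omega>. ennreal (exp (?T \<omega>)) * H' (\<lambda>j\<in>UNIV. X j \<omega>) \<partial>M) = (\<integral>\<^sup>+\<omega>. ennreal (exp ?c) * H' (\<lambda>j\<in>UNIV. X' j \<omega>) \<partial>M)"
      by (rule tilted_vector_laws_eq[OF _ pair_functional_V const XV _ m cc H']) (auto simp: prob_space.prob_space[OF prob_space_axioms])
    also have "\<dots> = ennreal (exp ?c) * (\<integral>\<^sup>+\<omega>. H' (\<lambda>j\<in>UNIV. X' j \<omega>) \<partial>M)"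
      unfolding H'_def X'_def by (rule nn_integral_cmult) simp
    finally show ?thesis by (simp add: H'_def X_def X'_def add.assoc)
  qed
  have "pair_integral t u (\<lambda>y z. ennreal (exp (a \<bullet> y + b \<bullet> z)) * H y z) =
      (\<integral>\<^sup>+x. \<integral>\<^sup>+\<omega>. ennreal (exp (?T \<omega>)) * H (x + \<xi> t \<omega>) (x + \<xi> u \<omega>) \<partial>M \<partial>\<Lambda>)"
    unfolding pair_integral_def
  proof (rule nn_integral_cong_AE)
    show "AE x in \<Lambda>. (\<integral>\<^sup>+\<omega>. ennreal (exp (a \<bullet> (x + \<xi> t \<omega>) + b \<bullet> (x + \<xi> u \<omega>))) * H (x + \<xi> t \<omega>) (x + \<xi> u \<omega>) \<partial>M) =
        (\<integral>\<^sup>+\<omega>. ennreal (exp (?T \<omega>)) * H (x + \<xi> t \<omega>) (x + \<xi> u \<omega>) \<partial>M)"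
      using AE_diagonal
    proof eventually_elim
      case (elim x)
      then have "x = coord_mean x *\<^sub>R vec 1" by (simp add: diagonal_iff vec_eq_iff)
      then have "(a + b) \<bullet> x = 0" using adm by (metis inner_scaleR_right mult_zero_right)
      then have "a \<bullet> (x + \<xi> t \<omega>) + b \<bullet> (x + \<xi> u \<omega>) = ?T \<omega>" for \<omega>
        by (simp add: pair_functional_def inner_add_left inner_add_right)
      then show ?case by simp
    qed
  qed
  also have "\<dots> = ennreal (exp ?c) * pair_integral t u (\<lambda>y z. H (y + ?k t) (z + ?k u))"
    unfolding one pair_integral_def by (rule nn_integral_cmult) measurable
  finally show ?thesis .
qed

text \<open>The tilted measures at the two pairs of times coincide. Each is a translate of the same pair
  intensity, by two different vectors.\<close>

lemma pair_integral_quasi_invariant: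
  fixes a b t u t' u'
  defines "T \<equiv> pair_functional a b t u" and "T' \<equiv> pair_functional a b t' u'"
  assumes same: "same_pair_intensity t u t' u'" and adm: "(a + b) \<bullet> vec 1 = 0"
    and H[measurable]: "case_prod H \<in> borel_measurable (borel \<Otimes>\<^sub>M borel)"
  shows "pair_integral t u H = ennreal (exp (integral\<^sup>L M T' + cov M T' T' / 2 - (integral\<^sup>L M T + cov M T T / 2))) *
    pair_integral t u (\<lambda>y z. H (y + (cov_vec T' t' - cov_vec T t)) (z + (cov_vec T' u' - cov_vec T u)))"
proof -
  let ?c = "integral\<^sup>L M T + cov M T T / 2" and ?c' = "integral\<^sup>L M T' + cov M T' T' / 2"
  define G where "G y z = H (y - cov_vec T t) (z - cov_vec T u)" for y z
  have [measurable]: "case_prod G \<in> borel_measurable (borel \<Otimes>\<^sub>M borel)" unfolding G_def by measurable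
  have Gm: "case_prod G \<in> borel_measurable (borel \<Otimes>\<^sub>M borel)" by measurable
  let ?E = "\<lambda>y z. ennreal (exp (a \<bullet> y + b \<bullet> z)) * G y z"
  have "pair_integral t u ?E = pair_integral t' u' ?E" using same unfolding same_pair_intensity_def by (auto simp: measurable_split_conv)
  moreover have "pair_integral t u ?E = ennreal (exp ?c) * pair_integral t u H"
    unfolding pair_integral_tilt[OF adm Gm] by (simp add: G_def T_def)
  moreover have "pair_integral t' u' ?E = ennreal (exp ?c') * pair_integral t' u' (\<lambda>y z. H (y + (cov_vec T' t' - cov_vec T t)) (z + (cov_vec T' u' - cov_vec T u)))"
    unfolding pair_integral_tilt[OF adm Gm] by (simp add: G_def T'_def algebra_simps)
  moreover have "pair_integral t' u' (\<lambda>y z. H (y + (cov_vec T' t' - cov_vec T t)) (z + (cov_vec T' u' - cov_vec T u))) = pair_integral t u (\<lambda>y z. H (y + (cov_vec T' t' - cov_vec T t)) (z + (cov_vec T' u' - cov_vec T u)))"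
    using same unfolding same_pair_intensity_def by (auto simp: measurable_split_conv)
  ultimately have "ennreal (exp ?c) * pair_integral t u H = ennreal (exp ?c') * pair_integral t u (\<lambda>y z. H (y + (cov_vec T' t' - cov_vec T t)) (z + (cov_vec T' u' - cov_vec T u)))"
    by simp
  then have "ennreal (exp (- ?c)) * (ennreal (exp ?c) * pair_integral t u H) = ennreal (exp (- ?c)) * (ennreal (exp ?c') * pair_integral t u (\<lambda>y z. H (y + (cov_vec T' t' - cov_vec T t)) (z + (cov_vec T' u' - cov_vec T u))))"
    by simp
  then show ?thesis
    by (simp add: mult.assoc[symmetric] ennreal_mult[symmetric] exp_add[symmetric] del: minus_add_distrib)
qed

text \<open>A test function with positive finite integral makes the constants in the quasi-invariance
  relations unique.\<close>

lemma pair_integral_normalizer: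
  obtains H where "case_prod H \<in> borel_measurable (borel \<Otimes>\<^sub>M borel)" "pair_integral t u H \<noteq> 0" "pair_integral t u H \<noteq> top"
proof -
  define B where "B n y z = (indicator (cball 0 (real n)) y :: ennreal)" for n and y z :: "real^'d"
  have [measurable]: "case_prod (B n) \<in> borel_measurable (borel \<Otimes>\<^sub>M borel)" for n
    unfolding B_def case_prod_beta'
    by (rule measurable_compose[OF measurable_fst borel_measurable_indicator[OF borel_closed[OF closed_cball]]])
  have fin: "pair_integral t u (B n) \<noteq> top" for n
    using displaced_ball_finite[of "real n" t] by (simp add: pair_integral_def B_def)
  have "\<exists>n. pair_integral t u (B n) \<noteq> 0"
  proof (rule ccontr)
    assume "\<not> ?thesis"
    then have "\<And>n. pair_integral t u (B n) = 0" by simp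
    then have "AE x in \<Lambda>. \<forall>n. (\<integral>\<^sup>+\<omega>. B n (x + \<xi> t \<omega>) (x + \<xi> u \<omega>) \<partial>M) = 0"
      unfolding AE_all_countable pair_integral_def by (subst (asm) nn_integral_0_iff_AE) auto
    then have "AE x in \<Lambda>. False"
    proof eventually_elim
      case (elim x)
      then have "AE \<omega> in M. \<forall>n. B n (x + \<xi> t \<omega>) (x + \<xi> u \<omega>) = 0"
        unfolding AE_all_countable by (subst (asm) nn_integral_0_iff_AE) auto
      then have "AE \<omega> in M. False"
      proof eventually_elim
        case (elim \<omega>)
        obtain n :: nat where "norm (x + \<xi> t \<omega>) \<le> real n" using real_arch_simple by blast
        then show ?case using elim[rule_format, of n] by (simp add: B_def)
      qed
      then show ?case by simp
    qed
    then have "emeasure \<Lambda> UNIV = 0"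
      by (subst (asm) AE_iff_measurable[where N=UNIV]) (auto simp: sets_eq_imp_space_eq[OF sets_Lambda])
    then show False using nonzero by simp
  qed
  then obtain n where "pair_integral t u (B n) \<noteq> 0" by blast
  then show thesis using fin by (intro that[of "B n"]) auto
qed

lemma exp_mult_pair_integral_cancel:
  assumes "pair_integral t u H \<noteq> 0" "pair_integral t u H \<noteq> top" "ennreal (exp p) * pair_integral t u H = ennreal (exp q) * pair_integral t u H"
  shows "p = q"
  using assms by (auto simp: mult.commute[of _ "pair_integral t u H"] ennreal_mult_cancel_left)

lemma pair_functional_scale: "pair_functional (r *\<^sub>R a) (r *\<^sub>R b) t u = (\<lambda>\<omega>. r * pair_functional a b t u \<omega>)"
  by (auto simp: pair_functional_def algebra_simps)

lemma cov_vec_scale: "cov_vec (\<lambda>\<omega>. r * X \<omega>) t = r *\<^sub>R cov_vec X t"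
  by (simp add: cov_vec_def vec_eq_iff cov_scale2)

text \<open>Apply the quasi-invariance to \<open>\<Theta>\<close> twice and to \<open>2 \<Theta>\<close> once. Both translate by the same vector, but
  the logarithms of the factors are \<open>2 p + 2 q\<close> and \<open>2 p + 4 q\<close>, where \<open>q\<close> is half the difference of
  the variances.\<close>

lemma variance_invariant:
  assumes same: "same_pair_intensity t u t' u'" and adm: "(a + b) \<bullet> vec 1 = 0"
  shows "cov M (pair_functional a b t u) (pair_functional a b t u) = cov M (pair_functional a b t' u') (pair_functional a b t' u')"
proof -
  let ?T = "pair_functional a b t u" and ?T' = "pair_functional a b t' u'"
  define p where "p = integral\<^sup>L M ?T' - integral\<^sup>L M ?T"
  define q where "q = (cov M ?T' ?T' - cov M ?T ?T) / 2"
  define c where "c = cov_vec ?T' t' - cov_vec ?T t"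
  define d where "d = cov_vec ?T' u' - cov_vec ?T u"
  obtain G where G[measurable]: "case_prod G \<in> borel_measurable (borel \<Otimes>\<^sub>M borel)" and J: "pair_integral t u G \<noteq> 0" "pair_integral t u G \<noteq> top"
    by (rule pair_integral_normalizer)
  have one: "pair_integral t u H = ennreal (exp (p + q)) * pair_integral t u (\<lambda>y z. H (y + c) (z + d))"
    if "case_prod H \<in> borel_measurable (borel \<Otimes>\<^sub>M borel)" for H
    using pair_integral_quasi_invariant[OF same adm that] by (simp add: p_def q_def c_def d_def diff_divide_distrib algebra_simps)
  have adm2: "(2 *\<^sub>R a + 2 *\<^sub>R b) \<bullet> vec 1 = 0" using adm by (simp flip: scaleR_add_right)
  have two: "pair_integral t u H = ennreal (exp (2 * p + 4 * q)) * pair_integral t u (\<lambda>y z. H (y + 2 *\<^sub>R c) (z + 2 *\<^sub>R d))"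
    if "case_prod H \<in> borel_measurable (borel \<Otimes>\<^sub>M borel)" for H
    using pair_integral_quasi_invariant[OF same adm2 that] unfolding pair_functional_scale cov_vec_scale mean_scale cov_scale cov_scale2
    by (simp add: p_def q_def c_def d_def diff_divide_distrib algebra_simps)
  \<comment> \<open>The translate of the normalizer that the shift by \<open>(2 c, 2 d)\<close> moves back.\<close>
  define H where "H y z = G (y - 2 *\<^sub>R c) (z - 2 *\<^sub>R d)" for y z
  have H[measurable]: "case_prod H \<in> borel_measurable (borel \<Otimes>\<^sub>M borel)" unfolding H_def by measurable
  have H1: "case_prod (\<lambda>y z. H (y + c) (z + d)) \<in> borel_measurable (borel \<Otimes>\<^sub>M borel)" by measurable
  have "pair_integral t u H = ennreal (exp (p + q)) * (ennreal (exp (p + q)) * pair_integral t u G)"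
    unfolding one[OF H] one[OF H1] by (simp add: H_def scaleR_2 algebra_simps)
  moreover have "pair_integral t u H = ennreal (exp (2 * p + 4 * q)) * pair_integral t u G"
    unfolding two[OF H] by (simp add: H_def)
  ultimately have "ennreal (exp (2 * p + 4 * q)) * pair_integral t u G = ennreal (exp (2 * p + 2 * q)) * pair_integral t u G"
    by (simp add: mult.assoc[symmetric] ennreal_mult[symmetric] exp_add[symmetric] algebra_simps)
  then have "2 * p + 4 * q = 2 * p + 2 * q" by (rule exp_mult_pair_integral_cancel[OF J])
  then show ?thesis by (simp add: q_def)
qed

lemma covariance_invariant:
  assumes same: "same_pair_intensity t u t' u'" and adm: "(a + b) \<bullet> vec 1 = 0" "(a' + b') \<bullet> vec 1 = 0"
  shows "cov M (pair_functional a' b' t u) (pair_functional a b t u) = cov M (pair_functional a' b' t' u') (pair_functional a b t' u')"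
proof -
  have s: "pair_functional (a' + a) (b' + b) t u = (\<lambda>\<omega>. pair_functional a' b' t u \<omega> + pair_functional a b t u \<omega>)" for t u
    by (auto simp: pair_functional_def inner_add_left)
  have "cov M (pair_functional (a' + a) (b' + b) t u) (pair_functional (a' + a) (b' + b) t u) =
      cov M (pair_functional a' b' t u) (pair_functional a' b' t u) + 2 * cov M (pair_functional a' b' t u) (pair_functional a b t u) + cov M (pair_functional a b t u) (pair_functional a b t u)" for t u
    unfolding s using pair_functional_V[of a' b' t u] pair_functional_V[of a b t u] by (simp add: cov_add cov_add2 add cov_commute[of M "pair_functional a b t u" "pair_functional a' b' t u"])
  moreover have "(a' + a + (b' + b)) \<bullet> vec 1 = 0" using adm by (simp add: inner_add_left)
  ultimately show ?thesis
    using variance_invariant[OF same, of "a' + a" "b' + b"] variance_invariant[OF same adm(1)] variance_invariant[OF same adm(2)] by simp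
qed

text \<open>By \<open>covariance_invariant\<close> the shift is orthogonal to the coefficient vectors of all admissible
  functionals, and the orthogonal complement of these is spanned by the diagonal shift.\<close>

lemma cov_vec_shift:
  fixes a b t u t' u'
  defines "T \<equiv> pair_functional a b t u" and "T' \<equiv> pair_functional a b t' u'"
  defines "\<tau> \<equiv> cov M (\<lambda>\<omega>. coord_mean (\<xi> t' \<omega>)) T' - cov M (\<lambda>\<omega>. coord_mean (\<xi> t \<omega>)) T"
  assumes same: "same_pair_intensity t u t' u'" and adm: "(a + b) \<bullet> vec 1 = 0"
  shows "cov_vec T' t' - cov_vec T t = vec \<tau>" "cov_vec T' u' - cov_vec T u = vec \<tau>"
proof -
  define c where "c = cov_vec T' t' - cov_vec T t"
  define d where "d = cov_vec T' u' - cov_vec T u"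
  have TV: "T \<in> V" "T' \<in> V" by (simp_all add: T_def T'_def pair_functional_V)
  have orth: "a' \<bullet> c + b' \<bullet> d = 0" if "(a' + b') \<bullet> vec 1 = 0" for a' b'
  proof -
    have "a' \<bullet> cov_vec S t + b' \<bullet> cov_vec S u = cov M (pair_functional a' b' t u) S" if "S \<in> V" for S t u
      unfolding inner_cov_vec[OF that] pair_functional_def by (rule cov_add[symmetric]) (auto intro: inner_V that)
    then have "a' \<bullet> cov_vec T' t' + b' \<bullet> cov_vec T' u' = cov M (pair_functional a' b' t' u') T'" "a' \<bullet> cov_vec T t + b' \<bullet> cov_vec T u = cov M (pair_functional a' b' t u) T"
      using TV by auto
    then show ?thesis
      using covariance_invariant[OF same adm that] by (simp add: c_def d_def T_def T'_def inner_diff_right)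
  qed
  have vtau: "vec (1 / real CARD('d)) \<bullet> c = \<tau>"
    unfolding c_def \<tau>_def by (simp add: inner_diff_right inner_cov_vec TV coord_mean_inner)
  have ax: "axis i 1 \<bullet> (vec 1 :: real^'d) = 1" for i by (simp add: inner_axis')
  have one: "vec (1 / real CARD('d)) \<bullet> (vec 1 :: real^'d) = 1" by (simp only: vec_inner_vec coord_mean_vec) simp
  have "c $ i = \<tau>" for i
    using orth[of "axis i 1 - vec (1 / real CARD('d))" 0] vtau one ax[of i] by (simp add: inner_diff_left inner_axis')
  then show "cov_vec T' t' - cov_vec T t = vec \<tau>" by (simp add: c_def[symmetric] vec_eq_iff)
  have "d $ i = \<tau>" for i
    using orth[of "- vec (1 / real CARD('d))" "axis i 1"] vtau one ax[of i] by (simp add: inner_diff_left inner_add_left inner_axis')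
  then show "cov_vec T' u' - cov_vec T u = vec \<tau>" by (simp add: d_def[symmetric] vec_eq_iff)
qed

lemma pair_integral_diagonal_shift:
  fixes a b t u t' u'
  defines "T \<equiv> pair_functional a b t u" and "T' \<equiv> pair_functional a b t' u'"
  defines "\<tau> \<equiv> cov M (\<lambda>\<omega>. coord_mean (\<xi> t' \<omega>)) T' - cov M (\<lambda>\<omega>. coord_mean (\<xi> t \<omega>)) T"
  assumes same: "same_pair_intensity t u t' u'" and adm: "(a + b) \<bullet> vec 1 = 0"
    and H: "case_prod H \<in> borel_measurable (borel \<Otimes>\<^sub>M borel)"
  shows "pair_integral t u H = ennreal (exp (integral\<^sup>L M T' - integral\<^sup>L M T)) * pair_integral t u (\<lambda>y z. H (y + vec \<tau>) (z + vec \<tau>))"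
  using pair_integral_quasi_invariant[OF same adm H] cov_vec_shift[OF same adm] variance_invariant[OF same adm]
  by (simp add: T_def T'_def \<tau>_def)

text \<open>The deconvolution applied to \<open>\<Lambda>\<close> and a multiple of its translate.\<close>

lemma translate_deconvolution:
  assumes C: "C > 0"
    and eq: "\<And>f. f \<in> borel_measurable borel \<Longrightarrow>
      (\<integral>\<^sup>+x. \<integral>\<^sup>+\<omega>. f (x + \<xi> t \<omega>) \<partial>M \<partial>\<Lambda>) = ennreal C * (\<integral>\<^sup>+x. \<integral>\<^sup>+\<omega>. f (x + vec w + \<xi> t \<omega>) \<partial>M \<partial>\<Lambda>)"
    and f: "f \<in> borel_measurable borel"
  shows "(\<integral>\<^sup>+x. f x \<partial>\<Lambda>) = ennreal C * (\<integral>\<^sup>+x. f (x + vec w) \<partial>\<Lambda>)"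
proof -
  define L where "L = scale_measure (ennreal C) (distr \<Lambda> borel (\<lambda>x. x + vec w))"
  have sL: "sets L = sets borel" by (simp add: L_def)
  have Lint: "(\<integral>\<^sup>+x. g x \<partial>L) = ennreal C * (\<integral>\<^sup>+x. g (x + vec w) \<partial>\<Lambda>)" if [measurable]: "g \<in> borel_measurable borel" for g
    unfolding L_def by (simp add: nn_integral_scale_measure nn_integral_distr)
  have emL: "emeasure L A = ennreal C * emeasure \<Lambda> ((\<lambda>x. x + vec w) -` A)" if "A \<in> sets borel" for A
    using that unfolding L_def by (simp add: emeasure_distr sets_eq_imp_space_eq[OF sets_Lambda])
  have "\<Lambda> = L"
  proof (rule diagonal_deconvolution[OF sets_Lambda sL off_diagonal _ ball_finite, of t])
    have "x + vec w \<in> diagonal \<longleftrightarrow> x \<in> diagonal" for x :: "real^'d"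
      by (simp add: diagonal_iff vec_eq_iff)
    then have "(\<lambda>x::real^'d. x + vec w) -` (- diagonal) = - diagonal" by auto
    then show "emeasure L (- diagonal) = 0" by (subst emL) (simp_all add: off_diagonal)
    show "emeasure L (cball 0 R) < \<infinity>" for R
    proof -
      have "(\<lambda>x::real^'d. x + vec w) -` cball 0 R \<subseteq> cball 0 (R + norm (vec w :: real^'d))"
      proof
        fix x :: "real^'d" assume "x \<in> (\<lambda>x. x + vec w) -` cball 0 R"
        then show "x \<in> cball 0 (R + norm (vec w :: real^'d))"
          using norm_triangle_ineq4[of "x + vec w" "vec w"] by simp
      qed
      then have "emeasure \<Lambda> ((\<lambda>x. x + vec w) -` cball 0 R) \<le> emeasure \<Lambda> (cball 0 (R + norm (vec w :: real^'d)))"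
        by (rule emeasure_mono) (simp add: sets_Lambda)
      also have "\<dots> < \<infinity>" by (rule ball_finite)
      finally show ?thesis by (simp add: emL ennreal_mult_less_top)
    qed
    show "(\<integral>\<^sup>+x. \<integral>\<^sup>+\<omega>. f (x + \<xi> t \<omega>) \<partial>M \<partial>\<Lambda>) = (\<integral>\<^sup>+x. \<integral>\<^sup>+\<omega>. f (x + \<xi> t \<omega>) \<partial>M \<partial>L)"
      if [measurable]: "f \<in> borel_measurable borel" for f
      unfolding eq[OF that] by (rule Lint[symmetric]) measurable
  qed (rule displaced_ball_finite)
  then show ?thesis using Lint[OF f] by simp
qed

lemma exponential_of_shift:
  fixes a b t u t' u'
  defines "T \<equiv> pair_functional a b t u" and "T' \<equiv> pair_functional a b t' u'"
  defines "\<tau> \<equiv> cov M (\<lambda>\<omega>. coord_mean (\<xi> t' \<omega>)) T' - cov M (\<lambda>\<omega>. coord_mean (\<xi> t \<omega>)) T"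
  assumes same: "same_pair_intensity t u t' u'" and adm: "(a + b) \<bullet> vec 1 = 0" and tau: "\<tau> \<noteq> 0"
  shows "\<exists>l. \<exists>c>0. \<Lambda> = scale_measure (ennreal c) (exp_diagonal l)"
proof -
  define p where "p = integral\<^sup>L M T' - integral\<^sup>L M T"
  have shift: "(\<integral>\<^sup>+x. f x \<partial>\<Lambda>) = ennreal (exp (r * p)) * (\<integral>\<^sup>+x. f (x + vec (r * \<tau>)) \<partial>\<Lambda>)"
    if f: "f \<in> borel_measurable borel" for f r
  proof (rule translate_deconvolution[where t=t, OF exp_gt_zero _ f])
    fix f :: "real^'d \<Rightarrow> ennreal" assume [measurable]: "f \<in> borel_measurable borel"
    have m: "case_prod (\<lambda>y z. f y) \<in> borel_measurable (borel \<Otimes>\<^sub>M borel)" by measurable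
    have adm': "(r *\<^sub>R a + r *\<^sub>R b) \<bullet> vec 1 = 0" using adm by (simp flip: scaleR_add_right)
    have "pair_integral t u (\<lambda>y z. f y) = ennreal (exp (r * p)) * pair_integral t u (\<lambda>y z. f (y + vec (r * \<tau>)))"
      using pair_integral_diagonal_shift[OF same adm' m] unfolding pair_functional_scale mean_scale cov_scale2
      by (simp add: T_def T'_def \<tau>_def p_def right_diff_distrib)
    then show "(\<integral>\<^sup>+x. \<integral>\<^sup>+\<omega>. f (x + \<xi> t \<omega>) \<partial>M \<partial>\<Lambda>) = ennreal (exp (r * p)) * (\<integral>\<^sup>+x. \<integral>\<^sup>+\<omega>. f (x + vec (r * \<tau>) + \<xi> t \<omega>) \<partial>M \<partial>\<Lambda>)"
      unfolding pair_integral_def by (simp add: add_ac)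
  qed
  have "\<exists>c>0. \<Lambda> = scale_measure (ennreal c) (exp_diagonal (- p / \<tau>))"
  proof (rule exp_diagonal_of_quasi_invariant[OF sets_Lambda off_diagonal ball_finite nonzero tau])
    fix n :: nat and f :: "real^'d \<Rightarrow> ennreal" assume "n \<ge> 1" and f: "f \<in> borel_measurable borel"
    have "- p / \<tau> * (\<tau> / real n) = - (1 / real n * p)" using tau by simp
    moreover have "(\<integral>\<^sup>+x. f (x + vec (\<tau> / real n)) \<partial>\<Lambda>) = ennreal (exp (- (1 / real n * p))) * (\<integral>\<^sup>+x. f x \<partial>\<Lambda>)"
      unfolding shift[OF f, of "1 / real n"]
      by (simp add: mult.assoc[symmetric] ennreal_mult[symmetric] exp_add[symmetric])
    ultimately show "(\<integral>\<^sup>+x. f (x + vec (\<tau> / real n)) \<partial>\<Lambda>) = ennreal (exp (- p / \<tau> * (\<tau> / real n))) * (\<integral>\<^sup>+x. f x \<partial>\<Lambda>)"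
      by (simp only:)
  qed
  then show ?thesis by blast
qed

text \<open>The diagonal shift by \<open>\<tau>\<close> multiplies the pair intensity by a constant in two ways, once by the
  quasi-invariance and once by the assumed behaviour of \<open>\<Lambda>\<close>. For \<open>\<tau> = 0\<close> any value of \<open>l\<close> may be used.\<close>

lemma tilted_mean_invariant:
  fixes a b t u t' u'
  defines "T \<equiv> pair_functional a b t u" and "T' \<equiv> pair_functional a b t' u'"
  assumes same: "same_pair_intensity t u t' u'" and adm: "(a + b) \<bullet> vec 1 = 0"
    and L: "\<And>w f. f \<in> borel_measurable borel \<Longrightarrow>
       w = cov M (\<lambda>\<omega>. coord_mean (\<xi> t' \<omega>)) T' - cov M (\<lambda>\<omega>. coord_mean (\<xi> t \<omega>)) T \<Longrightarrow>
       (\<integral>\<^sup>+x. f (x + vec w) \<partial>\<Lambda>) = ennreal (exp (l * w)) * (\<integral>\<^sup>+x. f x \<partial>\<Lambda>)"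
  shows "integral\<^sup>L M T + l * cov M (\<lambda>\<omega>. coord_mean (\<xi> t \<omega>)) T = integral\<^sup>L M T' + l * cov M (\<lambda>\<omega>. coord_mean (\<xi> t' \<omega>)) T'"
proof -
  define \<tau> where "\<tau> = cov M (\<lambda>\<omega>. coord_mean (\<xi> t' \<omega>)) T' - cov M (\<lambda>\<omega>. coord_mean (\<xi> t \<omega>)) T"
  define p where "p = integral\<^sup>L M T' - integral\<^sup>L M T"
  obtain H where H[measurable]: "case_prod H \<in> borel_measurable (borel \<Otimes>\<^sub>M borel)" and J: "pair_integral t u H \<noteq> 0" "pair_integral t u H \<noteq> top"
    by (rule pair_integral_normalizer)
  have "ennreal (exp 0) * pair_integral t u H = pair_integral t u H" by simp
  also have "\<dots> = ennreal (exp p) * pair_integral t u (\<lambda>y z. H (y + vec \<tau>) (z + vec \<tau>))"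
    using pair_integral_diagonal_shift[OF same adm H] by (simp add: T_def T'_def p_def \<tau>_def)
  also have "pair_integral t u (\<lambda>y z. H (y + vec \<tau>) (z + vec \<tau>)) = ennreal (exp (l * \<tau>)) * pair_integral t u H"
    unfolding pair_integral_def using L[of "\<lambda>x. \<integral>\<^sup>+\<omega>. H (x + \<xi> t \<omega>) (x + \<xi> u \<omega>) \<partial>M" \<tau>]
    by (simp add: \<tau>_def add_ac)
  also have "ennreal (exp p) * (ennreal (exp (l * \<tau>)) * pair_integral t u H) = ennreal (exp (p + l * \<tau>)) * pair_integral t u H"
    by (simp add: mult.assoc[symmetric] ennreal_mult[symmetric] exp_add[symmetric])
  finally have "0 = p + l * \<tau>" by (rule exp_mult_pair_integral_cancel[OF J])
  then show ?thesis by (simp add: p_def \<tau>_def algebra_simps)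
qed

end

section \<open>The starting measure is exponential\<close>

context gaussian_system begin

abbreviation "\<eta> t \<equiv> (\<lambda>\<omega>. coord_mean (\<xi> t \<omega>))"

definition stationary_pairs :: bool where
  "stationary_pairs \<longleftrightarrow> (\<forall>t u s. same_pair_intensity t u (t + s) (u + s))"

lemma pair_functional_left: "pair_functional v 0 t u = (\<lambda>\<omega>. v \<bullet> \<xi> t \<omega>)" and pair_functional_right: "pair_functional 0 v t u = (\<lambda>\<omega>. v \<bullet> \<xi> u \<omega>)"
  by (auto simp: pair_functional_def)

lemma pair_functional_increment: "pair_functional (- vec (1 / real CARD('d))) (vec (1 / real CARD('d))) t u = (\<lambda>\<omega>. \<eta> u \<omega> - \<eta> t \<omega>)"
  by (auto simp: pair_functional_def coord_mean_inner)

lemma inner_decompose: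
  "v \<bullet> x = (v - vec (v \<bullet> vec 1 / real CARD('d))) \<bullet> x + (v \<bullet> vec 1) * coord_mean (x :: real^'d)"
  by (simp add: inner_diff_left vec_inner_vec)

lemma decompose_admissible: "(v - vec (v \<bullet> vec 1 / real CARD('d))) \<bullet> (vec 1 :: real^'d) = 0"
proof -
  have "vec (v \<bullet> vec 1 / real CARD('d)) \<bullet> (vec 1 :: real^'d) = v \<bullet> (vec 1 :: real^'d)"
    by (simp only: vec_inner_vec coord_mean_vec) simp
  then show ?thesis by (simp add: inner_diff_left)
qed

text \<open>If no admissible functional produces a diagonal shift, then every covariance of \<open>\<eta>(t)\<close> with an
  admissible functional is invariant. For the increment \<open>\<eta>(u) - \<eta>(t)\<close>, which is admissible, this and
  the invariance of its variance make \<open>Var \<eta>(t) - Var \<eta>(0)\<close> additive. It is bounded below by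
  \<open>- Var \<eta>(0)\<close>, so it vanishes, and only a drift of the mean is left.\<close>

theorem exponential_of_stationary_pairs:
  assumes st: stationary_pairs and ns: "\<exists>v. \<not> stationary_process M (\<lambda>t \<omega>. v \<bullet> \<xi> t \<omega>)"
  shows "\<exists>l. \<exists>c>0. \<Lambda> = scale_measure (ennreal c) (exp_diagonal l)"
proof (cases "\<exists>a b t u s. (a + b) \<bullet> vec 1 = 0 \<and> cov M (\<eta> (t + s)) (pair_functional a b (t + s) (u + s)) - cov M (\<eta> t) (pair_functional a b t u) \<noteq> 0")
  case True
  then show ?thesis using exponential_of_shift st unfolding stationary_pairs_def by metis
next
  case False
  have same: "same_pair_intensity t u (t + s) (u + s)" for t u s using st by (simp add: stationary_pairs_def)
  have c_inv: "cov M (\<eta> (t + s)) (pair_functional a b (t + s) (u + s)) = cov M (\<eta> t) (pair_functional a b t u)" if "(a + b) \<bullet> vec 1 = 0" for a b t u s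
    using False that by auto
  have m_inv: "integral\<^sup>L M (pair_functional a b (t + s) (u + s)) = integral\<^sup>L M (pair_functional a b t u)" if "(a + b) \<bullet> vec 1 = 0" for a b t u s
    using tilted_mean_invariant[OF same that, of t s u 0] c_inv[OF that] by (simp add: vec_eq_iff flip: zero_vec_def)
  have inc: "(- vec (1 / real CARD('d)) + vec (1 / real CARD('d))) \<bullet> (vec 1 :: real^'d) = 0" by simp
  define R where "R t u = cov M (\<eta> t) (\<eta> u)" for t u
  define \<mu> where "\<mu> t = integral\<^sup>L M (\<eta> t)" for t
  note \<eta>V = coord_mean_V
  have R1: "R (t + s) (u + s) - R (t + s) (t + s) = R t u - R t t" for t u s
    using c_inv[OF inc, of t s u] unfolding pair_functional_increment R_def by (simp add: cov_diff2 \<eta>V)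
  have R2: "R (u + s) (u + s) - 2 * R (t + s) (u + s) + R (t + s) (t + s) = R u u - 2 * R t u + R t t" for t u s
    using covariance_invariant[OF same inc inc, of t u s] unfolding pair_functional_increment R_def
    by (simp add: cov_diff cov_diff2 diff \<eta>V cov_commute[of M "\<eta> (u + s)" "\<eta> (t + s)"] cov_commute[of M "\<eta> u" "\<eta> t"])
  have "R t t - R 0 0 = 0" for t
  proof (rule additive_bounded_below_zero[where h="\<lambda>t. R t t - R 0 0" and B="- R 0 0"])
    fix s t show "R (s + t) (s + t) - R 0 0 = (R s s - R 0 0) + (R t t - R 0 0)"
      using R1[of 0 t s] R2[of s t 0] by simp
  next
    fix t show "- R 0 0 \<le> R t t - R 0 0" using cov_self_nonneg[of "\<eta> t"] by (simp add: R_def)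
  qed
  then have "R (t + s) (t + s) = R t t" for t s by (metis eq_iff_diff_eq_0)
  then have R_inv: "R (t + s) (u + s) = R t u" for t u s using R1[of t s u] by simp
  have mu_inv: "\<mu> (u + s) - \<mu> (t + s) = \<mu> u - \<mu> t" for t u s
    using m_inv[OF inc, of t s u] unfolding pair_functional_increment \<mu>_def by (simp add: mean_diff \<eta>V)
  have wm: "integral\<^sup>L M (\<lambda>\<omega>. w \<bullet> \<xi> (t + s) \<omega>) = integral\<^sup>L M (\<lambda>\<omega>. w \<bullet> \<xi> t \<omega>)" if "w \<bullet> vec 1 = 0" for w t s
    using m_inv[of w 0 t s t] that unfolding pair_functional_left by simp
  have w\<eta>: "cov M (\<eta> (t + s)) (\<lambda>\<omega>. w \<bullet> \<xi> (u + s) \<omega>) = cov M (\<eta> t) (\<lambda>\<omega>. w \<bullet> \<xi> u \<omega>)" if "w \<bullet> vec 1 = 0" for w t u s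
    using c_inv[of 0 w t s u] that unfolding pair_functional_right by simp
  have ww: "cov M (\<lambda>\<omega>. w \<bullet> \<xi> (t + s) \<omega>) (\<lambda>\<omega>. w' \<bullet> \<xi> (u + s) \<omega>) = cov M (\<lambda>\<omega>. w \<bullet> \<xi> t \<omega>) (\<lambda>\<omega>. w' \<bullet> \<xi> u \<omega>)"
    if "w \<bullet> vec 1 = 0" "w' \<bullet> vec 1 = 0" for w w' t u s
    using covariance_invariant[OF same, of 0 w' w 0 t u s] that unfolding pair_functional_right pair_functional_left by simp
  \<comment> \<open>Every \<open>v \<bullet> \<xi>\<close> is the sum of an admissible functional and a multiple of \<open>\<eta>\<close>.\<close>
  define pr where "pr v = v - vec (v \<bullet> vec 1 / real CARD('d))" for v :: "real^'d"
  have pr0: "pr v \<bullet> vec 1 = 0" for v unfolding pr_def by (rule decompose_admissible)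
  have dec: "(\<lambda>\<omega>. v \<bullet> \<xi> t \<omega>) = (\<lambda>\<omega>. pr v \<bullet> \<xi> t \<omega> + (v \<bullet> vec 1) * \<eta> t \<omega>)" for v t
    unfolding pr_def by (rule ext) (rule inner_decompose)
  have vmean: "integral\<^sup>L M (\<lambda>\<omega>. v \<bullet> \<xi> (t + s) \<omega>) = integral\<^sup>L M (\<lambda>\<omega>. v \<bullet> \<xi> t \<omega>) + (v \<bullet> vec 1) * (\<mu> (t + s) - \<mu> t)" for v t s
    unfolding dec[of v] using wm[OF pr0, of v t s] by (simp add: mean_add inner_V scale \<eta>V \<mu>_def right_diff_distrib)
  have vcov: "cov M (\<lambda>\<omega>. v \<bullet> \<xi> (t + s) \<omega>) (\<lambda>\<omega>. v' \<bullet> \<xi> (u + s) \<omega>) = cov M (\<lambda>\<omega>. v \<bullet> \<xi> t \<omega>) (\<lambda>\<omega>. v' \<bullet> \<xi> u \<omega>)" for v v' t u s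
  proof -
    have "cov M (\<lambda>\<omega>. v \<bullet> \<xi> t \<omega>) (\<lambda>\<omega>. v' \<bullet> \<xi> u \<omega>) = cov M (\<lambda>\<omega>. pr v \<bullet> \<xi> t \<omega>) (\<lambda>\<omega>. pr v' \<bullet> \<xi> u \<omega>)
        + (v' \<bullet> vec 1) * cov M (\<eta> u) (\<lambda>\<omega>. pr v \<bullet> \<xi> t \<omega>) + (v \<bullet> vec 1) * cov M (\<eta> t) (\<lambda>\<omega>. pr v' \<bullet> \<xi> u \<omega>)
        + (v \<bullet> vec 1) * (v' \<bullet> vec 1) * R t u" for t u
      unfolding dec[of v] dec[of v'] R_def
      by (simp add: cov_add cov_add2 inner_V scale add \<eta>V cov_scale cov_scale2 cov_commute[of M "\<lambda>\<omega>. pr v \<bullet> \<xi> t \<omega>" "\<eta> u"] algebra_simps)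
    then show ?thesis by (simp only: ww[OF pr0 pr0] w\<eta>[OF pr0] R_inv)
  qed
  define \<beta> where "\<beta> t = \<mu> t - \<mu> 0" for t
  have beta_add: "\<beta> (s + t) = \<beta> s + \<beta> t" for s t
    using mu_inv[of t s 0] by (simp add: \<beta>_def add.commute)
  have mu_shift: "\<mu> (t + s) - \<mu> t = \<beta> s" for t s using beta_add[of t s] by (simp add: \<beta>_def)
  show ?thesis
  proof (cases "\<forall>s. \<beta> s = 0")
    case True
    have "stationary_process M (\<lambda>t \<omega>. v \<bullet> \<xi> t \<omega>)" for v
      unfolding stationary_process_def
    proof
      fix s
      show "process_law M (\<lambda>t \<omega>. v \<bullet> \<xi> (t + s) \<omega>) = process_law M (\<lambda>t \<omega>. v \<bullet> \<xi> t \<omega>)"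
        by (rule real_process_law_eqI) (auto intro: inner_V simp: vmean vcov mu_shift True)
    qed
    then show ?thesis using ns by blast
  next
    case False
    then obtain s0 where s0: "\<beta> s0 \<noteq> 0" by blast
    have beta_n: "\<beta> (s0 / real n) = \<beta> s0 / real n" if "n \<ge> 1" for n
    proof -
      have "\<beta> (real k * t) = real k * \<beta> t" for k t
        using beta_add[of 0 0] by (induction k) (auto simp: algebra_simps beta_add)
      from this[of n "s0 / real n"] that show ?thesis by (simp add: field_simps)
    qed
    have shift: "(\<integral>\<^sup>+x. f x \<partial>\<Lambda>) = ennreal 1 * (\<integral>\<^sup>+x. f (x + vec (\<beta> s)) \<partial>\<Lambda>)" if f: "f \<in> borel_measurable borel" for f s
    proof (rule translate_deconvolution[where t=0, OF zero_less_one _ f])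
      fix f :: "real^'d \<Rightarrow> ennreal" assume f[measurable]: "f \<in> borel_measurable borel"
      have m: "case_prod (\<lambda>y z. f y) \<in> borel_measurable (borel \<Otimes>\<^sub>M borel)" by measurable
      have "(\<integral>\<^sup>+x. \<integral>\<^sup>+\<omega>. f (x + \<xi> 0 \<omega>) \<partial>M \<partial>\<Lambda>) = (\<integral>\<^sup>+x. \<integral>\<^sup>+\<omega>. f (x + \<xi> s \<omega>) \<partial>M \<partial>\<Lambda>)"
        using same[of 0 0 s, unfolded same_pair_intensity_def pair_integral_def, rule_format, OF m] by simp
      also have "\<dots> = (\<integral>\<^sup>+x. \<integral>\<^sup>+\<omega>. f (x + vec (\<beta> s) + \<xi> 0 \<omega>) \<partial>M \<partial>\<Lambda>)"
      proof (rule nn_integral_cong)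
        fix x show "(\<integral>\<^sup>+\<omega>. f (x + \<xi> s \<omega>) \<partial>M) = (\<integral>\<^sup>+\<omega>. f (x + vec (\<beta> s) + \<xi> 0 \<omega>) \<partial>M)"
        proof -
        define H where "H g = f (x + g ())" for g :: "unit \<Rightarrow> real^'d"
        have H: "H \<in> borel_measurable (\<Pi>\<^sub>M j\<in>UNIV. borel)" unfolding H_def by measurable
        have cm: "(\<integral>\<omega>. \<xi> s \<omega> $ i \<partial>M) = (\<integral>\<omega>. (vec (\<beta> s) + \<xi> 0 \<omega>) $ i \<partial>M)" for i
          using vmean[of "axis i 1" 0 s] mu_shift[of 0 s]
          by (simp add: inner_axis' mean_add const component_V prob_space.prob_space[OF prob_space_axioms])
        have cc: "cov M (\<lambda>\<omega>. \<xi> s \<omega> $ i) (\<lambda>\<omega>. \<xi> s \<omega> $ k) = cov M (\<lambda>\<omega>. (vec (\<beta> s) + \<xi> 0 \<omega>) $ i) (\<lambda>\<omega>. (vec (\<beta> s) + \<xi> 0 \<omega>) $ k)" for i k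
          using vcov[of "axis i 1" 0 s "axis k 1" 0]
          by (simp add: inner_axis' cov_add cov_add2 add const component_V)
        have "(\<integral>\<^sup>+\<omega>. ennreal (exp 0) * H (\<lambda>j\<in>UNIV. \<xi> s \<omega>) \<partial>M) = (\<integral>\<^sup>+\<omega>. ennreal (exp 0) * H (\<lambda>j\<in>UNIV. vec (\<beta> s) + \<xi> 0 \<omega>) \<partial>M)"
          by (rule tilted_vector_laws_eq[where X="\<lambda>_. \<xi> s" and X'="\<lambda>_ \<omega>. vec (\<beta> s) + \<xi> 0 \<omega>", OF _ const const])
             (use H cm cc in \<open>auto intro!: component_V add const\<close>)
        then show ?thesis by (simp add: H_def add.assoc)
        qed
      qed
      finally show "(\<integral>\<^sup>+x. \<integral>\<^sup>+\<omega>. f (x + \<xi> 0 \<omega>) \<partial>M \<partial>\<Lambda>) = ennreal 1 * (\<integral>\<^sup>+x. \<integral>\<^sup>+\<omega>. f (x + vec (\<beta> s) + \<xi> 0 \<omega>) \<partial>M \<partial>\<Lambda>)"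
        by simp
    qed
    have "\<exists>c>0. \<Lambda> = scale_measure (ennreal c) (exp_diagonal 0)"
      by (rule exp_diagonal_of_quasi_invariant[OF sets_Lambda off_diagonal ball_finite nonzero s0])
         (use shift beta_n in \<open>metis ennreal_1 exp_zero mult_1 mult_zero_left\<close>)
    then show ?thesis by blast
  qed
qed

end

section \<open>Systems with an exponential starting measure\<close>

context gaussian_system begin

abbreviation "\<zeta> k t \<equiv> (\<lambda>\<omega>. perp_part (\<xi> t \<omega>) $ k)"

definition \<mu> :: "real \<Rightarrow> real" where "\<mu> t = integral\<^sup>L M (\<eta> t)"
definition m :: "'d \<Rightarrow> real \<Rightarrow> real" where "m k t = integral\<^sup>L M (\<zeta> k t)"
definition R :: "real \<Rightarrow> real \<Rightarrow> real" where "R t u = cov M (\<eta> t) (\<eta> u)"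
definition S :: "'d \<Rightarrow> real \<Rightarrow> real \<Rightarrow> real" where "S k t u = cov M (\<eta> t) (\<zeta> k u)"
definition Z :: "'d \<Rightarrow> 'd \<Rightarrow> real \<Rightarrow> real \<Rightarrow> real" where "Z i k t u = cov M (\<zeta> i t) (\<zeta> k u)"

lemma R_commute: "R t u = R u t" by (simp add: R_def cov_commute)

text \<open>In this order: mass of the weighted law, its means along and across the diagonal, and its
  covariances, where the increments of \<open>\<eta>\<close> are described by their variances.\<close>

definition moment_conditions :: "real \<Rightarrow> bool" where
  "moment_conditions l \<longleftrightarrow>
     (\<forall>t s. l * \<mu> (t + s) + l\<^sup>2 / 2 * R (t + s) (t + s) = l * \<mu> t + l\<^sup>2 / 2 * R t t) \<and>
     (\<forall>t u s. \<mu> (u + s) - \<mu> (t + s) + l * (R (t + s) (u + s) - R (t + s) (t + s)) = \<mu> u - \<mu> t + l * (R t u - R t t)) \<and>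
     (\<forall>k t u s. m k (u + s) + l * S k (t + s) (u + s) = m k u + l * S k t u) \<and>
     (\<forall>i k t u s. Z i k (t + s) (u + s) = Z i k t u) \<and>
     (\<forall>t u s. R (u + s) (u + s) - 2 * R (t + s) (u + s) + R (t + s) (t + s) = R u u - 2 * R t u + R t t) \<and>
     (\<forall>k t u s. S k (t + s) (t + s) - S k (u + s) (t + s) = S k t t - S k u t)"

text \<open>The substitution \<open>y = v + \<eta>(t 0)\<close> in the integral over the starting point \<open>vec v\<close> replaces the
  density \<open>exp (- l v)\<close> by \<open>exp (- l y) exp (l \<eta>(t 0))\<close>.\<close>

lemma intensity_exponential:
  assumes L: "\<Lambda> = scale_measure (ennreal a) (exp_diagonal l)" and a: "a > 0"
    and H[measurable]: "H \<in> borel_measurable (\<Pi>\<^sub>M j\<in>{..<n}. borel)"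
  shows "(\<integral>\<^sup>+z. H z \<partial>intensity \<Lambda> M \<xi> n t) = ennreal (a * sqrt (real CARD('d))) *
    (\<integral>\<^sup>+y. ennreal (exp (- (l * y))) *
       (\<integral>\<^sup>+\<omega>. ennreal (exp (l * \<eta> (t 0) \<omega>)) * H (\<lambda>j\<in>{..<n}. vec y + (\<xi> (t j) \<omega> - vec (\<eta> (t 0) \<omega>))) \<partial>M) \<partial>lborel)"
proof -
  interpret P: pair_sigma_finite M lborel ..
  have vv: "vec (x + y) = (vec x + vec y :: real^'d)" "vec (x - y) = (vec x - vec y :: real^'d)" for x y
    by (simp_all add: vec_eq_iff)
  have "(\<integral>\<^sup>+z. H z \<partial>intensity \<Lambda> M \<xi> n t) = (\<integral>\<^sup>+x. \<integral>\<^sup>+\<omega>. H (\<lambda>j\<in>{..<n}. x + \<xi> (t j) \<omega>) \<partial>M \<partial>\<Lambda>)"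
    by (rule nn_integral_intensity[OF prob_space_axioms measurable_xi sets_Lambda H])
  also have "\<dots> = ennreal (a * sqrt (real CARD('d))) *
      (\<integral>\<^sup>+v. ennreal (exp (- (l * v))) * (\<integral>\<^sup>+\<omega>. H (\<lambda>j\<in>{..<n}. vec v + \<xi> (t j) \<omega>) \<partial>M) \<partial>lborel)"
    unfolding L using a by (intro nn_integral_scale_exp_diagonal) auto
  also have "(\<integral>\<^sup>+v. ennreal (exp (- (l * v))) * (\<integral>\<^sup>+\<omega>. H (\<lambda>j\<in>{..<n}. vec v + \<xi> (t j) \<omega>) \<partial>M) \<partial>lborel) =
      (\<integral>\<^sup>+v. \<integral>\<^sup>+\<omega>. ennreal (exp (- (l * v))) * H (\<lambda>j\<in>{..<n}. vec v + \<xi> (t j) \<omega>) \<partial>M \<partial>lborel)"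
    by (intro nn_integral_cong nn_integral_cmult[symmetric]) measurable
  also have "\<dots> = (\<integral>\<^sup>+\<omega>. \<integral>\<^sup>+v. ennreal (exp (- (l * v))) * H (\<lambda>j\<in>{..<n}. vec v + \<xi> (t j) \<omega>) \<partial>lborel \<partial>M)"
    by (rule P.Fubini') measurable
  also have "\<dots> = (\<integral>\<^sup>+\<omega>. \<integral>\<^sup>+y. ennreal (exp (- (l * y))) * (ennreal (exp (l * \<eta> (t 0) \<omega>)) * H (\<lambda>j\<in>{..<n}. vec y + (\<xi> (t j) \<omega> - vec (\<eta> (t 0) \<omega>)))) \<partial>lborel \<partial>M)"
  proof (rule nn_integral_cong)
    fix \<omega>
    have "(\<integral>\<^sup>+v. ennreal (exp (- (l * v))) * H (\<lambda>j\<in>{..<n}. vec v + \<xi> (t j) \<omega>) \<partial>lborel) =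
        (\<integral>\<^sup>+y. ennreal (exp (- (l * (y - \<eta> (t 0) \<omega>)))) * H (\<lambda>j\<in>{..<n}. vec (y - \<eta> (t 0) \<omega>) + \<xi> (t j) \<omega>) \<partial>lborel)"
      by (subst nn_integral_real_affine[where c=1 and t="- \<eta> (t 0) \<omega>"]) auto
    also have "\<dots> = (\<integral>\<^sup>+y. ennreal (exp (- (l * y))) * (ennreal (exp (l * \<eta> (t 0) \<omega>)) * H (\<lambda>j\<in>{..<n}. vec y + (\<xi> (t j) \<omega> - vec (\<eta> (t 0) \<omega>)))) \<partial>lborel)"
    proof (rule nn_integral_cong)
      fix y
      have "ennreal (exp (- (l * (y - \<eta> (t 0) \<omega>)))) = ennreal (exp (- (l * y))) * ennreal (exp (l * \<eta> (t 0) \<omega>))"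
        by (simp add: algebra_simps flip: ennreal_mult exp_add)
      moreover have "(\<lambda>j\<in>{..<n}. vec (y - \<eta> (t 0) \<omega>) + \<xi> (t j) \<omega>) = (\<lambda>j\<in>{..<n}. vec y + (\<xi> (t j) \<omega> - vec (\<eta> (t 0) \<omega>)))"
        by (simp add: vv algebra_simps)
      ultimately show "ennreal (exp (- (l * (y - \<eta> (t 0) \<omega>)))) * H (\<lambda>j\<in>{..<n}. vec (y - \<eta> (t 0) \<omega>) + \<xi> (t j) \<omega>) =
         ennreal (exp (- (l * y))) * (ennreal (exp (l * \<eta> (t 0) \<omega>)) * H (\<lambda>j\<in>{..<n}. vec y + (\<xi> (t j) \<omega> - vec (\<eta> (t 0) \<omega>))))"
        by (simp only: mult.assoc)
    qed
    finally show "(\<integral>\<^sup>+v. ennreal (exp (- (l * v))) * H (\<lambda>j\<in>{..<n}. vec v + \<xi> (t j) \<omega>) \<partial>lborel) =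
       (\<integral>\<^sup>+y. ennreal (exp (- (l * y))) * (ennreal (exp (l * \<eta> (t 0) \<omega>)) * H (\<lambda>j\<in>{..<n}. vec y + (\<xi> (t j) \<omega> - vec (\<eta> (t 0) \<omega>)))) \<partial>lborel)" .
  qed
  also have "\<dots> = (\<integral>\<^sup>+y. \<integral>\<^sup>+\<omega>. ennreal (exp (- (l * y))) * (ennreal (exp (l * \<eta> (t 0) \<omega>)) * H (\<lambda>j\<in>{..<n}. vec y + (\<xi> (t j) \<omega> - vec (\<eta> (t 0) \<omega>)))) \<partial>M \<partial>lborel)"
    by (rule P.Fubini'[symmetric]) measurable
  also have "\<dots> = (\<integral>\<^sup>+y. ennreal (exp (- (l * y))) * (\<integral>\<^sup>+\<omega>. ennreal (exp (l * \<eta> (t 0) \<omega>)) * H (\<lambda>j\<in>{..<n}. vec y + (\<xi> (t j) \<omega> - vec (\<eta> (t 0) \<omega>))) \<partial>M) \<partial>lborel)"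
    by (intro nn_integral_cong nn_integral_cmult) measurable
  finally show ?thesis .
qed

text \<open>The differences \<open>\<xi>(t j) - \<eta>(t 0)\<close> have the coordinates \<open>\<zeta>(t j) + (\<eta>(t j) - \<eta>(t 0))\<close>, whose
  weighted moments are combinations of the invariant quantities. The covariances of two increments
  come from their variances by polarisation.\<close>

lemma intensity_eq_of_moment_conditions:
  assumes L: "\<Lambda> = scale_measure (ennreal a) (exp_diagonal l)" and a: "a > 0"
    and mc: "moment_conditions l" and n: "n \<ge> 1"
  shows "intensity \<Lambda> M \<xi> n t = intensity \<Lambda> M \<xi> n (\<lambda>j. t j + s)"
proof (rule measure_eqI_nn_integral)
  note A = mc[unfolded moment_conditions_def, THEN conjunct1, rule_format]
    and B1 = mc[unfolded moment_conditions_def, THEN conjunct2, THEN conjunct1, rule_format]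
    and B2 = mc[unfolded moment_conditions_def, THEN conjunct2, THEN conjunct2, THEN conjunct1, rule_format]
    and C1 = mc[unfolded moment_conditions_def, THEN conjunct2, THEN conjunct2, THEN conjunct2, THEN conjunct1, rule_format]
    and C2 = mc[unfolded moment_conditions_def, THEN conjunct2, THEN conjunct2, THEN conjunct2, THEN conjunct2, THEN conjunct1, rule_format]
    and C3 = mc[unfolded moment_conditions_def, THEN conjunct2, THEN conjunct2, THEN conjunct2, THEN conjunct2, THEN conjunct2, rule_format]
  fix H :: "(nat \<Rightarrow> real^'d) \<Rightarrow> ennreal" assume "H \<in> borel_measurable (intensity \<Lambda> M \<xi> n t)"
  then have H[measurable]: "H \<in> borel_measurable (\<Pi>\<^sub>M j\<in>{..<n}. borel)"
    by (simp add: measurable_cong_sets[OF sets_intensity refl])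
  define X where "X t j \<omega> = \<xi> (t j) \<omega> - vec (\<eta> (t 0) \<omega>)" for t :: "nat \<Rightarrow> real" and j \<omega>
  have Xi: "(\<lambda>\<omega>. X t j \<omega> $ i) = (\<lambda>\<omega>. \<zeta> i (t j) \<omega> + (\<eta> (t j) \<omega> - \<eta> (t 0) \<omega>))" for t j i
    by (auto simp: X_def perp_part_inner)
  have DV: "(\<lambda>\<omega>. \<eta> u \<omega> - \<eta> v \<omega>) \<in> V" for u v by (intro diff coord_mean_V)
  have XV: "(\<lambda>\<omega>. X t j \<omega> $ i) \<in> V" for t j i
    unfolding Xi by (intro add perp_V DV)
  have mX: "(\<integral>\<omega>. X t j \<omega> $ i \<partial>M) = m i (t j) + (\<mu> (t j) - \<mu> (t 0))" for t j i
    unfolding Xi by (simp add: mean_add mean_diff perp_V DV coord_mean_V m_def \<mu>_def)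
  have cX: "cov M (\<lambda>\<omega>. l * \<eta> (t 0) \<omega>) (\<lambda>\<omega>. X t j \<omega> $ i) = l * (S i (t 0) (t j) + (R (t 0) (t j) - R (t 0) (t 0)))" for t j i
    unfolding Xi by (simp add: cov_scale cov_add2 cov_diff2 perp_V DV coord_mean_V S_def R_def)
  have DD: "cov M (\<lambda>\<omega>. \<eta> u \<omega> - \<eta> v \<omega>) (\<lambda>\<omega>. \<eta> w \<omega> - \<eta> v \<omega>) = R u w - R u v - R v w + R v v" for u v w
    by (simp add: cov_diff cov_diff2 DV coord_mean_V R_def)
  have DZ: "cov M (\<lambda>\<omega>. \<eta> u \<omega> - \<eta> v \<omega>) (\<zeta> i w) = (S i w w - S i v w) - (S i w w - S i u w)" for u v w i
    by (simp add: cov_diff perp_V coord_mean_V S_def)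
  have cXX: "cov M (\<lambda>\<omega>. X t j \<omega> $ i) (\<lambda>\<omega>. X t k \<omega> $ q) = Z i q (t j) (t k)
      + ((S i (t j) (t j) - S i (t 0) (t j)) - (S i (t j) (t j) - S i (t k) (t j)))
      + ((S q (t k) (t k) - S q (t 0) (t k)) - (S q (t k) (t k) - S q (t j) (t k)))
      + ((R (t j) (t j) - 2 * R (t 0) (t j) + R (t 0) (t 0)) + (R (t k) (t k) - 2 * R (t 0) (t k) + R (t 0) (t 0))
         - (R (t k) (t k) - 2 * R (t j) (t k) + R (t j) (t j))) / 2" for t j i k q
  proof -
    let ?D = "\<lambda>j \<omega>. \<eta> (t j) \<omega> - \<eta> (t 0) \<omega>"
    have "cov M (\<lambda>\<omega>. X t j \<omega> $ i) (\<lambda>\<omega>. X t k \<omega> $ q) =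
        cov M (\<zeta> i (t j)) (\<zeta> q (t k)) + cov M (?D k) (\<zeta> i (t j)) + cov M (?D j) (\<zeta> q (t k)) + cov M (?D j) (?D k)"
      unfolding Xi by (simp add: cov_add cov_add2 add perp_V DV cov_commute[of M "\<zeta> i (t j)" "?D k"])
    then show ?thesis unfolding DD DZ
      by (simp add: Z_def R_commute[of "t j" "t 0"] field_simps)
  qed
  let ?t' = "\<lambda>j. t j + s"
  have key: "(\<integral>\<^sup>+\<omega>. ennreal (exp (l * \<eta> (t 0) \<omega>)) * H (\<lambda>j\<in>{..<n}. vec y + X t j \<omega>) \<partial>M) =
      (\<integral>\<^sup>+\<omega>. ennreal (exp (l * \<eta> (?t' 0) \<omega>)) * H (\<lambda>j\<in>{..<n}. vec y + X ?t' j \<omega>) \<partial>M)" for y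
  proof -
    define H' where "H' g = H (\<lambda>j\<in>{..<n}. vec y + g j)" for g :: "nat \<Rightarrow> real^'d"
    have H': "H' \<in> borel_measurable (\<Pi>\<^sub>M j\<in>{..<n}. borel)" unfolding H'_def by measurable
    have "(\<integral>\<^sup>+\<omega>. ennreal (exp (l * \<eta> (t 0) \<omega>)) * H' (\<lambda>j\<in>{..<n}. X t j \<omega>) \<partial>M) =
        (\<integral>\<^sup>+\<omega>. ennreal (exp (l * \<eta> (?t' 0) \<omega>)) * H' (\<lambda>j\<in>{..<n}. X ?t' j \<omega>) \<partial>M)"
    proof (rule tilted_vector_laws_eq[OF _ scale[OF coord_mean_V] scale[OF coord_mean_V] XV XV _ _ _ H'])
      show "integral\<^sup>L M (\<lambda>\<omega>. l * \<eta> (t 0) \<omega>) + cov M (\<lambda>\<omega>. l * \<eta> (t 0) \<omega>) (\<lambda>\<omega>. l * \<eta> (t 0) \<omega>) / 2 =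
          integral\<^sup>L M (\<lambda>\<omega>. l * \<eta> (?t' 0) \<omega>) + cov M (\<lambda>\<omega>. l * \<eta> (?t' 0) \<omega>) (\<lambda>\<omega>. l * \<eta> (?t' 0) \<omega>) / 2"
        using A[of "t 0" s] by (simp add: cov_scale cov_scale2 \<mu>_def[symmetric] R_def[symmetric] power2_eq_square algebra_simps)
      show "(\<integral>\<omega>. X t j \<omega> $ i \<partial>M) + cov M (\<lambda>\<omega>. l * \<eta> (t 0) \<omega>) (\<lambda>\<omega>. X t j \<omega> $ i) =
          (\<integral>\<omega>. X ?t' j \<omega> $ i \<partial>M) + cov M (\<lambda>\<omega>. l * \<eta> (?t' 0) \<omega>) (\<lambda>\<omega>. X ?t' j \<omega> $ i)" for j i
        using B1[of "t j" s "t 0"] B2[of i "t j" s "t 0"] cX[of t j i] mX[of t j i] cX[of ?t' j i] mX[of ?t' j i]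
        by (simp add: algebra_simps)
      show "cov M (\<lambda>\<omega>. X t j \<omega> $ i) (\<lambda>\<omega>. X t k \<omega> $ q) = cov M (\<lambda>\<omega>. X ?t' j \<omega> $ i) (\<lambda>\<omega>. X ?t' k \<omega> $ q)" for j i k q
        unfolding cXX by (simp only: C1 C2 C3)
    qed simp
    moreover have "H' (\<lambda>j\<in>{..<n}. g j) = H (\<lambda>j\<in>{..<n}. vec y + g j)" for g
      unfolding H'_def by (intro arg_cong[where f=H]) auto
    ultimately show ?thesis by simp
  qed
  show "(\<integral>\<^sup>+z. H z \<partial>intensity \<Lambda> M \<xi> n t) = (\<integral>\<^sup>+z. H z \<partial>intensity \<Lambda> M \<xi> n ?t')"
    unfolding intensity_exponential[OF L a H] using key unfolding X_def by simp
qed simp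

lemma pair_integral_eq_intensity:
  assumes [measurable]: "case_prod H \<in> borel_measurable (borel \<Otimes>\<^sub>M borel)"
  shows "pair_integral t u H = (\<integral>\<^sup>+z. H (z 0) (z 1) \<partial>intensity \<Lambda> M \<xi> 2 (\<lambda>j. if j = 0 then t else u))"
proof -
  have m: "(\<lambda>z. H (z 0) (z 1)) \<in> borel_measurable (\<Pi>\<^sub>M j\<in>{..<2::nat}. borel)"
  proof -
    have "(\<lambda>z. z 0) \<in> measurable (\<Pi>\<^sub>M j\<in>{..<2::nat}. (borel :: (real^'d) measure)) borel" "(\<lambda>z. z 1) \<in> measurable (\<Pi>\<^sub>M j\<in>{..<2::nat}. (borel :: (real^'d) measure)) borel"
      by (intro measurable_component_singleton; simp)+
    from measurable_compose[OF measurable_Pair[OF this], of "case_prod H" borel] show ?thesis by simp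
  qed
  show ?thesis
    unfolding nn_integral_intensity[OF prob_space_axioms measurable_xi sets_Lambda m] by (simp add: pair_integral_def)
qed

lemma stationary_pairs_of_intensity:
  assumes "\<forall>n\<ge>1. \<forall>s t. intensity \<Lambda> M \<xi> n t = intensity \<Lambda> M \<xi> n (\<lambda>j. t j + s)"
  shows stationary_pairs
  unfolding stationary_pairs_def same_pair_intensity_def
proof (intro allI impI)
  fix t u s :: real and H :: "real^'d \<Rightarrow> real^'d \<Rightarrow> ennreal" assume H: "case_prod H \<in> borel_measurable (borel \<Otimes>\<^sub>M (borel :: (real^'d) measure))"
  have "(\<lambda>j::nat. (if j = 0 then t else u) + s) = (\<lambda>j. if j = 0 then t + s else u + s)" by auto
  then show "pair_integral t u H = pair_integral (t + s) (u + s) H"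
    unfolding pair_integral_eq_intensity[OF H] using assms[rule_format, of 2 "\<lambda>j. if j = 0 then t else u" s] by simp
qed

text \<open>All conditions except the first come from the quasi-invariance, applied to the functionals \<open>\<zeta> k\<close>
  and \<open>\<eta>(u) - \<eta>(t)\<close>. The mass is read off the intensity of the set of points whose coordinate mean
  lies in \<open>[0, 1]\<close>.\<close>

lemma moment_conditions_of_intensity:
  assumes L: "\<Lambda> = scale_measure (ennreal a) (exp_diagonal l)" and a: "a > 0"
    and st: "\<forall>n\<ge>1. \<forall>s t. intensity \<Lambda> M \<xi> n t = intensity \<Lambda> M \<xi> n (\<lambda>j. t j + s)"
  shows "moment_conditions l"
proof -
  have same: "same_pair_intensity t u (t + s) (u + s)" for t u s
    using stationary_pairs_of_intensity[OF st] by (simp add: stationary_pairs_def)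
  have shift: "(\<integral>\<^sup>+x. f (x + vec w) \<partial>\<Lambda>) = ennreal (exp (l * w)) * (\<integral>\<^sup>+x. f x \<partial>\<Lambda>)" if "f \<in> borel_measurable borel" for f w
    unfolding L using a that by (intro exp_diagonal_shift) auto
  have tm: "integral\<^sup>L M (pair_functional c b t u) + l * cov M (\<eta> t) (pair_functional c b t u) =
      integral\<^sup>L M (pair_functional c b (t + s) (u + s)) + l * cov M (\<eta> (t + s)) (pair_functional c b (t + s) (u + s))"
    if "(c + b) \<bullet> vec 1 = 0" for c b t u s
    by (rule tilted_mean_invariant[OF same that]) (rule shift)
  note cv = covariance_invariant[OF same]
  define e where "e k = (axis k 1 - vec (1 / real CARD('d)) :: real^'d)" for k
  have e: "e k \<bullet> vec 1 = 0" for k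
  proof -
    have "vec (1 / real CARD('d)) \<bullet> (vec 1 :: real^'d) = 1" by (simp only: vec_inner_vec coord_mean_vec) simp
    then show ?thesis by (simp add: e_def inner_diff_left inner_axis')
  qed
  have Z1: "pair_functional (e k) 0 t u = \<zeta> k t" and Z2: "pair_functional 0 (e k) t u = \<zeta> k u" for k t u
    by (simp_all add: pair_functional_left pair_functional_right e_def perp_inner_eq)
  have inc: "(- vec (1 / real CARD('d)) + vec (1 / real CARD('d))) \<bullet> (vec 1 :: real^'d) = 0" by simp
  have A: "l * \<mu> (t + s) + l\<^sup>2 / 2 * R (t + s) (t + s) = l * \<mu> t + l\<^sup>2 / 2 * R t t" for t s
  proof -
    define H where "H z = (indicator {0..1} (coord_mean (z 0)) :: ennreal)" for z :: "nat \<Rightarrow> real^'d"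
    have H: "H \<in> borel_measurable (\<Pi>\<^sub>M j\<in>{..<1}. borel)"
    proof -
      have "(\<lambda>z. z 0) \<in> measurable (\<Pi>\<^sub>M j\<in>{..<1::nat}. (borel :: (real^'d) measure)) borel"
        by (intro measurable_component_singleton) simp
      from measurable_compose[OF this, of "\<lambda>y. indicator {0..1} (coord_mean y) :: ennreal" borel] show ?thesis
        unfolding H_def by simp
    qed
    define c where "c = (\<integral>\<^sup>+y. ennreal (exp (- (l * y))) * indicator {0..1} y \<partial>lborel)"
    have cH: "coord_mean (\<xi> t \<omega> - vec (\<eta> t \<omega>)) = 0" for t \<omega>
      using coord_mean_add[of "\<xi> t \<omega> - vec (\<eta> t \<omega>)" "vec (\<eta> t \<omega>)"] by simp
    have "(\<integral>\<^sup>+z. H z \<partial>intensity \<Lambda> M \<xi> 1 (\<lambda>_. t)) = ennreal (a * sqrt (real CARD('d))) * (c * ennreal (exp (l * \<mu> t + l\<^sup>2 / 2 * R t t)))" for t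
    proof -
      have "(\<integral>\<^sup>+z. H z \<partial>intensity \<Lambda> M \<xi> 1 (\<lambda>_. t)) = ennreal (a * sqrt (real CARD('d))) *
        (\<integral>\<^sup>+y. ennreal (exp (- (l * y))) * (\<integral>\<^sup>+\<omega>. ennreal (exp (l * \<eta> t \<omega>)) * indicator {0..1} y \<partial>M) \<partial>lborel)"
        unfolding intensity_exponential[OF L a H] by (simp add: H_def cH)
      also have "(\<lambda>y. ennreal (exp (- (l * y))) * (\<integral>\<^sup>+\<omega>. ennreal (exp (l * \<eta> t \<omega>)) * indicator {0..1} y \<partial>M)) =
        (\<lambda>y. (ennreal (exp (- (l * y))) * indicator {0..1} y) * ennreal (exp (l * \<mu> t + l\<^sup>2 / 2 * R t t)))"
      proof
        fix y :: real
        have "(\<integral>\<^sup>+\<omega>. ennreal (exp (l * \<eta> t \<omega>)) * indicator {0..1} y \<partial>M) = (\<integral>\<^sup>+\<omega>. ennreal (exp (l * \<eta> t \<omega>)) \<partial>M) * indicator {0..1} y"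
          by (rule nn_integral_multc) measurable
        also have "(\<integral>\<^sup>+\<omega>. ennreal (exp (l * \<eta> t \<omega>)) \<partial>M) = ennreal (exp (l * \<mu> t + l\<^sup>2 / 2 * R t t))"
          using mgf[OF scale[OF coord_mean_V, of l t]] by (simp add: cov_scale cov_scale2 \<mu>_def R_def power2_eq_square mult.assoc)
        finally show "ennreal (exp (- (l * y))) * (\<integral>\<^sup>+\<omega>. ennreal (exp (l * \<eta> t \<omega>)) * indicator {0..1} y \<partial>M) =
          (ennreal (exp (- (l * y))) * indicator {0..1} y) * ennreal (exp (l * \<mu> t + l\<^sup>2 / 2 * R t t))"
          by (simp only: mult_ac)
      qed
      also have "(\<integral>\<^sup>+y. (ennreal (exp (- (l * y))) * indicator {0..1} y) * ennreal (exp (l * \<mu> t + l\<^sup>2 / 2 * R t t)) \<partial>lborel) = c * ennreal (exp (l * \<mu> t + l\<^sup>2 / 2 * R t t))"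
        unfolding c_def by (rule nn_integral_multc) measurable
      finally show ?thesis .
    qed
    from this[of t] this[of "t + s"] st[rule_format, of 1 "\<lambda>_. t" s]
    have eq: "ennreal (a * sqrt (real CARD('d))) * (c * ennreal (exp (l * \<mu> t + l\<^sup>2 / 2 * R t t))) =
        ennreal (a * sqrt (real CARD('d))) * (c * ennreal (exp (l * \<mu> (t + s) + l\<^sup>2 / 2 * R (t + s) (t + s))))" by simp
    have c0: "c \<noteq> 0"
    proof
      assume "c = 0"
      then have "AE y in lborel. ennreal (exp (- (l * y))) * indicator {0..1} y = 0"
        unfolding c_def by (subst (asm) nn_integral_0_iff_AE) auto
      from AE_lborel_dense[OF this zero_less_one] show False by (auto simp: indicator_def)
    qed
    have "c \<le> (\<integral>\<^sup>+y. ennreal (exp \<bar>l\<bar>) * indicator {0..1::real} y \<partial>lborel)"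
      unfolding c_def
    proof (rule nn_integral_mono)
      fix y :: real
      have "- (l * y) \<le> \<bar>l\<bar>" if "0 \<le> y" "y \<le> 1"
      proof -
        have "- (l * y) \<le> \<bar>l\<bar> * \<bar>y\<bar>" by (metis abs_ge_minus_self abs_mult)
        also have "\<dots> \<le> \<bar>l\<bar> * 1" using that by (intro mult_left_mono) auto
        finally show ?thesis by simp
      qed
      then show "ennreal (exp (- (l * y))) * indicator {0..1} y \<le> ennreal (exp \<bar>l\<bar>) * indicator {0..1} y"
        by (auto simp: indicator_def ennreal_leI)
    qed
    also have "\<dots> = ennreal (exp \<bar>l\<bar>)" by (simp add: nn_integral_cmult_indicator)
    finally have "c \<noteq> top" by (auto simp: top_unique)
    then show ?thesis using eq c0 a by (simp add: ennreal_mult_cancel_left)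
  qed
  show ?thesis
    unfolding moment_conditions_def
  proof (intro conjI allI A)
    show "\<mu> (u + s) - \<mu> (t + s) + l * (R (t + s) (u + s) - R (t + s) (t + s)) = \<mu> u - \<mu> t + l * (R t u - R t t)" for t u s
      using tm[OF inc, of t u s] unfolding pair_functional_increment by (simp add: mean_diff cov_diff2 coord_mean_V \<mu>_def R_def)
    show "m k (u + s) + l * S k (t + s) (u + s) = m k u + l * S k t u" for k t u s
      using tm[of 0 "e k" t u s] e unfolding Z2 by (simp add: m_def S_def)
    show "Z i k (t + s) (u + s) = Z i k t u" for i k t u s
      using cv[of 0 "e k" "e i" 0 t u s] e unfolding Z1 Z2 by (simp add: Z_def)
    show "R (u + s) (u + s) - 2 * R (t + s) (u + s) + R (t + s) (t + s) = R u u - 2 * R t u + R t t" for t u s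
      using cv[OF inc inc, of t u s] unfolding pair_functional_increment R_def
      by (simp add: cov_diff cov_diff2 diff coord_mean_V cov_commute[of M "\<eta> (u + s)" "\<eta> (t + s)"] cov_commute[of M "\<eta> u" "\<eta> t"])
    show "S k (t + s) (t + s) - S k (u + s) (t + s) = S k t t - S k u t" for k t u s
      using cv[OF _ inc, of "e k" 0 t u s] e unfolding Z1 pair_functional_increment S_def
      by (simp add: cov_diff coord_mean_V perp_V)
  qed
qed

end

section \<open>Reading off the moment conditions\<close>

lemma process_law_nn_integral:
  fixes X :: "real \<Rightarrow> 'a \<Rightarrow> 'b::topological_space"
  assumes X: "\<And>t. X t \<in> borel_measurable M" and f[measurable]: "f \<in> borel_measurable (\<Pi>\<^sub>M t\<in>UNIV. borel)"
  shows "(\<integral>y. f y \<partial>process_law M X) = (\<integral>\<omega>. f (\<lambda>t. X t \<omega>) \<partial>M :: real)"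
  unfolding process_law_def
  by (rule integral_distr[OF _ f]) (rule measurable_PiM_single', use X in auto)

context gaussian_system begin

lemma mean_vector:
  fixes X :: "'a \<Rightarrow> real^'d"
  assumes "\<And>i. (\<lambda>\<omega>. X \<omega> $ i) \<in> V"
  shows "(\<integral>\<omega>. X \<omega> \<partial>M) $ i = (\<integral>\<omega>. X \<omega> $ i \<partial>M)"
proof -
  have "X = (\<lambda>\<omega>. \<Sum>j\<in>UNIV. (X \<omega> $ j) *\<^sub>R axis j 1)"
    by (simp add: fun_eq_iff vec_eq_iff axis_def if_distrib cong: if_cong)
  moreover have "integrable M (\<lambda>\<omega>. \<Sum>j\<in>UNIV. (X \<omega> $ j) *\<^sub>R (axis j 1 :: real^'d))"
    by (intro Bochner_Integration.integrable_sum integrable_scaleR_left integrable assms)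
  ultimately have "integrable M X" by simp
  then have "(\<integral>\<omega>. X \<omega> \<bullet> axis i 1 \<partial>M) = (\<integral>\<omega>. X \<omega> \<partial>M) \<bullet> axis i 1" by (rule integral_inner_left)
  then show ?thesis by (simp add: inner_axis)
qed

lemma mean_perp: "(\<integral>\<omega>. perp_part (\<xi> t \<omega>) \<partial>M) $ k = m k t"
  unfolding m_def by (rule mean_vector) (rule perp_V)

lemma cross_covariance_eq:
  "cross_covariance M (\<lambda>\<omega>. diag_part (\<xi> t \<omega>)) (\<lambda>\<omega>. perp_part (\<xi> u \<omega>)) $ i $ k = S k t u"
proof -
  have d: "(\<lambda>\<omega>. diag_part (\<xi> t \<omega>) $ j) = \<eta> t" for j by (simp add: diag_part_def)
  have "(\<integral>\<omega>. diag_part (\<xi> t \<omega>) \<partial>M) $ i = integral\<^sup>L M (\<eta> t)"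
    using mean_vector[of "\<lambda>\<omega>. diag_part (\<xi> t \<omega>)" i] unfolding d by (simp add: coord_mean_V)
  then show ?thesis
    unfolding cross_covariance_def S_def cov_def by (simp add: mean_perp m_def[symmetric] fun_cong[OF d])
qed

lemma condition_iv:
  fixes t u s :: real
  defines "mv \<equiv> (\<lambda>t. \<integral>\<omega>. perp_part (\<xi> t \<omega>) \<partial>M)"
    and "C \<equiv> (\<lambda>t1 t2. cross_covariance M (\<lambda>\<omega>. diag_part (\<xi> t1 \<omega>)) (\<lambda>\<omega>. perp_part (\<xi> t2 \<omega>)))"
  shows "mv u + transpose (C t u) *v diag_vec l = mv (u + s) + transpose (C (t + s) (u + s)) *v diag_vec l \<longleftrightarrow>
    (\<forall>k. m k u + l * S k t u = m k (u + s) + l * S k (t + s) (u + s))"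
proof -
  have "(transpose (C t u) *v diag_vec l) $ k = l * S k t u" for t u k
    unfolding C_def matrix_vector_mult_def transpose_def diag_vec_def
    by (simp add: cross_covariance_eq)
  then show ?thesis by (simp add: vec_eq_iff mv_def mean_perp)
qed

lemma condition_iii:
  fixes t u s :: real
  defines "C \<equiv> (\<lambda>t1 t2. cross_covariance M (\<lambda>\<omega>. diag_part (\<xi> t1 \<omega>)) (\<lambda>\<omega>. perp_part (\<xi> t2 \<omega>)))"
  shows "C t t - C u t = C (t + s) (t + s) - C (u + s) (t + s) \<longleftrightarrow>
    (\<forall>k. S k t t - S k u t = S k (t + s) (t + s) - S k (u + s) (t + s))"
  by (simp add: vec_eq_iff C_def cross_covariance_eq)

lemma condition_ii:
  fixes mv
  defines "mv \<equiv> (\<lambda>t. \<integral>\<omega>. perp_part (\<xi> t \<omega>) \<partial>M)"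
  shows "stationary_process M (\<lambda>t \<omega>. perp_part (\<xi> t \<omega>) - mv t) \<longleftrightarrow> (\<forall>i k t u s. Z i k (t + s) (u + s) = Z i k t u)"
proof -
  let ?X = "\<lambda>t \<omega>. perp_part (\<xi> t \<omega>) - mv t"
  have Xi: "(\<lambda>\<omega>. ?X t \<omega> $ i) = (\<lambda>\<omega>. \<zeta> i t \<omega> - m i t)" for t i
    by (simp add: mv_def mean_perp)
  have XV: "(\<lambda>\<omega>. ?X t \<omega> $ i) \<in> V" for t i unfolding Xi by (intro diff perp_V const)
  have X0: "(\<integral>\<omega>. ?X t \<omega> $ i \<partial>M) = 0" for t i
    unfolding Xi by (simp add: mean_diff perp_V const m_def prob_space.prob_space[OF prob_space_axioms])
  have XX: "cov M (\<lambda>\<omega>. ?X t \<omega> $ i) (\<lambda>\<omega>. ?X u \<omega> $ k) = Z i k t u" for t i u k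
    unfolding Xi Z_def by (simp add: cov_diff cov_diff2 perp_V const diff)
  have Xm: "?X t \<in> borel_measurable M" for t by measurable
  show ?thesis
  proof
    assume st: "stationary_process M ?X"
    show "\<forall>i k t u s. Z i k (t + s) (u + s) = Z i k t u"
    proof (intro allI)
      fix i k t u s
      have c: "Z i k t u = (\<integral>\<omega>. ?X t \<omega> $ i * ?X u \<omega> $ k \<partial>M)" for t u
        using XX[of t i u k] unfolding cov_def X0 by simp
      let ?f = "\<lambda>y :: real \<Rightarrow> real^'d. y t $ i * y u $ k"
      have "(\<lambda>y :: real \<Rightarrow> real^'d. (axis i 1 \<bullet> y t) * (axis k 1 \<bullet> y u)) \<in> borel_measurable (\<Pi>\<^sub>M t\<in>UNIV. borel)"
        by measurable
      then have f: "?f \<in> borel_measurable (\<Pi>\<^sub>M t\<in>UNIV. borel)" by (simp add: inner_axis')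
      have "Z i k (t + s) (u + s) = (\<integral>y. ?f y \<partial>process_law M (\<lambda>t. ?X (t + s)))"
        unfolding c by (subst process_law_nn_integral[OF Xm f]) simp
      also have "process_law M (\<lambda>t. ?X (t + s)) = process_law M ?X" using st unfolding stationary_process_def by blast
      also have "(\<integral>y. ?f y \<partial>process_law M ?X) = Z i k t u"
        unfolding c by (subst process_law_nn_integral[OF Xm f]) simp
      finally show "Z i k (t + s) (u + s) = Z i k t u" .
    qed
  next
    assume Z: "\<forall>i k t u s. Z i k (t + s) (u + s) = Z i k t u"
    show "stationary_process M ?X"
      unfolding stationary_process_def
    proof
      fix s show "process_law M (\<lambda>t. ?X (t + s)) = process_law M ?X"
        by (rule vector_process_law_eqI[OF XV XV]) (simp_all only: X0 XX Z)
    qed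
  qed
qed

text \<open>In one direction \<open>W = \<eta> - E \<eta>\<close>; its increments are stationary because their covariances are
  polarised from their variances. In the other direction only the first two moments of the
  representation enter. For \<open>l \<noteq> 0\<close> the condition on the means of the increments follows from
  the value \<open>c - l/2 \<cdot> Var W(t)\<close> of the mean and the stationarity of the variances of increments.\<close>

lemma coordinate_representation:
  "(\<exists>(W :: real \<Rightarrow> 'a \<Rightarrow> real) b c.
      gaussian_process M W \<and> (\<forall>t. expectation (W t) = 0) \<and> stationary_increments M W \<and>
      (\<forall>t s. b (t + s) = b t + b s) \<and>
      (\<forall>t. AE \<omega> in M. \<eta> t \<omega> = (if l = 0 then W t \<omega> + b t + c else W t \<omega> - 1 / 2 * l * variance (W t) + c))) \<longleftrightarrow>
   (\<forall>t s. l * \<mu> (t + s) + l\<^sup>2 / 2 * R (t + s) (t + s) = l * \<mu> t + l\<^sup>2 / 2 * R t t) \<and>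
   (\<forall>t u s. \<mu> (u + s) - \<mu> (t + s) + l * (R (t + s) (u + s) - R (t + s) (t + s)) = \<mu> u - \<mu> t + l * (R t u - R t t)) \<and>
   (\<forall>t u s. R (u + s) (u + s) - 2 * R (t + s) (u + s) + R (t + s) (t + s) = R u u - 2 * R t u + R t t)"
  (is "?L \<longleftrightarrow> ?A \<and> ?B \<and> ?C")
proof
  assume ?L
  then obtain W b c where W: "gaussian_process M W" and W0: "\<And>t. expectation (W t) = 0" and inc: "stationary_increments M W"
    and b: "\<And>t s. b (t + s) = b t + b s"
    and \<eta>: "\<And>t. AE \<omega> in M. \<eta> t \<omega> = (if l = 0 then W t \<omega> + b t + c else W t \<omega> - 1 / 2 * l * variance (W t) + c)"
    by blast
  interpret W: gaussian_space M "process_span W" by (rule gaussian_space_process_span[OF prob_space_axioms W])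
  have WV: "W t \<in> process_span W" for t using inner_in_process_span[of 1 W t] by simp
  note [measurable] = W.meas[OF WV] meas[OF coord_mean_V]
  define \<beta> where "\<beta> t = (if l = 0 then b t + c else c - l / 2 * cov M (W t) (W t))" for t
  have \<eta>\<beta>: "AE \<omega> in M. \<eta> t \<omega> = W t \<omega> + \<beta> t" for t
    using \<eta>[of t] by eventually_elim (auto simp: \<beta>_def cov_def power2_eq_square W0)
  have mu: "\<mu> t = \<beta> t" for t
  proof -
    have "\<mu> t = (\<integral>\<omega>. W t \<omega> + \<beta> t \<partial>M)" unfolding \<mu>_def by (rule integral_cong_AE) (use \<eta>\<beta> in auto)
    also have "\<dots> = \<beta> t" using W.mean_add[OF WV W.const, of t "\<beta> t"] by (simp add: W0 prob_space.prob_space[OF prob_space_axioms])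
    finally show ?thesis .
  qed
  have Rw: "R t u = (\<integral>\<omega>. W t \<omega> * W u \<omega> \<partial>M)" for t u
    unfolding R_def cov_def
  proof (rule integral_cong_AE)
    show "AE \<omega> in M. (\<eta> t \<omega> - expectation (\<eta> t)) * (\<eta> u \<omega> - expectation (\<eta> u)) = W t \<omega> * W u \<omega>"
      using \<eta>\<beta>[of t] \<eta>\<beta>[of u] by eventually_elim (simp add: \<mu>_def[symmetric] mu)
  qed measurable
  have D: "(\<integral>\<omega>. (W u \<omega> - W t \<omega>)\<^sup>2 \<partial>M) = R u u - 2 * R t u + R t t" for t u
  proof -
    have "(\<integral>\<omega>. (W u \<omega> - W t \<omega>)\<^sup>2 \<partial>M) = (\<integral>\<omega>. W u \<omega> * W u \<omega> - 2 * (W t \<omega> * W u \<omega>) + W t \<omega> * W t \<omega> \<partial>M)"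
      by (intro Bochner_Integration.integral_cong) (simp_all add: power2_eq_square algebra_simps)
    also have "\<dots> = R u u - 2 * R t u + R t t"
      unfolding Rw using W.integrable_mult[OF WV WV] by simp
    finally show ?thesis .
  qed
  have C: ?C
  proof (intro allI)
    fix t u s
    have base: "(\<integral>\<omega>. (W (v + r) \<omega> - W r \<omega>)\<^sup>2 \<partial>M) = (\<integral>\<omega>. (W v \<omega> - W 0 \<omega>)\<^sup>2 \<partial>M)" for v r
    proof -
      let ?f = "\<lambda>y :: real \<Rightarrow> real. (y v)\<^sup>2"
      have f: "?f \<in> borel_measurable (\<Pi>\<^sub>M t\<in>UNIV. borel)" by measurable
      have m1: "(\<lambda>\<omega>. W (t + r) \<omega> - W r \<omega>) \<in> borel_measurable M" "(\<lambda>\<omega>. W t \<omega> - W 0 \<omega>) \<in> borel_measurable M" for t by measurable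
      have "(\<integral>\<omega>. (W (v + r) \<omega> - W r \<omega>)\<^sup>2 \<partial>M) = (\<integral>y. ?f y \<partial>process_law M (\<lambda>t \<omega>. W (t + r) \<omega> - W r \<omega>))"
        by (subst process_law_nn_integral[OF m1(1) f]) simp
      also have "process_law M (\<lambda>t \<omega>. W (t + r) \<omega> - W r \<omega>) = process_law M (\<lambda>t \<omega>. W t \<omega> - W 0 \<omega>)"
        using inc unfolding stationary_increments_def by blast
      also have "(\<integral>y. ?f y \<partial>\<dots>) = (\<integral>\<omega>. (W v \<omega> - W 0 \<omega>)\<^sup>2 \<partial>M)"
        by (subst process_law_nn_integral[OF m1(2) f]) simp
      finally show ?thesis .
    qed
    show "R (u + s) (u + s) - 2 * R (t + s) (u + s) + R (t + s) (t + s) = R u u - 2 * R t u + R t t"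
      unfolding D[symmetric] using base[of "u - t" "t + s"] base[of "u - t" t] by (simp add: add.commute)
  qed
  have cW: "cov M (W t) (W t) = R t t" for t unfolding Rw cov_def W0 by simp
  have A: ?A
    by (auto simp: mu \<beta>_def cW power2_eq_square algebra_simps)
  have B: ?B
  proof (intro allI)
    fix t u s
    show "\<mu> (u + s) - \<mu> (t + s) + l * (R (t + s) (u + s) - R (t + s) (t + s)) = \<mu> u - \<mu> t + l * (R t u - R t t)"
    proof (cases "l = 0")
      case True then show ?thesis by (simp add: mu \<beta>_def b)
    next
      case False
      have "\<mu> u - \<mu> t + l * (R t u - R t t) = - (l / 2) * (R u u - 2 * R t u + R t t)" for t u
        using False by (simp add: mu \<beta>_def cW field_simps)
      then show ?thesis using C by simp
    qed
  qed
  show "?A \<and> ?B \<and> ?C" using A B C by blast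
next
  assume ABC: "?A \<and> ?B \<and> ?C"
  then have A: "\<And>t s. l * \<mu> (t + s) + l\<^sup>2 / 2 * R (t + s) (t + s) = l * \<mu> t + l\<^sup>2 / 2 * R t t"
    and B: "\<And>t u s. \<mu> (u + s) - \<mu> (t + s) + l * (R (t + s) (u + s) - R (t + s) (t + s)) = \<mu> u - \<mu> t + l * (R t u - R t t)"
    and C: "\<And>t u s. R (u + s) (u + s) - 2 * R (t + s) (u + s) + R (t + s) (t + s) = R u u - 2 * R t u + R t t"
    by blast+
  define W where "W t \<omega> = \<eta> t \<omega> - \<mu> t" for t \<omega>
  have WV: "W t \<in> V" for t unfolding W_def by (intro diff coord_mean_V const)
  have W0: "expectation (W t) = 0" for t
    unfolding W_def by (simp add: mean_diff coord_mean_V const \<mu>_def prob_space.prob_space[OF prob_space_axioms])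
  have Wcov: "cov M (W t) (W u) = R t u" for t u
    unfolding W_def R_def by (simp add: cov_diff cov_diff2 coord_mean_V const diff)
  have Wvar: "variance (W t) = R t t" for t
    using Wcov[of t t] by (simp add: cov_def power2_eq_square)
  have g: "gaussian_process M W"
    unfolding gaussian_process_def using WV
    by (auto intro!: gaussian sum scale meas)
  have inc: "stationary_increments M W"
    unfolding stationary_increments_def
  proof
    fix s
    have cc: "cov M (\<lambda>\<omega>. W t \<omega> - W s \<omega>) (\<lambda>\<omega>. W u \<omega> - W s \<omega>) =
      ((R t t - 2 * R s t + R s s) + (R u u - 2 * R s u + R s s) - (R u u - 2 * R t u + R t t)) / 2" for t u s
      by (simp add: cov_diff cov_diff2 diff WV Wcov R_commute[of t s] field_simps)
    show "process_law M (\<lambda>t \<omega>. W (t + s) \<omega> - W s \<omega>) = process_law M (\<lambda>t \<omega>. W t \<omega> - W 0 \<omega>)"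
    proof (rule real_process_law_eqI)
      show "cov M (\<lambda>\<omega>. W (t + s) \<omega> - W s \<omega>) (\<lambda>\<omega>. W (u + s) \<omega> - W s \<omega>) = cov M (\<lambda>\<omega>. W t \<omega> - W 0 \<omega>) (\<lambda>\<omega>. W u \<omega> - W 0 \<omega>)" for t u
        unfolding cc using C[of t s 0] C[of u s 0] C[of u s t] by simp
    qed (auto intro!: diff WV simp: mean_diff WV W0)
  qed
  show ?L
  proof (cases "l = 0")
    case True
    define b where "b t = \<mu> t - \<mu> 0" for t
    have "b (t + s) = b t + b s" for t s
      using B[of t s 0] True by (simp add: b_def)
    then show ?thesis using g W0 inc True
      by (intro exI[of _ W] exI[of _ b] exI[of _ "\<mu> 0"]) (auto simp: W_def b_def)
  next
    case False
    define c where "c = \<mu> 0 + l / 2 * R 0 0"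
    have "\<mu> t = c - 1 / 2 * l * R t t" for t
    proof -
      have "l * (\<mu> t + l / 2 * R t t) = l * c" using A[of 0 t] by (simp add: c_def power2_eq_square algebra_simps)
      then have "\<mu> t + l / 2 * R t t = c" using False by (simp only: mult_cancel_left) simp
      then show ?thesis by simp
    qed
    then have "\<eta> t \<omega> = W t \<omega> - 1 / 2 * l * variance (W t) + c" for t \<omega>
      unfolding Wvar by (simp add: W_def)
    then show ?thesis using g W0 inc False
      by (intro exI[of _ W] exI[of _ "\<lambda>_. 0"] exI[of _ c]) auto
  qed
qed

end

lemma gaussian_systemI:
  fixes \<xi> :: "real \<Rightarrow> 'a \<Rightarrow> real^'d"
  assumes M: "prob_space M" and g: "gaussian_process M \<xi>" and lf: "locally_finite_measure \<Lambda>"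
    and diag: "emeasure \<Lambda> (- diagonal) = 0" and nz: "emeasure \<Lambda> UNIV \<noteq> 0"
    and conv: "\<forall>t. locally_finite_measure (\<Lambda> \<star> distr M borel (\<xi> t))"
  shows "gaussian_system M \<xi> \<Lambda>"
proof -
  interpret prob_space M by fact
  have [measurable]: "\<xi> t \<in> borel_measurable M" for t using g by (simp add: gaussian_process_def)
  have s[measurable_cong]: "sets \<Lambda> = sets borel" using lf by (simp add: locally_finite_measure_def)
  show ?thesis
  proof unfold_locales
    show "emeasure \<Lambda> (cball 0 R) < \<infinity>" for R using lf by (simp add: locally_finite_measure_def)
    show "(\<integral>\<^sup>+x. \<integral>\<^sup>+\<omega>. indicator (cball 0 R) (x + \<xi> t \<omega>) \<partial>M \<partial>\<Lambda>) < \<infinity>" for R t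
    proof -
      let ?D = "distr M borel (\<xi> t)"
      interpret D: prob_space ?D by (rule prob_space_distr) simp
      have m: "cball 0 R \<in> sets (borel :: (real^'d) measure)" by (rule borel_closed[OF closed_cball])
      note [measurable] = m borel_measurable_indicator[OF m]
      have "emeasure (\<Lambda> \<star> ?D) (cball 0 R) = (\<integral>\<^sup>+z. indicator (cball 0 R) z \<partial>(\<Lambda> \<star> ?D))"
        using m by (intro nn_integral_indicator[symmetric]) (simp add: convolution_def)
      also have "\<dots> = (\<integral>\<^sup>+p. indicator (cball 0 R) (case p of (x, y) \<Rightarrow> x + y) \<partial>(\<Lambda> \<Otimes>\<^sub>M ?D))"
        unfolding convolution_def by (rule nn_integral_distr) measurable
      also have "\<dots> = (\<integral>\<^sup>+x. \<integral>\<^sup>+y. indicator (cball 0 R) (x + y) \<partial>?D \<partial>\<Lambda>)"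
        by (subst D.nn_integral_fst[symmetric]) (auto simp: split_beta)
      also have "\<dots> = (\<integral>\<^sup>+x. \<integral>\<^sup>+\<omega>. indicator (cball 0 R) (x + \<xi> t \<omega>) \<partial>M \<partial>\<Lambda>)"
        by (intro nn_integral_cong nn_integral_distr) measurable
      finally have "(\<integral>\<^sup>+x. \<integral>\<^sup>+\<omega>. indicator (cball 0 R) (x + \<xi> t \<omega>) \<partial>M \<partial>\<Lambda>) = emeasure (\<Lambda> \<star> ?D) (cball 0 R)"
        by (rule sym)
      moreover have "emeasure (\<Lambda> \<star> ?D) (cball 0 R) < \<infinity>"
        using conv compact_cball unfolding locally_finite_measure_def by blast
      ultimately show ?thesis by simp
    qed
  qed (fact g s diag nz)+
qed

theorem theorem5p3:
  fixes M :: "'a measure" and \<xi> :: "real \<Rightarrow> 'a \<Rightarrow> real^'d"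
    and \<Lambda> :: "(real^'d) measure"
    and P :: "'o measure" and K :: "'o \<Rightarrow> enat" and x :: "nat \<Rightarrow> 'o \<Rightarrow> real^'d"
    and Y :: "nat \<Rightarrow> real \<Rightarrow> 'o \<Rightarrow> real^'d"
  defines "m \<equiv> (\<lambda>t. integral\<^sup>L M (\<lambda>\<omega>. perp_part (\<xi> t \<omega>)))"
    and "C \<equiv> (\<lambda>t1 t2. cross_covariance M (\<lambda>\<omega>. diag_part (\<xi> t1 \<omega>)) (\<lambda>\<omega>. perp_part (\<xi> t2 \<omega>)))"
  assumes "prob_space M"
    and "gaussian_process M \<xi>"
    and "\<exists>v. v \<notin> diagonal \<and> \<not> stationary_process M (\<lambda>t \<omega>. v \<bullet> \<xi> t \<omega>)"
    and "locally_finite_measure \<Lambda>"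
    and "emeasure \<Lambda> (- diagonal) = 0"
    and "emeasure \<Lambda> UNIV \<noteq> 0"
    and "\<forall>t. locally_finite_measure (\<Lambda> \<star> distr M borel (\<xi> t))"
    and "particle_data \<Lambda> M \<xi> P K x Y"
  shows "stationary_particle_system P K x Y \<longleftrightarrow>
    (\<exists>l::real.
       (\<exists>a>0. \<Lambda> = scale_measure (ennreal a) (exp_diagonal l)) \<and>
       (\<exists>(W :: real \<Rightarrow> 'a \<Rightarrow> real) (b :: real \<Rightarrow> real) (c :: real).
          gaussian_process M W \<and>
          (\<forall>t. prob_space.expectation M (W t) = 0) \<and>
          stationary_increments M W \<and>
          (\<forall>t s. b (t + s) = b t + b s) \<and>
          (\<forall>t. AE \<omega> in M. coord_mean (\<xi> t \<omega>) =
             (if l = 0 then W t \<omega> + b t + c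
              else W t \<omega> - 1 / 2 * l * prob_space.variance M (W t) + c))) \<and>
       stationary_process M (\<lambda>t \<omega>. perp_part (\<xi> t \<omega>) - m t) \<and>
       (\<forall>s t1 t2. C t1 t1 - C t2 t1 = C (t1 + s) (t1 + s) - C (t2 + s) (t1 + s)) \<and>
       (\<forall>s t1 t2. m t2 + transpose (C t1 t2) *v diag_vec l =
                  m (t2 + s) + transpose (C (t1 + s) (t2 + s)) *v diag_vec l))"
proof -
  interpret G: gaussian_system M \<xi> \<Lambda>
    by (rule gaussian_systemI) fact+
  have st: "stationary_particle_system P K x Y \<longleftrightarrow>
      (\<forall>n\<ge>1. \<forall>s t. intensity \<Lambda> M \<xi> n t = intensity \<Lambda> M \<xi> n (\<lambda>j. t j + s))"
    by (rule stationary_particle_system_iff[OF assms(10,3) G.measurable_xi G.sets_Lambda])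
  have "stationary_particle_system P K x Y \<longleftrightarrow>
      (\<exists>l. (\<exists>a>0. \<Lambda> = scale_measure (ennreal a) (exp_diagonal l)) \<and> G.moment_conditions l)"
  proof
    assume "stationary_particle_system P K x Y"
    then have I: "\<forall>n\<ge>1. \<forall>s t. intensity \<Lambda> M \<xi> n t = intensity \<Lambda> M \<xi> n (\<lambda>j. t j + s)" unfolding st .
    obtain l a where "a > 0" "\<Lambda> = scale_measure (ennreal a) (exp_diagonal l)"
      using G.exponential_of_stationary_pairs[OF G.stationary_pairs_of_intensity[OF I]] assms(5) by blast
    then show "\<exists>l. (\<exists>a>0. \<Lambda> = scale_measure (ennreal a) (exp_diagonal l)) \<and> G.moment_conditions l"
      using G.moment_conditions_of_intensity[OF _ _ I] by blast
  next
    assume "\<exists>l. (\<exists>a>0. \<Lambda> = scale_measure (ennreal a) (exp_diagonal l)) \<and> G.moment_conditions l"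
    then show "stationary_particle_system P K x Y"
      unfolding st using G.intensity_eq_of_moment_conditions by blast
  qed
  moreover have "G.moment_conditions l \<longleftrightarrow>
       (\<exists>(W :: real \<Rightarrow> 'a \<Rightarrow> real) (b :: real \<Rightarrow> real) (c :: real).
          gaussian_process M W \<and>
          (\<forall>t. prob_space.expectation M (W t) = 0) \<and>
          stationary_increments M W \<and>
          (\<forall>t s. b (t + s) = b t + b s) \<and>
          (\<forall>t. AE \<omega> in M. coord_mean (\<xi> t \<omega>) =
             (if l = 0 then W t \<omega> + b t + c
              else W t \<omega> - 1 / 2 * l * prob_space.variance M (W t) + c))) \<and>
       stationary_process M (\<lambda>t \<omega>. perp_part (\<xi> t \<omega>) - m t) \<and>
       (\<forall>s t1 t2. C t1 t1 - C t2 t1 = C (t1 + s) (t1 + s) - C (t2 + s) (t1 + s)) \<and>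
       (\<forall>s t1 t2. m t2 + transpose (C t1 t2) *v diag_vec l =
                  m (t2 + s) + transpose (C (t1 + s) (t2 + s)) *v diag_vec l)" for l
    unfolding m_def C_def G.condition_ii G.condition_iii G.condition_iv G.coordinate_representation G.moment_conditions_def
    by (auto simp: eq_commute)
  ultimately show ?thesis by simp
qed

end
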